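(* Let $\mathcal{T}=(T(t))_{t\ge0}$ be a bounded $C_0$-semigroup on a Banach space $X$ with infinitesimal generator $A$, and let $x\in X$. The following statements are equivalent: (a) the orbit $T(t)x$ is stable, i.e. $\lim_{t\to\infty}\|T(t)x\|_X=0$; (b) $\sigma_{PF}(A,x)=\varnothing$; (c) $\sigma_{PF}(A,x)$ is countable and $x\in\overline{\operatorname{Rg}(i\xi-A)}$ for each $i\xi\in\sigma_{PF}(A,x)$; (d) $\sigma_{PF}(A,x)$ is countable and $\lim_{\alpha\to0^+}\alpha R(\alpha+i\xi,A)x=0$ in norm for each $i\xi\in\sigma_{PF}(A,x)$; (e) $\sigma_{PF}(A,x)$ is countable and $\alpha R(\alpha+i\xi,A)x\to0$ weakly in $X$ as $\alpha\to0^+$ for each $i\xi\in\sigma_{PF}(A,x)$.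
   Context: Vector-valued distributions: for a Banach space $Z$ and an open set $I\subseteq\mathbb{R}$, $\mathcal{D}'(I;Z)$ is the space of continuous linear maps $\mathcal{D}(I)=C_c^\infty(I)\to Z$, and $\mathcal{S}'(\mathbb{R};Z)$ is the space of continuous linear maps $\mathcal{S}(\mathbb{R})\to Z$ (Schwartz space). The Fourier transform is $\widehat{\varphi}(\xi)=\int_{-\infty}^{\infty}e^{-i\xi t}\varphi(t)\,dt$ on $\mathcal{S}(\mathbb{R})$, extended to $\mathcal{S}'(\mathbb{R};Z)$ by $\langle\widehat f,\varphi\rangle=\langle f,\widehat\varphi\rangle$. $C_0(\mathbb{R};Z)$ is the space of continuous $Z$-valued functions vanishing at infinity, and $PF(\mathbb{R};Z)=\{\widehat g: g\in C_0(\mathbb{R};Z)\}$. A distribution $f\in\mathcal{D}'(I;Z)$ is a local pseudofunction on $I$ if each $\xi_0\in I$ has an open neighborhood $I'\subseteq I$ on which $f$ coincides with an element of $PF(\mathbb{R};Z)$. For $f\in\mathcal{D}'(\mathbb{R};Z)$, $\operatorname{sing\,supp}_{PF}f$ is the complement in $\mathbb{R}$ of the largest open set on which $f$ is a local pseudofunction. Semigroups: $\mathcal{T}$ is bounded if $\sup_{t\ge0}\|T(t)\|_{L(X)}<\infty$; $R(\lambda,A)=(\lambda-A)^{-1}$ is the resolvent and $\operatorname{Rg}$ denotes range. For bounded $\mathcal{T}$ and $x\in X$, the limit $\langle R(i\xi,A)x,\varphi(\xi)\rangle=\lim_{\alpha\to0^+}\int_{-\infty}^\infty\varphi(\xi)R(\alpha+i\xi,A)x\,d\xi$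 defines $R(i\,\cdot,A)x\in\mathcal{S}'(\mathbb{R};X)$ (it is the Fourier transform of $t\mapsto T(t)x$, extended by $0$ to $t<0$). The local pseudofunction spectrum of $A$ at $x$ is $\sigma_{PF}(A,x)=i\operatorname{sing\,supp}_{PF}R(i\,\cdot,A)x\subseteq i\mathbb{R}$. Countable includes finite and empty. *)

theory Defs
  imports "HOL-Analysis.Analysis"
begin

section \<open>Complex Banach spaces\<close>

class complex_normed_vector = real_normed_vector +
  fixes scaleC :: "complex \<Rightarrow> 'a \<Rightarrow> 'a"  (infixr "*\<^sub>C" 75)
  assumes scaleC_add_right: "a *\<^sub>C (x + y) = a *\<^sub>C x + a *\<^sub>C y"
    and scaleC_add_left: "(a + b) *\<^sub>C x = a *\<^sub>C x + b *\<^sub>C x"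
    and scaleC_scaleC: "a *\<^sub>C b *\<^sub>C x = (a * b) *\<^sub>C x"
    and scaleR_scaleC: "r *\<^sub>R x = complex_of_real r *\<^sub>C x"
    and norm_scaleC: "norm (a *\<^sub>C x) = cmod a * norm x"

class complex_banach = complex_normed_vector + complete_space

subclass (in complex_banach) banach ..

instantiation complex :: complex_banach
begin

definition scaleC_complex :: "complex \<Rightarrow> complex \<Rightarrow> complex"
  where "scaleC_complex = (*)"

instance
  by standard (auto simp: scaleC_complex_def algebra_simps norm_mult scaleR_conv_of_real)

end

definition bounded_clinear :: "('a::complex_normed_vector \<Rightarrow> 'b::complex_normed_vector) \<Rightarrow> bool"
  where "bounded_clinear f \<longleftrightarrow> bounded_linear f \<and> (\<forall>c x. f (c *\<^sub>C x) = c *\<^sub>C f x)"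

definition weakly_tendsto :: "('i \<Rightarrow> 'a::complex_normed_vector) \<Rightarrow> 'a \<Rightarrow> 'i filter \<Rightarrow> bool"
  where "weakly_tendsto u l F \<longleftrightarrow>
    (\<forall>x' :: 'a \<Rightarrow> complex. bounded_clinear x' \<longrightarrow> ((\<lambda>i. x' (u i)) \<longlongrightarrow> x' l) F)"


section \<open>Test functions and vector-valued distributions\<close>

definition nth_deriv :: "nat \<Rightarrow> (real \<Rightarrow> complex) \<Rightarrow> real \<Rightarrow> complex"
  where "nth_deriv n = (\<lambda>\<phi> t. vector_derivative \<phi> (at t)) ^^ n"

definition smooth :: "(real \<Rightarrow> complex) \<Rightarrow> bool"
  where "smooth \<phi> \<longleftrightarrow> (\<forall>n t. nth_deriv n \<phi> differentiable (at t))"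

definition test_functions :: "real set \<Rightarrow> (real \<Rightarrow> complex) set"
  where "test_functions I =
    {\<phi>. smooth \<phi> \<and> compact (closure {t. \<phi> t \<noteq> 0}) \<and> closure {t. \<phi> t \<noteq> 0} \<subseteq> I}"

text \<open>The usual inductive limit topology on test functions: the finest locally convex topology
  for which every inclusion of the functions supported in a fixed compact subset is continuous.
  A base of neighbourhoods of 0 is formed by the absolutely convex sets whose trace on the
  functions supported in \<open>K\<close> is a neighbourhood of 0 there, for every compact \<open>K\<close>.\<close>

definition basic_nbhd_0 :: "real set \<Rightarrow> (real \<Rightarrow> complex) set \<Rightarrow> bool"
  where "basic_nbhd_0 I V \<longleftrightarrow> V \<subseteq> test_functions I \<and>
    (\<forall>\<phi>\<in>V. \<forall>\<psi>\<in>V. \<forall>a b. cmod a + cmod b \<le> 1 \<longrightarrow> (\<lambda>t. a * \<phi> t + b * \<psi> t) \<in> V) \<and>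
    (\<forall>K. compact K \<and> K \<subseteq> I \<longrightarrow>
      (\<exists>N. \<exists>\<epsilon>>0. \<forall>\<phi>\<in>test_functions K.
         (\<forall>n\<le>N. \<forall>t. cmod (nth_deriv n \<phi> t) < \<epsilon>) \<longrightarrow> \<phi> \<in> V))"

definition test_topology :: "real set \<Rightarrow> (real \<Rightarrow> complex) topology"
  where "test_topology I = topology (\<lambda>U. U \<subseteq> test_functions I \<and>
    (\<forall>\<phi>\<in>U. \<exists>V. basic_nbhd_0 I V \<and> (\<forall>\<psi>\<in>V. (\<lambda>t. \<phi> t + \<psi> t) \<in> U)))"

lemma basic_nbhd_0_Int:
  assumes "basic_nbhd_0 I V" "basic_nbhd_0 I W"
  shows "basic_nbhd_0 I (V \<inter> W)"
proof -
  have "\<exists>N. \<exists>\<epsilon>>0. \<forall>\<phi>\<in>test_functions K.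
         (\<forall>n\<le>N. \<forall>t. cmod (nth_deriv n \<phi> t) < \<epsilon>) \<longrightarrow> \<phi> \<in> V \<inter> W"
    if K: "compact K" "K \<subseteq> I" for K
  proof -
    obtain N \<epsilon> where 1: "\<epsilon> > 0" "\<And>\<phi>. \<phi>\<in>test_functions K \<Longrightarrow>
         (\<forall>n\<le>N. \<forall>t. cmod (nth_deriv n \<phi> t) < \<epsilon>) \<Longrightarrow> \<phi> \<in> V"
      using assms(1) K unfolding basic_nbhd_0_def by metis
    obtain M \<delta> where 2: "\<delta> > 0" "\<And>\<phi>. \<phi>\<in>test_functions K \<Longrightarrow>
         (\<forall>n\<le>M. \<forall>t. cmod (nth_deriv n \<phi> t) < \<delta>) \<Longrightarrow> \<phi> \<in> W"
      using assms(2) K unfolding basic_nbhd_0_def by metis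
    show ?thesis
      by (rule exI[of _ "max N M"], rule exI[of _ "min \<epsilon> \<delta>"]) (use 1 2 in auto)
  qed
  moreover have "V \<inter> W \<subseteq> test_functions I"
    using assms unfolding basic_nbhd_0_def by blast
  moreover have "(\<lambda>t. a * \<phi> t + b * \<psi> t) \<in> V \<inter> W"
    if "\<phi> \<in> V \<inter> W" "\<psi> \<in> V \<inter> W" "cmod a + cmod b \<le> 1" for \<phi> \<psi> a b
    using assms that unfolding basic_nbhd_0_def by simp
  ultimately show ?thesis
    unfolding basic_nbhd_0_def by (intro conjI ballI allI impI) simp_all
qed

lemma openin_test_topology:
  "openin (test_topology I) U \<longleftrightarrow> U \<subseteq> test_functions I \<and>
    (\<forall>\<phi>\<in>U. \<exists>V. basic_nbhd_0 I V \<and> (\<forall>\<psi>\<in>V. (\<lambda>t. \<phi> t + \<psi> t) \<in> U))"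
proof -
  let ?P = "\<lambda>U. U \<subseteq> test_functions I \<and>
    (\<forall>\<phi>\<in>U. \<exists>V. basic_nbhd_0 I V \<and> (\<forall>\<psi>\<in>V. (\<lambda>t. \<phi> t + \<psi> t) \<in> U))"
  have "istopology ?P"
    unfolding istopology_def
  proof (intro conjI allI impI)
    fix S T assume S: "?P S" and T: "?P T"
    show "S \<inter> T \<subseteq> test_functions I" using S by blast
    show "\<forall>\<phi>\<in>S \<inter> T. \<exists>V. basic_nbhd_0 I V \<and> (\<forall>\<psi>\<in>V. (\<lambda>t. \<phi> t + \<psi> t) \<in> S \<inter> T)"
    proof
      fix \<phi> assume "\<phi> \<in> S \<inter> T"
      then obtain V W where "basic_nbhd_0 I V" "\<forall>\<psi>\<in>V. (\<lambda>t. \<phi> t + \<psi> t) \<in> S"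
        "basic_nbhd_0 I W" "\<forall>\<psi>\<in>W. (\<lambda>t. \<phi> t + \<psi> t) \<in> T"
        using S T by blast
      then show "\<exists>V. basic_nbhd_0 I V \<and> (\<forall>\<psi>\<in>V. (\<lambda>t. \<phi> t + \<psi> t) \<in> S \<inter> T)"
        using basic_nbhd_0_Int by blast
    qed
  next
    fix \<K> assume K: "\<forall>S\<in>\<K>. ?P S"
    then show "\<Union>\<K> \<subseteq> test_functions I" by blast
    show "\<forall>\<phi>\<in>\<Union>\<K>. \<exists>V. basic_nbhd_0 I V \<and> (\<forall>\<psi>\<in>V. (\<lambda>t. \<phi> t + \<psi> t) \<in> \<Union>\<K>)"
      using K by (meson Union_iff)
  qed
  then show ?thesis
    unfolding test_topology_def by (simp add: topology_inverse')
qed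

definition distributions :: "real set \<Rightarrow> ((real \<Rightarrow> complex) \<Rightarrow> 'z::complex_banach) set"
  where "distributions I = {f. continuous_map (test_topology I) euclidean f \<and>
    (\<forall>\<phi>\<in>test_functions I. \<forall>\<psi>\<in>test_functions I. f (\<lambda>t. \<phi> t + \<psi> t) = f \<phi> + f \<psi>) \<and>
    (\<forall>\<phi>\<in>test_functions I. \<forall>c. f (\<lambda>t. c * \<phi> t) = c *\<^sub>C f \<phi>)}"


section \<open>Pseudofunctions\<close>

definition fourier :: "(real \<Rightarrow> complex) \<Rightarrow> real \<Rightarrow> complex"
  where "fourier \<phi> \<xi> = integral UNIV (\<lambda>t. exp (- \<i> * of_real \<xi> * of_real t) * \<phi> t)"

text \<open>Integrals of vector-valued functions are gauge integrals, since the library's Bochner integral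
  is restricted to separable spaces. All integrands below are continuous and absolutely integrable
  in norm, so that the two notions agree.\<close>

definition distr_of_fun :: "(real \<Rightarrow> 'z::complex_banach) \<Rightarrow> (real \<Rightarrow> complex) \<Rightarrow> 'z"
  where "distr_of_fun g \<phi> = integral UNIV (\<lambda>t. \<phi> t *\<^sub>C g t)"

definition fourier_distr :: "((real \<Rightarrow> complex) \<Rightarrow> 'z) \<Rightarrow> (real \<Rightarrow> complex) \<Rightarrow> 'z"
  where "fourier_distr f \<phi> = f (fourier \<phi>)"

definition C0_functions :: "(real \<Rightarrow> 'z::complex_banach) set"
  where "C0_functions = {g. continuous_on UNIV g \<and> (g \<longlongrightarrow> 0) at_infinity}"

definition pseudofunctions :: "((real \<Rightarrow> complex) \<Rightarrow> 'z::complex_banach) set"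
  where "pseudofunctions = (\<lambda>g. fourier_distr (distr_of_fun g)) ` C0_functions"

definition local_pseudofunction_on :: "real set \<Rightarrow> ((real \<Rightarrow> complex) \<Rightarrow> 'z::complex_banach) \<Rightarrow> bool"
  where "local_pseudofunction_on I f \<longleftrightarrow> f \<in> distributions I \<and>
    (\<forall>\<xi>\<in>I. \<exists>I'. open I' \<and> \<xi> \<in> I' \<and> I' \<subseteq> I \<and>
      (\<exists>h\<in>pseudofunctions. \<forall>\<phi>\<in>test_functions I'. f \<phi> = h \<phi>))"

definition sing_supp_PF :: "((real \<Rightarrow> complex) \<Rightarrow> 'z::complex_banach) \<Rightarrow> real set"
  where "sing_supp_PF f = - \<Union>{I. open I \<and> local_pseudofunction_on I f}"

text \<open>The union above is indeed the largest open set on which \<open>f\<close> is a local pseudofunction.\<close>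

lemma test_functions_mono: "I \<subseteq> J \<Longrightarrow> test_functions I \<subseteq> test_functions J"
  unfolding test_functions_def by blast

lemma smooth_lincomb:
  assumes "smooth \<phi>" "smooth \<psi>"
  shows "smooth (\<lambda>t. a * \<phi> t + b * \<psi> t)"
proof -
  have *: "nth_deriv n (\<lambda>t. a * \<phi> t + b * \<psi> t) = (\<lambda>t. a * nth_deriv n \<phi> t + b * nth_deriv n \<psi> t)" for n
  proof (induction n)
    case 0
    show ?case by (simp add: nth_deriv_def)
  next
    case (Suc n)
    have S: "nth_deriv (Suc n) h t = vector_derivative (nth_deriv n h) (at t)" for h t
      by (simp add: nth_deriv_def)
    have "((\<lambda>t. a * nth_deriv n \<phi> t + b * nth_deriv n \<psi> t) has_vector_derivative
            a * nth_deriv (Suc n) \<phi> t + b * nth_deriv (Suc n) \<psi> t) (at t)" for t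
      unfolding S using assms unfolding smooth_def
      by (intro has_vector_derivative_add has_vector_derivative_mult_right)
         (auto simp: vector_derivative_works[symmetric])
    then show ?case
      by (auto simp: S Suc vector_derivative_at)
  qed
  show ?thesis
    using assms unfolding smooth_def * by (intro allI derivative_intros) auto
qed

lemma test_functions_lincomb:
  assumes "\<phi> \<in> test_functions I" "\<psi> \<in> test_functions I"
  shows "(\<lambda>t. a * \<phi> t + b * \<psi> t) \<in> test_functions I"
proof -
  let ?S = "\<lambda>h :: real \<Rightarrow> complex. closure {t. h t \<noteq> 0}"
  have *: "?S (\<lambda>t. a * \<phi> t + b * \<psi> t) \<subseteq> ?S \<phi> \<union> ?S \<psi>"
    unfolding closure_Un[symmetric] by (intro closure_mono) auto
  have "compact (?S \<phi> \<union> ?S \<psi>)"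
    using assms unfolding test_functions_def by (intro compact_Un) simp_all
  then have "compact ((?S \<phi> \<union> ?S \<psi>) \<inter> ?S (\<lambda>t. a * \<phi> t + b * \<psi> t))"
    by (rule compact_Int_closed) (rule closed_closure)
  then have "compact (?S (\<lambda>t. a * \<phi> t + b * \<psi> t))"
    unfolding inf_absorb2[OF *] .
  then show ?thesis
    using assms * smooth_lincomb[of \<phi> \<psi> a b] unfolding test_functions_def mem_Collect_eq
    by (meson Un_least subset_trans)
qed

lemma basic_nbhd_0_restrict:
  assumes "basic_nbhd_0 J V" "I \<subseteq> J"
  shows "basic_nbhd_0 I (V \<inter> test_functions I)"
proof -
  have "\<exists>N. \<exists>\<epsilon>>0. \<forall>\<phi>\<in>test_functions K.
         (\<forall>n\<le>N. \<forall>t. cmod (nth_deriv n \<phi> t) < \<epsilon>) \<longrightarrow> \<phi> \<in> V \<inter> test_functions I"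
    if K: "compact K" "K \<subseteq> I" for K
  proof -
    have "K \<subseteq> J" using K assms by blast
    then obtain N \<epsilon> where "\<epsilon> > 0" "\<forall>\<phi>\<in>test_functions K.
         (\<forall>n\<le>N. \<forall>t. cmod (nth_deriv n \<phi> t) < \<epsilon>) \<longrightarrow> \<phi> \<in> V"
      using assms(1) K unfolding basic_nbhd_0_def by metis
    then show ?thesis using test_functions_mono[OF K(2)] by blast
  qed
  moreover have "(\<lambda>t. a * \<phi> t + b * \<psi> t) \<in> V \<inter> test_functions I"
    if "\<phi> \<in> V \<inter> test_functions I" "\<psi> \<in> V \<inter> test_functions I" "cmod a + cmod b \<le> 1"
    for \<phi> \<psi> a b
    using assms that test_functions_lincomb[of \<phi> I \<psi> a b] unfolding basic_nbhd_0_def by simp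
  ultimately show ?thesis
    unfolding basic_nbhd_0_def by (intro conjI ballI allI impI) simp_all
qed

lemma topspace_test_topology: "topspace (test_topology I) = test_functions I"
proof
  show "topspace (test_topology I) \<subseteq> test_functions I"
    using openin_test_topology openin_topspace by blast
  have "basic_nbhd_0 I (test_functions I)"
    unfolding basic_nbhd_0_def
  proof (intro conjI ballI allI impI subset_refl test_functions_lincomb)
    fix K assume "compact K \<and> K \<subseteq> I"
    then show "\<exists>N. \<exists>\<epsilon>>0. \<forall>\<phi>\<in>test_functions K.
        (\<forall>n\<le>N. \<forall>t. cmod (nth_deriv n \<phi> t) < \<epsilon>) \<longrightarrow> \<phi> \<in> test_functions I"
      using test_functions_mono[of K I] by (intro exI[of _ "0::nat"] exI[of _ "1::real"]) auto
  qed
  moreover have "(\<lambda>t. \<phi> t + \<psi> t) \<in> test_functions I"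
    if "\<phi> \<in> test_functions I" "\<psi> \<in> test_functions I" for \<phi> \<psi>
    using test_functions_lincomb[OF that, of 1 1] by simp
  ultimately have "openin (test_topology I) (test_functions I)"
    unfolding openin_test_topology by blast
  then show "test_functions I \<subseteq> topspace (test_topology I)"
    by (rule openin_subset)
qed

lemma distributions_restrict:
  assumes f: "f \<in> distributions J" and "I \<subseteq> J"
  shows "f \<in> distributions I"
proof -
  note sub = test_functions_mono[OF \<open>I \<subseteq> J\<close>]
  have "openin (test_topology I) {\<phi> \<in> test_functions I. f \<phi> \<in> W}" if "open W" for W
    unfolding openin_test_topology
  proof (intro conjI ballI)
    fix \<phi> assume \<phi>: "\<phi> \<in> {\<phi> \<in> test_functions I. f \<phi> \<in> W}"
    have "openin (test_topology J) {\<phi> \<in> test_functions J. f \<phi> \<in> W}"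
      using f that by (auto simp: distributions_def continuous_map_def topspace_test_topology)
    then obtain V where V: "basic_nbhd_0 J V" "\<forall>\<psi>\<in>V. f (\<lambda>t. \<phi> t + \<psi> t) \<in> W"
      using \<phi> sub unfolding openin_test_topology by blast
    have "(\<lambda>t. \<phi> t + \<psi> t) \<in> test_functions I" if "\<psi> \<in> test_functions I" for \<psi>
      using test_functions_lincomb[of \<phi> I \<psi> 1 1] \<phi> that by simp
    then show "\<exists>V. basic_nbhd_0 I V \<and>
        (\<forall>\<psi>\<in>V. (\<lambda>t. \<phi> t + \<psi> t) \<in> {\<phi> \<in> test_functions I. f \<phi> \<in> W})"
      using V basic_nbhd_0_restrict[OF V(1) \<open>I \<subseteq> J\<close>] by blast
  qed auto
  then have "continuous_map (test_topology I) euclidean f"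
    by (simp add: continuous_map_def topspace_test_topology)
  with f sub show ?thesis
    unfolding distributions_def by (simp add: subset_iff)
qed

lemma open_largest_local_pseudofunction:
  assumes "f \<in> distributions UNIV"
  shows "local_pseudofunction_on (\<Union>{I. open I \<and> local_pseudofunction_on I f}) f"
  unfolding local_pseudofunction_on_def[of "\<Union>_"]
proof (intro conjI ballI)
  show "f \<in> distributions (\<Union>{I. open I \<and> local_pseudofunction_on I f})"
    using distributions_restrict[OF assms] by blast
next
  fix \<xi> assume "\<xi> \<in> \<Union>{I. open I \<and> local_pseudofunction_on I f}"
  then obtain I where I: "open I" "local_pseudofunction_on I f" "\<xi> \<in> I" by blast
  then obtain I' where "open I'" "\<xi> \<in> I'" "I' \<subseteq> I"
      "\<exists>h\<in>pseudofunctions. \<forall>\<phi>\<in>test_functions I'. f \<phi> = h \<phi>"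
    unfolding local_pseudofunction_on_def by blast
  then show "\<exists>I'. open I' \<and> \<xi> \<in> I' \<and> I' \<subseteq> \<Union>{I. open I \<and> local_pseudofunction_on I f} \<and>
      (\<exists>h\<in>pseudofunctions. \<forall>\<phi>\<in>test_functions I'. f \<phi> = h \<phi>)"
    using I by blast
qed


section \<open>Semigroups, generators and resolvents\<close>

definition C0_semigroup :: "(real \<Rightarrow> 'a::complex_banach \<Rightarrow> 'a) \<Rightarrow> bool"
  where "C0_semigroup T \<longleftrightarrow>
    (\<forall>t\<ge>0. bounded_clinear (T t)) \<and>
    T 0 = id \<and>
    (\<forall>s\<ge>0. \<forall>t\<ge>0. T (s + t) = T s \<circ> T t) \<and>
    (\<forall>x. ((\<lambda>t. T t x) \<longlongrightarrow> x) (at_right 0))"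

definition bounded_semigroup :: "(real \<Rightarrow> 'a::complex_banach \<Rightarrow> 'a) \<Rightarrow> bool"
  where "bounded_semigroup T \<longleftrightarrow> bdd_above ((\<lambda>t. onorm (T t)) ` {0..})"

text \<open>An unbounded operator is represented by its graph.\<close>

definition generator :: "(real \<Rightarrow> 'a::complex_banach \<Rightarrow> 'a) \<Rightarrow> ('a \<times> 'a) set"
  where "generator T = {(u, v). ((\<lambda>t. (1 / t) *\<^sub>R (T t u - u)) \<longlongrightarrow> v) (at_right 0)}"

definition scalar_minus :: "complex \<Rightarrow> ('a::complex_banach \<times> 'a) set \<Rightarrow> ('a \<times> 'a) set"
  where "scalar_minus \<mu> A = {(u, \<mu> *\<^sub>C u - v) | u v. (u, v) \<in> A}"

text \<open>The value is only meaningful for \<open>\<mu>\<close> in the resolvent set of \<open>A\<close>, which contains the open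
  right half-plane when \<open>A\<close> generates a bounded semigroup.\<close>

definition resolvent :: "complex \<Rightarrow> ('a::complex_banach \<times> 'a) set \<Rightarrow> 'a \<Rightarrow> 'a"
  where "resolvent \<mu> A y = (THE u. (u, y) \<in> scalar_minus \<mu> A)"

definition boundary_resolvent ::
    "('a::complex_banach \<times> 'a) set \<Rightarrow> 'a \<Rightarrow> (real \<Rightarrow> complex) \<Rightarrow> 'a"
  where "boundary_resolvent A x \<phi> =
    Lim (at_right 0) (\<lambda>\<alpha>. integral UNIV (\<lambda>\<xi>. \<phi> \<xi> *\<^sub>C resolvent (of_real \<alpha> + \<i> * of_real \<xi>) A x))"

definition sigma_PF :: "('a::complex_banach \<times> 'a) set \<Rightarrow> 'a \<Rightarrow> complex set"
  where "sigma_PF A x = (\<lambda>\<xi>. \<i> * of_real \<xi>) ` sing_supp_PF (boundary_resolvent A x)"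

end

theory Submission
  imports Defs
begin

text \<open>Let \<open>f t = T t x\<close> for \<open>t \<ge> 0\<close> and \<open>f t = 0\<close> for \<open>t < 0\<close>. Since the resolvent is the Laplace
  transform of the semigroup, the boundary distribution \<open>R(\<i> \<xi>, A) x\<close> is the Fourier transform of
  \<open>f\<close> (\<open>boundary_resolvent_eq\<close>). Modulating a test function \<open>\<phi>\<close> by \<open>exp (\<i> t \<xi>)\<close> translates its
  transform, so testing the distribution against all modulations of \<open>\<phi>\<close> gives the filtered orbit
  \<open>t \<mapsto> \<integral> fourier \<phi> (s - t) f s ds\<close>, called \<open>orbit_filter\<close> below. Everything rests on the question for
  which \<open>\<phi>\<close> the filtered orbit tends to 0 as \<open>t \<rightarrow> \<infinity>\<close>.

  If the distribution is a pseudofunction on the support of \<open>\<phi>\<close>, then \<open>f\<close> may be replaced by a \<open>C\<^sub>0\<close>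
  function \<open>g\<close>, and the convolution of \<open>g\<close> with an integrable kernel tends to 0
  (\<open>local_pseudofunction_decays\<close>). Decay for all \<open>\<phi>\<close> supported near each point of an open set gives
  decay for all \<open>\<phi>\<close> supported in that set, by a partition of unity (\<open>decays_on_local\<close>). If there is
  decay for all test functions on the line, then the orbit itself tends to 0: it is uniformly
  continuous, hence close to its convolution with a concentrated kernel (\<open>decays_imp_stable\<close>).

  An isolated point \<open>\<xi>\<close> of the remaining closed set can be removed when \<open>x\<close> is in the closure of the
  range of \<open>\<i> \<xi> - A\<close> (\<open>decays_on_isolated_point\<close>). Then \<open>x\<close> is close to a difference
  \<open>z = exp (- \<i> \<xi> h) T h y - y\<close>. A cut-off at scale \<open>\<epsilon>\<close> around \<open>\<xi>\<close> does not change the limit of the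
  filtered orbit; the filtered orbit of \<open>z\<close> is, up to a decaying term, that of \<open>y\<close> for \<open>\<phi>\<close> multiplied
  by \<open>exp (\<i> (\<eta> - \<xi>) h) - 1\<close>, which is of size \<open>\<epsilon>\<close> on the cut-off interval. The \<open>L\<^sup>1\<close> norm of the
  transform of the cut-off functions is bounded independently of \<open>\<epsilon>\<close> (\<open>fourier_scale_bound\<close>), so the
  limit is 0. By Baire's theorem a nonempty countable closed set has an isolated point. Hence
  no bad point is left if the spectrum is countable and the range condition holds on it: (c) implies (a).

  Conversely, if the orbit tends to 0, then \<open>f\<close> is in \<open>C\<^sub>0\<close> except for its jump at 0, and the jump only
  matters for the transform near infinity: (a) implies (b). From (b) the conditions (c), (d), (e) hold
  vacuously. Finally (d) implies (e) trivially, and (e) implies (c) since \<open>x - \<alpha> R(\<alpha> + \<i> \<xi>, A) x\<close>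
  lies in the range of \<open>\<i> \<xi> - A\<close>: a functional vanishing on that range but not at \<open>x\<close>, given by the
  Hahn-Banach theorem, would contradict weak convergence.\<close>

section \<open>Improper integrals of Banach space valued functions\<close>

lemma bounded_bilinear_scaleC:
  "bounded_bilinear ((*\<^sub>C) :: complex \<Rightarrow> 'a \<Rightarrow> 'a::complex_normed_vector)"
proof
  show "(r *\<^sub>R a) *\<^sub>C b = r *\<^sub>R (a *\<^sub>C b)" for r :: real and a :: complex and b :: 'a
    by (simp only: scaleR_scaleC[of r b] scaleR_scaleC[of r "a *\<^sub>C b"] scaleC_scaleC scaleR_conv_of_real)
  show "a *\<^sub>C (r *\<^sub>R b) = r *\<^sub>R (a *\<^sub>C b)" for r :: real and a :: complex and b :: 'a
    by (simp add: scaleR_scaleC scaleC_scaleC mult.commute)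
  show "\<exists>K. \<forall>a (b::'a). norm (a *\<^sub>C b) \<le> norm a * norm b * K"
    by (rule exI[of _ 1]) (simp add: norm_scaleC)
qed (simp_all add: scaleC_add_left scaleC_add_right)

lemmas bounded_linear_scaleC_left = bounded_bilinear.bounded_linear_left[OF bounded_bilinear_scaleC]
lemmas bounded_linear_scaleC_right = bounded_bilinear.bounded_linear_right[OF bounded_bilinear_scaleC]
lemmas continuous_on_scaleC [continuous_intros] =
  bounded_bilinear.continuous_on[OF bounded_bilinear_scaleC]
lemmas tendsto_scaleC [tendsto_intros] = bounded_bilinear.tendsto[OF bounded_bilinear_scaleC]
lemmas scaleC_diff_left = bounded_bilinear.diff_left[OF bounded_bilinear_scaleC]
lemmas scaleC_diff_right = bounded_bilinear.diff_right[OF bounded_bilinear_scaleC]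
lemmas scaleC_minus_left = bounded_bilinear.minus_left[OF bounded_bilinear_scaleC]
lemmas scaleC_minus_right = bounded_bilinear.minus_right[OF bounded_bilinear_scaleC]
lemmas scaleC_zero_left [simp] = bounded_bilinear.zero_left[OF bounded_bilinear_scaleC]
lemmas scaleC_zero_right [simp] = bounded_bilinear.zero_right[OF bounded_bilinear_scaleC]

lemma scaleC_one [simp]: "1 *\<^sub>C (x :: 'a::complex_normed_vector) = x"
  using scaleR_scaleC[of 1 x] by simp

lemma integral_scaleC_right:
  fixes f :: "real \<Rightarrow> 'a::complex_banach"
  shows "f integrable_on S \<Longrightarrow> integral S (\<lambda>t. c *\<^sub>C f t) = c *\<^sub>C integral S f"
    and "f integrable_on S \<Longrightarrow> (\<lambda>t. c *\<^sub>C f t) integrable_on S"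
  using integral_linear[OF _ bounded_linear_scaleC_right, of f S c]
    integrable_linear[OF _ bounded_linear_scaleC_right, of f S c] by (simp_all add: o_def)

lemma integral_scaleC_left:
  fixes z :: "'a::complex_banach"
  shows "f integrable_on S \<Longrightarrow> integral S (\<lambda>t. f t *\<^sub>C z) = integral S f *\<^sub>C z"
    and "f integrable_on S \<Longrightarrow> (\<lambda>t. f t *\<^sub>C z) integrable_on S"
  using integral_linear[OF _ bounded_linear_scaleC_left, of f S z]
    integrable_linear[OF _ bounded_linear_scaleC_left, of f S z] by (simp_all add: o_def)

lemma closed_interval_Int_Icc:
  fixes S :: "real set"
  assumes "closed S" "is_interval S"
  obtains c d where "S \<inter> {a..b} = {c..d}"
proof -
  have "compact (S \<inter> {a..b})" "connected (S \<inter> {a..b})"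
    using assms by (auto simp: closed_Int_compact is_interval_Int is_interval_connected)
  then show ?thesis using connected_compact_interval_1[of "S \<inter> {a..b}"] that by auto
qed

lemma integrable_continuous_closed_interval_Icc:
  fixes f :: "real \<Rightarrow> 'a::banach"
  assumes "closed S" "is_interval S" "continuous_on S f"
  shows "f integrable_on (S \<inter> {a..b})"
proof -
  obtain c d where cd: "S \<inter> {a..b} = {c..d}" using closed_interval_Int_Icc[OF assms(1,2)] .
  show ?thesis unfolding cd
    by (rule integrable_continuous_interval) (use assms(3) cd continuous_on_subset in blast)
qed

text \<open>Comparison test, by the Cauchy criterion: the integral of \<open>f\<close> over the part between two nested
  intervals is dominated by that of \<open>h\<close>.\<close>

lemma integrable_dominated:
  fixes f :: "real \<Rightarrow> 'a::banach"
  assumes S: "closed S" "is_interval S" "continuous_on S f"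
    and h: "h integrable_on S" "\<And>t. t \<in> S \<Longrightarrow> norm (f t) \<le> h t"
  shows "f integrable_on S"
proof -
  let ?F = "\<lambda>t. if t \<in> S then f t else 0" and ?H = "\<lambda>t. if t \<in> S then h t else 0"
  have F: "?F integrable_on {a..b}" for a b
    using integrable_continuous_closed_interval_Icc[OF S, of a b]
    by (simp add: integrable_restrict_Int)
  have H: "?H integrable_on {a..b}" for a b
    using integrable_altD(1)[OF h(1), of a b] by simp
  have FH: "norm (integral {a..b} ?F) \<le> integral {a..b} ?H" for a b
    by (rule integral_norm_bound_integral[OF F H]) (use h in auto)
  have *: "norm (integral {a..b} ?F - integral {c..d} ?F) \<le>
      norm (integral {a..b} ?H - integral {c..d} ?H)"
    if "c \<le> a" "a \<le> b" "b \<le> d" for a b c d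
  proof -
    have "integral {c..d} ?F = integral {c..a} ?F + integral {a..b} ?F + integral {b..d} ?F"
      using that F[of c d] F[of c b]
      by (simp add: Henstock_Kurzweil_Integration.integral_combine)
    moreover have "integral {c..d} ?H = integral {c..a} ?H + integral {a..b} ?H + integral {b..d} ?H"
      using that H[of c d] H[of c b]
      by (simp add: Henstock_Kurzweil_Integration.integral_combine)
    moreover have "norm (integral {c..a} ?F + integral {b..d} ?F)
        \<le> integral {c..a} ?H + integral {b..d} ?H"
      by (intro norm_triangle_le add_mono FH)
    moreover have "norm (- (integral {c..a} ?F + integral {b..d} ?F)) =
        norm (integral {c..a} ?F + integral {b..d} ?F)" by (rule norm_minus_cancel)
    ultimately show ?thesis by (simp add: algebra_simps)
  qed
  show ?thesis unfolding integrable_alt_subset[of f]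
  proof (intro conjI allI impI)
    show "?F integrable_on cbox a b" for a b using F by simp
    fix e :: real assume "e > 0"
    then obtain B where B: "B > 0" "\<And>a b c d. ball 0 B \<subseteq> cbox a b \<and> cbox a b \<subseteq> cbox c d \<Longrightarrow>
        norm (integral (cbox a b) ?H - integral (cbox c d) ?H) < e"
      using h(1) unfolding integrable_alt_subset[of h] by meson
    show "\<exists>B>0. \<forall>a b c d. ball 0 B \<subseteq> cbox a b \<and> cbox a b \<subseteq> cbox c d \<longrightarrow>
        norm (integral (cbox a b) ?F - integral (cbox c d) ?F) < e"
    proof (intro exI[of _ B] conjI allI impI B(1))
      fix a b c d assume abcd: "ball 0 B \<subseteq> cbox a b \<and> cbox a b \<subseteq> cbox c (d::real)"
      have "a \<le> b" using abcd B(1) by (metis atLeastatMost_empty_iff2 ball_eq_empty box_real(2)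
            leD subset_empty)
      with abcd have "c \<le> a" "b \<le> d" by auto
      then show "norm (integral (cbox a b) ?F - integral (cbox c d) ?F) < e"
        using *[of c a b d] B(2)[OF abcd] \<open>a \<le> b\<close> by simp
    qed
  qed
qed

lemma norm_integral_dominated:
  fixes f :: "real \<Rightarrow> 'a::banach"
  assumes S: "closed S" "is_interval S" "continuous_on S f"
    and h: "(h has_integral I) UNIV" "\<And>t. 0 \<le> h t" "\<And>t. t \<in> S \<Longrightarrow> norm (f t) \<le> h t"
  shows "f integrable_on S" "norm (integral S f) \<le> I"
proof -
  have hS: "h integrable_on S"
  proof -
    have "h absolutely_integrable_on UNIV"
      using h by (auto intro!: nonnegative_absolutely_integrable_1 simp: has_integral_iff)
    then have "h absolutely_integrable_on S"
      by (rule set_integrable_subset) (use S in auto)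
    then show ?thesis by (rule set_lebesgue_integral_eq_integral)
  qed
  show f: "f integrable_on S" by (rule integrable_dominated[OF S hS h(3)])
  have "norm (integral S f) \<le> integral S h"
    by (rule integral_norm_bound_integral[OF f hS h(3)])
  also have "\<dots> \<le> integral UNIV h"
    by (rule integral_subset_le) (use hS h in \<open>auto simp: has_integral_iff\<close>)
  finally show "norm (integral S f) \<le> I" using h(1) by (simp add: has_integral_iff)
qed

lemma integral_truncated_tendsto:
  fixes f :: "real \<Rightarrow> 'a::banach"
  assumes "f integrable_on S"
  shows "(\<lambda>n. integral (S \<inter> {- real n..real n}) f) \<longlonglongrightarrow> integral S f"
proof (rule LIMSEQ_I)
  fix e :: real assume "e > 0"
  then obtain B where B: "B > 0" "\<And>a b. ball 0 B \<subseteq> cbox a b \<Longrightarrow>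
      norm (integral (cbox a b) (\<lambda>x. if x \<in> S then f x else 0) - integral S f) < e"
    using has_integral_alt'[of f "integral S f" S] assms by (meson integrable_integral)
  have "ball 0 B \<subseteq> {- real n..real n}" if "n \<ge> nat \<lceil>B\<rceil>" for n
    using that by (auto simp: ball_def)
  then show "\<exists>N. \<forall>n\<ge>N. norm (integral (S \<inter> {- real n..real n}) f - integral S f) < e"
    using B(2) by (intro exI[of _ "nat \<lceil>B\<rceil>"])
      (auto simp: integral_restrict_Int Int_commute)
qed

lemma norm_integral_tail_le:
  fixes f :: "real \<Rightarrow> 'a::banach"
  assumes f: "f integrable_on S" "f integrable_on (S \<inter> C)"
    and h: "h integrable_on S" "h integrable_on (S \<inter> C)" "\<And>t. t \<in> S \<Longrightarrow> norm (f t) \<le> h t"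
  shows "norm (integral S f - integral (S \<inter> C) f) \<le> integral S h - integral (S \<inter> C) h"
proof -
  have eq: "integral (S \<inter> C) g = integral S (\<lambda>t. if t \<in> C then g t else 0)"
    "g integrable_on (S \<inter> C) \<longleftrightarrow> (\<lambda>t. if t \<in> C then g t else 0) integrable_on S"
    for g :: "real \<Rightarrow> 'c::banach"
    by (simp_all add: integral_restrict_Int integrable_restrict_Int Int_commute)
  show ?thesis
    using f h unfolding eq
    by (subst (1 2) integral_diff[symmetric])
       (auto intro!: integral_norm_bound_integral Henstock_Kurzweil_Integration.integrable_diff)
qed

text \<open>Fubini for one bounded and one possibly unbounded variable. The integrals over compact rectangles
  may be exchanged by continuity; the domination by \<open>h\<close> makes the truncated inner integrals converge
  uniformly in the bounded variable.\<close>

lemma integral_swap_dominated: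
  fixes H :: "real \<Rightarrow> real \<Rightarrow> 'a::banach"
  assumes S: "closed S" "is_interval S" and cont: "continuous_on ({a..b} \<times> S) (\<lambda>(x,t). H x t)"
    and h: "h integrable_on S" "\<And>x t. x \<in> {a..b} \<Longrightarrow> t \<in> S \<Longrightarrow> norm (H x t) \<le> h t"
  shows "integral {a..b} (\<lambda>x. integral S (H x)) = integral S (\<lambda>t. integral {a..b} (\<lambda>x. H x t))"
    and "(\<lambda>t. integral {a..b} (\<lambda>x. H x t)) integrable_on S"
    and "(\<lambda>x. integral S (H x)) integrable_on {a..b}"
proof -
  let ?S = "\<lambda>n. S \<inter> {- real n..real n}"
  have contx: "continuous_on S (H x)" if "x \<in> {a..b}" for x
    using that by (intro continuous_on_compose2[OF cont, where f = "Pair x", simplified])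
      (auto intro!: continuous_intros)
  have contt: "continuous_on {a..b} (\<lambda>x. H x t)" if "t \<in> S" for t
    using that by (intro continuous_on_compose2[OF cont, where f = "\<lambda>x. (x, t)", simplified])
      (auto intro!: continuous_intros)
  have hS: "h integrable_on ?S n" for n
    using integrable_altD(1)[OF h(1), of "- real n" "real n"] by (simp add: integrable_restrict_Int)
  have HS: "H x integrable_on S" "H x integrable_on ?S n" if "x \<in> {a..b}" for x n
    using integrable_dominated[OF S contx[OF that] h(1)] h(2)[OF that]
      integrable_continuous_closed_interval_Icc[OF S contx[OF that]] by auto
  have lim: "uniform_limit {a..b} (\<lambda>n x. integral (?S n) (H x)) (\<lambda>x. integral S (H x)) sequentially"
  proof (rule uniform_limitI)
    fix e :: real assume "e > 0"
    with integral_truncated_tendsto[OF h(1)]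
    have "\<forall>\<^sub>F n in sequentially. dist (integral (?S n) h) (integral S h) < e"
      by (rule tendstoD)
    then show "\<forall>\<^sub>F n in sequentially. \<forall>x\<in>{a..b}.
        dist (integral (?S n) (H x)) (integral S (H x)) < e"
    proof eventually_elim
      case (elim n)
      have "dist (integral (?S n) (H x)) (integral S (H x)) < e" if x: "x \<in> {a..b}" for x
        using norm_integral_tail_le[OF HS[OF x] h(1) hS h(2)[OF x], of n] elim
        by (simp add: dist_norm norm_minus_commute)
      then show ?case by blast
    qed
  qed
  have rect: "continuous_on {a..b} (\<lambda>x. integral (?S n) (H x)) \<and>
      integral {a..b} (\<lambda>x. integral (?S n) (H x)) =
      integral (?S n) (\<lambda>t. integral {a..b} (\<lambda>x. H x t))" for n
  proof -
    obtain c d where cd: "?S n = {c..d}" using closed_interval_Int_Icc[OF S] .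
    have c: "continuous_on ({a..b} \<times> {c..d}) (\<lambda>(x,t). H x t)"
      by (rule continuous_on_subset[OF cont]) (use cd in auto)
    have "continuous_on {a..b} (\<lambda>x. integral (cbox c d) (H x))"
      by (rule integral_continuous_on_param) (use c in simp)
    moreover have "integral (cbox a b) (\<lambda>x. integral (cbox c d) (H x)) =
      integral (cbox c d) (\<lambda>t. integral (cbox a b) (\<lambda>x. H x t))"
      by (rule integral_swap_continuous) (use c in \<open>simp add: cbox_Pair_eq\<close>)
    ultimately show ?thesis unfolding cd by simp
  qed
  have contS: "continuous_on S (\<lambda>t. integral {a..b} (\<lambda>x. H x t))"
  proof -
    have "continuous_on (S \<times> {a..b}) (\<lambda>(t,x). H x t)"
      using continuous_on_swap_args[OF cont] by (simp add: split_beta)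
    then show ?thesis using integral_continuous_on_param[of S a b "\<lambda>t x. H x t"] by simp
  qed
  show int: "(\<lambda>t. integral {a..b} (\<lambda>x. H x t)) integrable_on S"
  proof (cases "a \<le> b")
    case True
    show ?thesis
    proof (rule integrable_dominated[OF S contS])
      show "(\<lambda>t. h t * (b - a)) integrable_on S" using h(1) by (rule integrable_on_mult_left)
      show "norm (integral {a..b} (\<lambda>x. H x t)) \<le> h t * (b - a)" if "t \<in> S" for t
        by (rule integral_bound[OF True contt[OF that]]) (use h(2) that in auto)
    qed
  next
    case False then show ?thesis by (simp add: integrable_0)
  qed
  obtain I J where IJ: "\<And>n. ((\<lambda>x. integral (?S n) (H x)) has_integral I n) {a..b}"
    "((\<lambda>x. integral S (H x)) has_integral J) {a..b}" "I \<longlonglongrightarrow> J"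
    using uniform_limit_integral[OF lim] rect by (metis sequentially_bot)
  show "(\<lambda>x. integral S (H x)) integrable_on {a..b}" using IJ(2) by blast
  have "I n = integral (?S n) (\<lambda>t. integral {a..b} (\<lambda>x. H x t))" for n
    using IJ(1)[of n] rect[of n] by (metis integral_unique)
  then have "I \<longlonglongrightarrow> integral S (\<lambda>t. integral {a..b} (\<lambda>x. H x t))"
    using integral_truncated_tendsto[OF int] by presburger
  with IJ(3) have "J = integral S (\<lambda>t. integral {a..b} (\<lambda>x. H x t))"
    by (rule LIMSEQ_unique)
  then show "integral {a..b} (\<lambda>x. integral S (H x)) = integral S (\<lambda>t. integral {a..b} (\<lambda>x. H x t))"
    using IJ(2) by (simp add: has_integral_iff)
qed

lemma has_integral_isometry:
  fixes f :: "real \<Rightarrow> 'a::banach"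
  assumes f: "(f has_integral i) S" and m: "\<bar>m\<bar> = 1"
  shows "((\<lambda>x. f (m * x + c)) has_integral i) {x. m * x + c \<in> S}"
proof -
  let ?F = "\<lambda>x. if x \<in> S then f x else 0"
  let ?I = "\<lambda>a b. {min (m * a) (m * b) + c..max (m * a) (m * b) + c}"
  have m': "m = 1 \<or> m = -1" using m by linarith
  have F: "?F integrable_on {a..b}" for a b
    using f unfolding has_integral_alt' by simp
  have eq: "(\<lambda>x. if x \<in> {x. m * x + c \<in> S} then f (m * x + c) else 0) = (\<lambda>x. ?F (m * x + c))" by auto
  have R: "((\<lambda>x. ?F (m * x + c)) has_integral integral (?I a b) ?F) {a..b}" if "a \<le> b" for a b
  proof -
    have "((\<lambda>x. ?F (m *\<^sub>R x + c)) has_integral integral (?I a b) ?F)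
        ((\<lambda>x. (1 / m) *\<^sub>R x + - ((1 / m) *\<^sub>R c)) ` ?I a b)"
      using has_integral_affinity[OF integrable_integral[OF F[of "min (m * a) (m * b) + c"
            "max (m * a) (m * b) + c"], unfolded box_real[symmetric]], of m c] m m' by auto
    moreover have "(\<lambda>x. (1 / m) *\<^sub>R x + - ((1 / m) *\<^sub>R c)) ` ?I a b = {a..b}"
    proof (rule set_eqI)
      fix y
      have "y \<in> {a..b} \<longleftrightarrow> m * y + c \<in> ?I a b" using m' that by auto
      moreover have "y = (1 / m) *\<^sub>R x + - ((1 / m) *\<^sub>R c) \<longleftrightarrow> x = m * y + c" for x
        using m' by auto
      ultimately show "y \<in> (\<lambda>x. (1 / m) *\<^sub>R x + - ((1 / m) *\<^sub>R c)) ` ?I a b \<longleftrightarrow> y \<in> {a..b}"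
        unfolding image_iff by (simp only:) blast
    qed
    ultimately show ?thesis by (simp cong: if_cong)
  qed
  show ?thesis unfolding has_integral_alt' eq
  proof (intro conjI allI impI)
    show "(\<lambda>x. ?F (m * x + c)) integrable_on cbox a b" for a b
      using R[of a b] by (cases "a \<le> b") (auto simp: has_integral_iff)
    fix e :: real assume "e > 0"
    then obtain B where B: "B > 0"
      "\<And>a b. ball 0 B \<subseteq> {a..b} \<Longrightarrow> norm (integral {a..b} ?F - i) < e"
      using f unfolding has_integral_alt' by auto
    have "norm (integral {a..b} (\<lambda>x. ?F (m * x + c)) - i) < e" if ab: "ball 0 (B + \<bar>c\<bar>) \<subseteq> {a..b}" for a b :: real
    proof -
      have "0 \<in> ball 0 (B + \<bar>c\<bar>)" using B(1) by simp
      then have "0 \<in> {a..b}" using ab by blast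
      then have "a \<le> b" by auto
      moreover have "ball 0 B \<subseteq> ?I a b"
      proof
        fix x :: real assume "x \<in> ball 0 B"
        then have "m * (x - c) \<in> ball 0 (B + \<bar>c\<bar>)" using m by (simp add: abs_mult abs_le_iff)
        then have "m * (x - c) \<in> {a..b}" using ab by blast
        then show "x \<in> ?I a b" using m' by auto
      qed
      ultimately show ?thesis using B(2) R[of a b] by (simp add: has_integral_iff)
    qed
    then show "\<exists>B>0. \<forall>a b. ball 0 B \<subseteq> cbox a b \<longrightarrow>
        norm (integral (cbox a b) (\<lambda>x. ?F (m * x + c)) - i) < e"
      using B(1) unfolding box_real by (intro exI[of _ "B + \<bar>c\<bar>"]) auto
  qed
qed

lemma has_integral_reflect_set:
  fixes f :: "real \<Rightarrow> 'a::banach"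
  shows "(f has_integral i) S \<Longrightarrow> ((\<lambda>x. f (- x)) has_integral i) {x. - x \<in> S}"
  using has_integral_isometry[of f i S "-1" 0] by simp

text \<open>The Poisson kernel of width \<open>1 / e\<close> serves as comparison function throughout.\<close>

lemma has_integral_Poisson:
  assumes "e > 0"
  shows "((\<lambda>s. e / (1 + (e * (s - t))\<^sup>2)) has_integral pi) UNIV"
proof -
  have half: "((\<lambda>s. e / (1 + (e * (s - t))\<^sup>2)) has_integral pi / 2) {t..}" for t
  proof (rule has_integral_to_inf)
    have pos: "1 + (e * (s - t))\<^sup>2 > 0" for s
      by (rule add_pos_nonneg) auto
    show "(\<lambda>s. e / (1 + (e * (s - t))\<^sup>2)) integrable_on {t..y}" for y
      using pos by (intro integrable_continuous_interval continuous_intros) (auto simp: less_imp_neq[symmetric])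
    have "((\<lambda>s. e / (1 + (e * (s - t))\<^sup>2)) has_integral
        (arctan (e * (y - t)) - arctan (e * (t - t)))) {t..y}" if "y \<ge> t" for y
      using that
      by (intro fundamental_theorem_of_calculus)
         (auto intro!: derivative_eq_intros simp: divide_simps simp flip: has_real_derivative_iff_has_vector_derivative)
    then have "\<forall>\<^sub>F y in at_top. arctan (e * (y - t)) = integral {t..y} (\<lambda>s. e / (1 + (e * (s - t))\<^sup>2))"
      by (intro eventually_at_top_linorderI[of t]) (auto simp: has_integral_iff)
    moreover have "filterlim (\<lambda>y. e * (y - t)) at_top at_top"
      using assms by (intro filterlim_tendsto_pos_mult_at_top[OF tendsto_const])
        (auto intro!: filterlim_at_top_mono[OF filterlim_ident] filterlim_tendsto_add_at_top[OF tendsto_const filterlim_ident, of "-t", simplified])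
    then have "((\<lambda>y. arctan (e * (y - t))) \<longlongrightarrow> pi / 2) at_top"
      by (rule filterlim_compose[OF tendsto_arctan_at_top])
    ultimately show "((\<lambda>y. integral {t..y} (\<lambda>s. e / (1 + (e * (s - t))\<^sup>2))) \<longlongrightarrow> pi / 2) at_top"
      using Lim_transform_eventually by fast
  qed (use assms in auto)
  have "((\<lambda>s. e / (1 + (e * (s - t))\<^sup>2)) has_integral pi / 2) {..t}"
    using has_integral_reflect_set[OF half[of "- t"]]
    by (simp add: power2_eq_square algebra_simps flip: atMost_def)
  from has_integral_Un[OF this half[of t]] 
  have "((\<lambda>s. e / (1 + (e * (s - t))\<^sup>2)) has_integral (pi/2 + pi/2)) ({..t} \<union> {t..})"
    by (auto simp: atMost_def atLeast_def Int_def order_eq_iff[symmetric])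
  moreover have "{..t} \<union> {t..} = (UNIV :: real set)" by auto
  ultimately show ?thesis by simp
qed

section \<open>Smooth functions and cut-offs\<close>

lemma nth_deriv_0 [simp]: "nth_deriv 0 \<phi> = \<phi>"
  by (simp add: nth_deriv_def)

lemma nth_deriv_Suc: "nth_deriv (Suc n) \<phi> t = vector_derivative (nth_deriv n \<phi>) (at t)"
  by (simp add: nth_deriv_def)

lemma smooth_has_vector_derivative:
  "smooth \<phi> \<Longrightarrow> (nth_deriv n \<phi> has_vector_derivative nth_deriv (Suc n) \<phi> t) (at t)"
  unfolding smooth_def nth_deriv_Suc by (simp add: vector_derivative_works[symmetric])

lemma smooth_has_vector_derivative_1:
  "smooth \<phi> \<Longrightarrow> (\<phi> has_vector_derivative nth_deriv (Suc 0) \<phi> t) (at t)"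
  using smooth_has_vector_derivative[of \<phi> 0] by simp

lemma nth_deriv_Suc_derivative:
  assumes "\<And>t. (\<phi> has_vector_derivative \<phi>' t) (at t)"
  shows "nth_deriv (Suc n) \<phi> = nth_deriv n \<phi>'"
proof -
  have "(\<lambda>t. vector_derivative \<phi> (at t)) = \<phi>'"
    using assms by (auto intro!: vector_derivative_at)
  then show ?thesis unfolding nth_deriv_def funpow_Suc_right by simp
qed

text \<open>All smoothness proofs below exhibit a class of functions closed under differentiation.\<close>

lemma smooth_coinduct:
  assumes "P \<phi>"
    and step: "\<And>\<phi>. P \<phi> \<Longrightarrow> \<exists>\<phi>'. P \<phi>' \<and> (\<forall>t. (\<phi> has_vector_derivative \<phi>' t) (at t))"
  shows "smooth \<phi>"
proof -
  have "P (nth_deriv n \<phi>)" for n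
  proof (induction n)
    case 0 then show ?case using assms(1) by simp
  next
    case (Suc n)
    then obtain \<phi>' where \<phi>': "P \<phi>'" "\<And>t. (nth_deriv n \<phi> has_vector_derivative \<phi>' t) (at t)"
      using step by metis
    have "nth_deriv (Suc n) \<phi> = \<phi>'"
      unfolding nth_deriv_Suc[abs_def] using \<phi>'(2) vector_derivative_at by fastforce
    then show ?case using \<phi>'(1) by simp
  qed
  then show ?thesis
    unfolding smooth_def using step differentiableI_vector by metis
qed

lemma smooth_derivative:
  assumes "smooth \<phi>" shows "smooth (nth_deriv n \<phi>)"
  by (rule smooth_coinduct[of "\<lambda>\<psi>. \<exists>n. \<psi> = nth_deriv n \<phi>"])
     (use smooth_has_vector_derivative[OF assms] in blast)+

lemma smooth_continuous_on: "smooth \<phi> \<Longrightarrow> continuous_on S (nth_deriv n \<phi>)"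
  unfolding smooth_def
  by (intro differentiable_imp_continuous_on) (simp add: differentiable_at_imp_differentiable_on)

lemma smooth_continuous_on_0: "smooth \<phi> \<Longrightarrow> continuous_on S \<phi>"
  using smooth_continuous_on[of \<phi> S 0] by simp

lemma smooth_const [intro]: "smooth (\<lambda>_. c)"
  by (rule smooth_coinduct[of "\<lambda>\<psi>. \<exists>c. \<psi> = (\<lambda>_. c)"]) (blast, auto intro!: exI[of _ "\<lambda>_. 0"])

lemma smooth_add: "smooth a \<Longrightarrow> smooth b \<Longrightarrow> smooth (\<lambda>t. a t + b t)"
  using smooth_lincomb[of a b 1 1] by simp

lemma smooth_diff: "smooth a \<Longrightarrow> smooth b \<Longrightarrow> smooth (\<lambda>t. a t - b t)"
  using smooth_lincomb[of a b 1 "-1"] by simp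

lemma smooth_cmult: "smooth a \<Longrightarrow> smooth (\<lambda>t. c * a t)"
  using smooth_lincomb[of a a c 0] by simp

lemma smooth_exp: "smooth (\<lambda>t. exp (c * of_real t))"
proof (rule smooth_coinduct[of "\<lambda>\<psi>. \<exists>a. \<psi> = (\<lambda>t. a * exp (c * of_real t))"])
  show "\<exists>a. (\<lambda>t. exp (c * complex_of_real t)) = (\<lambda>t. a * exp (c * complex_of_real t))"
    by (rule exI[of _ 1]) simp
  fix \<phi> assume "\<exists>a. \<phi> = (\<lambda>t. a * exp (c * complex_of_real t))"
  then obtain a where \<phi>: "\<phi> = (\<lambda>t. a * exp (c * complex_of_real t))" by blast
  have "(\<phi> has_vector_derivative (a * c) * exp (c * complex_of_real t)) (at t)" for t
    unfolding \<phi>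
    by (rule has_vector_derivative_real_field) (auto intro!: derivative_eq_intros)
  then show "\<exists>\<phi>'. (\<exists>a. \<phi>' = (\<lambda>t. a * exp (c * complex_of_real t))) \<and>
      (\<forall>t. (\<phi> has_vector_derivative \<phi>' t) (at t))" by blast
qed

text \<open>Sums of products of smooth functions are closed under differentiation; this avoids the
  Leibniz formula. The same holds for sums of smooth functions divided by powers of \<open>u\<close>.\<close>

inductive product_sum :: "(real \<Rightarrow> complex) \<Rightarrow> bool" where
  "smooth a \<Longrightarrow> smooth b \<Longrightarrow> product_sum (\<lambda>t. a t * b t)"
| "product_sum u \<Longrightarrow> product_sum v \<Longrightarrow> product_sum (\<lambda>t. u t + v t)"

lemma smooth_mult_has_vector_derivative:
  assumes "smooth a" "smooth b"
  shows "((\<lambda>t. a t * b t) has_vector_derivative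
    nth_deriv (Suc 0) a t * b t + a t * nth_deriv (Suc 0) b t) (at t)"
  using has_vector_derivative_mult[OF smooth_has_vector_derivative_1[OF assms(1)]
      smooth_has_vector_derivative_1[OF assms(2)]] by (simp add: algebra_simps)

lemma smooth_mult:
  assumes "smooth a" "smooth b"
  shows "smooth (\<lambda>t. a t * b t)"
proof (rule smooth_coinduct[of product_sum])
  show "product_sum (\<lambda>t. a t * b t)" using assms by (rule product_sum.intros)
  show "\<exists>\<phi>'. product_sum \<phi>' \<and> (\<forall>t. (\<phi> has_vector_derivative \<phi>' t) (at t))"
    if "product_sum \<phi>" for \<phi>
    using that
  proof induction
    case (1 a b)
    show ?case
      by (rule exI[of _ "\<lambda>t. nth_deriv (Suc 0) a t * b t + a t * nth_deriv (Suc 0) b t"])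
         (auto intro!: product_sum.intros smooth_derivative smooth_mult_has_vector_derivative 1)
  next
    case (2 u v)
    then obtain u' v' where "product_sum u'" "\<forall>t. (u has_vector_derivative u' t) (at t)"
        "product_sum v'" "\<forall>t. (v has_vector_derivative v' t) (at t)" by blast
    then show ?case
      by (intro exI[of _ "\<lambda>t. u' t + v' t"]) (auto intro: product_sum.intros has_vector_derivative_add)
  qed
qed

inductive quotient_sum :: "(real \<Rightarrow> complex) \<Rightarrow> (real \<Rightarrow> complex) \<Rightarrow> bool" for u where
  "smooth a \<Longrightarrow> quotient_sum u (\<lambda>t. a t * inverse (u t) ^ k)"
| "quotient_sum u v \<Longrightarrow> quotient_sum u w \<Longrightarrow> quotient_sum u (\<lambda>t. v t + w t)"

lemma smooth_inverse:
  assumes u: "smooth u" "\<And>t. u t \<noteq> 0"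
  shows "smooth (\<lambda>t. inverse (u t))"
proof (rule smooth_coinduct[of "quotient_sum u"])
  show "quotient_sum u (\<lambda>t. inverse (u t))"
    using quotient_sum.intros(1)[of "\<lambda>_. 1" u 1] smooth_const by simp
  show "\<exists>\<phi>'. quotient_sum u \<phi>' \<and> (\<forall>t. (\<phi> has_vector_derivative \<phi>' t) (at t))"
    if "quotient_sum u \<phi>" for \<phi>
    using that
  proof induction
    case (1 a k)
    let ?a' = "nth_deriv (Suc 0) a" and ?u' = "nth_deriv (Suc 0) u"
    have "((\<lambda>t. a t * inverse (u t) ^ k) has_vector_derivative
        ?a' t * inverse (u t) ^ k + ((- of_nat k) * (a t * ?u' t)) * inverse (u t) ^ (Suc k)) (at t)"
      for t
    proof -
      have "((\<lambda>t. inverse (u t) ^ k) has_vector_derivative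
          ?u' t * (- of_nat k * inverse (u t) ^ Suc k)) (at t)"
      proof (cases k)
        case (Suc m)
        have "((\<lambda>z. inverse z ^ Suc m) has_field_derivative
            (1 + of_nat m) * (- (inverse (u t) ^ Suc (Suc 0)) * inverse (u t) ^ m)) (at (u t))"
          by (rule DERIV_power_Suc[OF DERIV_inverse[OF u(2)]])
        then have "((\<lambda>z. inverse z ^ k) has_field_derivative
            - of_nat k * inverse (u t) ^ Suc k) (at (u t))"
          unfolding Suc by (simp add: algebra_simps)
        from field_vector_diff_chain_at[OF smooth_has_vector_derivative_1[OF u(1)] this]
        show ?thesis by (simp add: o_def)
      qed simp
      from has_vector_derivative_mult[OF smooth_has_vector_derivative_1[OF 1] this]
      show ?thesis by (simp add: algebra_simps)
    qed
    moreover have "quotient_sum u (\<lambda>t. ?a' t * inverse (u t) ^ k +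
        ((- of_nat k) * (a t * ?u' t)) * inverse (u t) ^ (Suc k))"
      by (intro quotient_sum.intros smooth_cmult smooth_mult smooth_derivative u 1)
    ultimately show ?case by blast
  next
    case (2 v w)
    then obtain v' w' where "quotient_sum u v'" "\<forall>t. (v has_vector_derivative v' t) (at t)"
        "quotient_sum u w'" "\<forall>t. (w has_vector_derivative w' t) (at t)" by blast
    then show ?case
      by (intro exI[of _ "\<lambda>t. v' t + w' t"]) (auto intro: quotient_sum.intros has_vector_derivative_add)
  qed
qed

lemma nth_deriv_affine:
  assumes "smooth \<phi>"
  shows "nth_deriv n (\<lambda>t. \<phi> (m * t + b)) = (\<lambda>t. of_real m ^ n * nth_deriv n \<phi> (m * t + b))"
    and "smooth (\<lambda>t. \<phi> (m * t + b))"
proof -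
  have D: "((\<lambda>t. of_real m ^ n * nth_deriv n \<phi> (m * t + b)) has_vector_derivative
      of_real m ^ Suc n * nth_deriv (Suc n) \<phi> (m * t + b)) (at t)" for n t
  proof -
    have "((\<lambda>t. m * t + b) has_vector_derivative m) (at t)"
      by (auto intro!: derivative_eq_intros simp flip: has_real_derivative_iff_has_vector_derivative)
    from vector_diff_chain_at[OF this smooth_has_vector_derivative[OF assms]]
    have "((\<lambda>t. nth_deriv n \<phi> (m * t + b)) has_vector_derivative
        m *\<^sub>R nth_deriv (Suc n) \<phi> (m * t + b)) (at t)" by (simp add: o_def)
    from has_vector_derivative_mult_right[OF this, of "of_real m ^ n"]
    show ?thesis by (simp add: scaleR_conv_of_real algebra_simps)
  qed
  show eq: "nth_deriv n (\<lambda>t. \<phi> (m * t + b)) = (\<lambda>t. of_real m ^ n * nth_deriv n \<phi> (m * t + b))" for n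
  proof (induction n)
    case (Suc n)
    show ?case by (rule ext, subst nth_deriv_Suc, subst Suc, rule vector_derivative_at[OF D])
  qed simp
  show "smooth (\<lambda>t. \<phi> (m * t + b))"
    unfolding smooth_def eq using D differentiableI_vector by blast
qed

lemma poly_times_exp_minus_tendsto_0:
  "((\<lambda>y. poly p y * exp (- y)) \<longlongrightarrow> 0) (at_top :: real filter)"
proof -
  have "((\<lambda>y. \<Sum>i\<le>degree p. coeff p i * (y ^ i / exp y)) \<longlongrightarrow> (\<Sum>i\<le>degree p. coeff p i * 0)) at_top"
    by (intro tendsto_intros tendsto_power_div_exp_0)
  then show ?thesis
    by (simp add: poly_altdef sum_distrib_right exp_minus divide_inverse mult.assoc)
qed

text \<open>The functions \<open>p (1/x) exp (-1/x)\<close>, continued by 0 to \<open>x \<le> 0\<close>, are closed under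
  differentiation: the derivative belongs to the polynomial \<open>y\<^sup>2 (p y - p' y)\<close>.\<close>

definition flat_fun :: "real poly \<Rightarrow> real \<Rightarrow> real"
  where "flat_fun p x = (if x > 0 then poly p (1 / x) * exp (- 1 / x) else 0)"

lemma flat_fun_has_derivative:
  "(flat_fun p has_real_derivative flat_fun ([:0, 0, 1:] * (p - pderiv p)) x) (at x)"
proof -
  consider "x > 0" | "x < 0" | "x = 0" by linarith
  then show ?thesis
  proof cases
    case 1
    have "((\<lambda>x. poly p (1 / x) * exp (- 1 / x)) has_real_derivative
        flat_fun ([:0, 0, 1:] * (p - pderiv p)) x) (at x)"
      using 1 by (auto intro!: derivative_eq_intros DERIV_chain2[OF poly_DERIV]
          simp: flat_fun_def field_simps power2_eq_square)
    then show ?thesis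
      by (rule has_field_derivative_transform_within_open[OF _ open_greaterThan[of 0]])
         (use 1 in \<open>auto simp: flat_fun_def\<close>)
  next
    case 2
    have "((\<lambda>x. 0) has_real_derivative flat_fun ([:0, 0, 1:] * (p - pderiv p)) x) (at x)"
      using 2 by (simp add: flat_fun_def)
    then show ?thesis
      by (rule has_field_derivative_transform_within_open[OF _ open_lessThan[of 0]])
         (use 2 in \<open>auto simp: flat_fun_def\<close>)
  next
    case 3
    have "((\<lambda>y. poly ([:0, 1:] * p) y * exp (- y)) \<longlongrightarrow> 0) at_top"
      by (rule poly_times_exp_minus_tendsto_0)
    from filterlim_compose[OF this filterlim_inverse_at_top_right]
    have "((\<lambda>x. flat_fun p x / x) \<longlongrightarrow> 0) (at_right 0)"
      by (rule Lim_transform_eventually)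
         (auto simp: eventually_at_filter flat_fun_def field_simps)
    moreover have "((\<lambda>x. flat_fun p x / x) \<longlongrightarrow> 0) (at_left 0)"
      by (rule tendsto_eventually) (auto simp: eventually_at_filter flat_fun_def)
    ultimately have "((\<lambda>x. flat_fun p x / x) \<longlongrightarrow> 0) (at 0)"
      by (simp add: filterlim_at_split)
    then show ?thesis unfolding 3 has_field_derivative_iff by (simp add: flat_fun_def)
  qed
qed

lemma smooth_flat_fun: "smooth (\<lambda>x. of_real (flat_fun p x))"
proof (rule smooth_coinduct[of "\<lambda>\<phi>. \<exists>p. \<phi> = (\<lambda>x. of_real (flat_fun p x))"])
  fix \<phi> :: "real \<Rightarrow> complex" assume "\<exists>p. \<phi> = (\<lambda>x. of_real (flat_fun p x))"
  then obtain p where "\<phi> = (\<lambda>x. of_real (flat_fun p x))" by blast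
  then have "(\<phi> has_vector_derivative of_real (flat_fun ([:0, 0, 1:] * (p - pderiv p)) x)) (at x)" for x
    using flat_fun_has_derivative[of p x]
    by (simp add: has_real_derivative_iff_has_vector_derivative has_vector_derivative_of_real)
  then show "\<exists>\<phi>'. (\<exists>p. \<phi>' = (\<lambda>x. of_real (flat_fun p x))) \<and>
      (\<forall>t. (\<phi> has_vector_derivative \<phi>' t) (at t))" by blast
qed blast

definition smooth_step :: "real \<Rightarrow> complex"
  where "smooth_step x = of_real (flat_fun 1 x) *
    inverse (of_real (flat_fun 1 x) + of_real (flat_fun 1 (1 - x)))"

lemma flat_fun_1_pos: "flat_fun 1 x + flat_fun 1 (1 - x) > 0"
  by (cases "x > 0") (auto simp: flat_fun_def intro: add_pos_nonneg)

lemma smooth_smooth_step: "smooth smooth_step"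
proof -
  have "smooth (\<lambda>x. of_real (flat_fun 1 (1 - x)))"
    using nth_deriv_affine(2)[OF smooth_flat_fun[of 1], of "-1" 1] by (simp add: algebra_simps)
  moreover have "complex_of_real (flat_fun 1 x) + of_real (flat_fun 1 (1 - x)) \<noteq> 0" for x
    using flat_fun_1_pos[of x] unfolding of_real_add[symmetric] of_real_eq_0_iff by linarith
  ultimately show ?thesis unfolding smooth_step_def[abs_def]
    by (intro smooth_mult smooth_inverse smooth_add smooth_flat_fun)
qed

lemma smooth_step_0: "x \<le> 0 \<Longrightarrow> smooth_step x = 0"
  by (simp add: smooth_step_def flat_fun_def)

lemma smooth_step_1: "x \<ge> 1 \<Longrightarrow> smooth_step x = 1"
  by (simp add: smooth_step_def flat_fun_def)

definition bump :: "real \<Rightarrow> complex"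
  where "bump x = smooth_step (x + 2) * smooth_step (2 - x)"

lemma smooth_bump: "smooth bump"
  using nth_deriv_affine(2)[OF smooth_smooth_step, of 1 2]
    nth_deriv_affine(2)[OF smooth_smooth_step, of "-1" 2]
  unfolding bump_def[abs_def] by (intro smooth_mult) (simp_all add: algebra_simps)

lemma bump_1: "\<bar>x\<bar> \<le> 1 \<Longrightarrow> bump x = 1"
  by (simp add: bump_def smooth_step_1)

lemma bump_0: "\<bar>x\<bar> \<ge> 2 \<Longrightarrow> bump x = 0"
  by (cases "x \<ge> 0") (simp_all add: bump_def smooth_step_0)

lemma test_functionsI:
  assumes "smooth \<phi>" "compact K" "K \<subseteq> I" "\<And>t. t \<notin> K \<Longrightarrow> \<phi> t = 0"
  shows "\<phi> \<in> test_functions I"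
proof -
  have "closure {t. \<phi> t \<noteq> 0} \<subseteq> K"
    by (rule closure_minimal) (use assms compact_imp_closed in auto)
  then show ?thesis
    using assms unfolding test_functions_def
    by (auto simp: compact_eq_bounded_closed intro: bounded_subset)
qed

lemma test_functionsE:
  assumes "\<phi> \<in> test_functions I"
  obtains K where "smooth \<phi>" "compact K" "K \<subseteq> I" "\<And>t. t \<notin> K \<Longrightarrow> \<phi> t = 0"
  using assms unfolding test_functions_def mem_Collect_eq
  by (metis (mono_tags, lifting) closure_subset mem_Collect_eq subsetD that)

lemma test_functions_smooth: "\<phi> \<in> test_functions I \<Longrightarrow> smooth \<phi>"
  by (simp add: test_functions_def)

lemma test_functions_mult:
  assumes "\<phi> \<in> test_functions I" "smooth a"
  shows "(\<lambda>t. \<phi> t * a t) \<in> test_functions I"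
proof -
  from assms(1) obtain K where "smooth \<phi>" "compact K" "K \<subseteq> I" "\<And>t. t \<notin> K \<Longrightarrow> \<phi> t = 0"
    by (rule test_functionsE) blast
  then show ?thesis
    by (intro test_functionsI[of _ K] smooth_mult assms) auto
qed

lemma test_functions_bounded_support:
  assumes "\<phi> \<in> test_functions I"
  obtains R where "R \<ge> 1" "\<And>t. \<bar>t\<bar> > R \<Longrightarrow> \<phi> t = 0"
proof -
  obtain K where K: "compact K" "\<And>t. t \<notin> K \<Longrightarrow> \<phi> t = 0"
    using test_functionsE[OF assms] by metis
  obtain R where "\<And>t. t \<in> K \<Longrightarrow> norm t \<le> R"
    using compact_imp_bounded[OF K(1)] unfolding bounded_iff by blast
  then show ?thesis using that[of "max 1 R"] K(2) by fastforce
qed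

lemma smooth_bounded_Icc:
  assumes "smooth \<phi>"
  obtains B where "B > 0" "\<And>k t. k \<le> 2 \<Longrightarrow> t \<in> {a..b} \<Longrightarrow> cmod (nth_deriv k \<phi> t) \<le> B"
proof -
  have "\<exists>B. \<forall>t\<in>{a..b}. cmod (nth_deriv k \<phi> t) \<le> B" for k
  proof -
    have "compact (nth_deriv k \<phi> ` {a..b})"
      by (rule compact_continuous_image[OF smooth_continuous_on[OF assms]]) simp
    then show ?thesis using compact_imp_bounded bounded_iff by (metis imageI)
  qed
  then obtain B where B: "\<And>k t. t \<in> {a..b} \<Longrightarrow> cmod (nth_deriv k \<phi> t) \<le> B k" by metis
  have "cmod (nth_deriv k \<phi> t) \<le> 1 + \<bar>B 0\<bar> + \<bar>B 1\<bar> + \<bar>B 2\<bar>" if kt: "k \<le> 2" "t \<in> {a..b}" for k t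
  proof -
    consider "k = 0" | "k = 1" | "k = 2" using kt(1) by linarith
    then show ?thesis using B[OF kt(2), of k] by cases auto
  qed
  moreover have "0 < 1 + \<bar>B 0\<bar> + \<bar>B 1\<bar> + \<bar>B 2\<bar>"
    using abs_ge_zero[of "B 0"] abs_ge_zero[of "B 1"] abs_ge_zero[of "B 2"] by linarith
  ultimately show ?thesis using that by blast
qed

lemma test_functions_bounded:
  assumes "\<phi> \<in> test_functions I"
  obtains B where "B > 0" "\<And>t. cmod (\<phi> t) \<le> B"
proof -
  from assms obtain R where R: "\<And>t. \<bar>t\<bar> > R \<Longrightarrow> \<phi> t = 0"
    by (rule test_functions_bounded_support) blast
  obtain B where B: "B > 0" "\<And>k t. k \<le> 2 \<Longrightarrow> t \<in> {-R..R} \<Longrightarrow> cmod (nth_deriv k \<phi> t) \<le> B"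
    using smooth_bounded_Icc[OF test_functions_smooth[OF assms]] by metis
  have "cmod (\<phi> t) \<le> B" for t
  proof (cases "\<bar>t\<bar> > R")
    case False
    then have "t \<in> {-R..R}" by auto
    then show ?thesis using B(2)[of 0 t] by simp
  qed (use R B(1) in simp)
  then show ?thesis using that B(1) by blast
qed

definition scaled_bump :: "real \<Rightarrow> real \<Rightarrow> real \<Rightarrow> complex"
  where "scaled_bump c e t = bump ((2 / e) * t + - (2 / e) * c)"

lemma scaled_bump:
  assumes "e > 0"
  shows "smooth (scaled_bump c e)" "\<bar>t - c\<bar> \<le> e / 2 \<Longrightarrow> scaled_bump c e t = 1"
    "\<bar>t - c\<bar> \<ge> e \<Longrightarrow> scaled_bump c e t = 0"
proof -
  show "smooth (scaled_bump c e)"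
    unfolding scaled_bump_def[abs_def] by (rule nth_deriv_affine(2)[OF smooth_bump])
  have eq: "\<bar>2 / e * t + - (2 / e) * c\<bar> = 2 / e * \<bar>t - c\<bar>"
  proof -
    have "2 / e * t + - (2 / e) * c = 2 / e * (t - c)" by (simp add: right_diff_distrib)
    then show ?thesis using assms by (simp only: abs_mult) simp
  qed
  show "scaled_bump c e t = 1" if "\<bar>t - c\<bar> \<le> e / 2"
    unfolding scaled_bump_def by (rule bump_1, unfold eq) (use that assms in \<open>simp add: field_simps\<close>)
  show "scaled_bump c e t = 0" if "\<bar>t - c\<bar> \<ge> e"
    unfolding scaled_bump_def by (rule bump_0, unfold eq) (use that assms in \<open>simp add: field_simps\<close>)
qed

text \<open>A function whose \<open>k\<close>-th derivatives, \<open>k \<le> 2\<close>, are of size \<open>A / e\<^sup>k\<close> on an interval of length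
  \<open>2 e\<close>. With the right constant this is stable under products, and a bound \<open>A\<close> uniform in \<open>e\<close> will
  give a uniform bound for the \<open>L\<^sup>1\<close> norm of the Fourier transform.\<close>

definition scale_bounded :: "real \<Rightarrow> real \<Rightarrow> real \<Rightarrow> (real \<Rightarrow> complex) \<Rightarrow> bool"
  where "scale_bounded c e A a \<longleftrightarrow> smooth a \<and>
    (\<forall>k\<le>2. \<forall>t. \<bar>t - c\<bar> \<le> e \<longrightarrow> cmod (nth_deriv k a t) \<le> A / e ^ k)"

lemma nth_deriv_mult:
  assumes "smooth a" "smooth b"
  shows "nth_deriv (Suc 0) (\<lambda>t. a t * b t) t = nth_deriv (Suc 0) a t * b t + a t * nth_deriv (Suc 0) b t"
    and "nth_deriv 2 (\<lambda>t. a t * b t) t =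
      nth_deriv 2 a t * b t + 2 * nth_deriv (Suc 0) a t * nth_deriv (Suc 0) b t + a t * nth_deriv 2 b t"
proof -
  note D = smooth_mult_has_vector_derivative
  have 1: "nth_deriv (Suc 0) (\<lambda>t. a t * b t) =
      (\<lambda>t. nth_deriv (Suc 0) a t * b t + a t * nth_deriv (Suc 0) b t)"
    using nth_deriv_Suc_derivative[OF D[OF assms], of 0] by simp
  then show "nth_deriv (Suc 0) (\<lambda>t. a t * b t) t = nth_deriv (Suc 0) a t * b t + a t * nth_deriv (Suc 0) b t"
    by simp
  have n: "nth_deriv (Suc 0) (nth_deriv (Suc 0) h) = nth_deriv 2 h" for h
    by (auto simp: nth_deriv_def numeral_2_eq_2)
  have "nth_deriv 2 (\<lambda>t. a t * b t) t = vector_derivative (nth_deriv (Suc 0) (\<lambda>t. a t * b t)) (at t)"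
    using nth_deriv_Suc[of "Suc 0"] by (simp add: numeral_2_eq_2)
  also have "\<dots> = nth_deriv 2 a t * b t + nth_deriv (Suc 0) a t * nth_deriv (Suc 0) b t +
      (nth_deriv (Suc 0) a t * nth_deriv (Suc 0) b t + a t * nth_deriv 2 b t)"
    unfolding 1 n[symmetric]
    by (intro vector_derivative_at has_vector_derivative_add D smooth_derivative assms)
  finally show "nth_deriv 2 (\<lambda>t. a t * b t) t =
      nth_deriv 2 a t * b t + 2 * nth_deriv (Suc 0) a t * nth_deriv (Suc 0) b t + a t * nth_deriv 2 b t"
    by (simp add: algebra_simps)
qed

lemma scale_bounded_mult:
  assumes a: "scale_bounded c e A a" and b: "scale_bounded c e B b" and e: "e > 0"
  shows "scale_bounded c e (4 * A * B) (\<lambda>t. a t * b t)"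
  unfolding scale_bounded_def
proof (intro conjI allI impI)
  have s: "smooth a" "smooth b" using a b by (auto simp: scale_bounded_def)
  then show "smooth (\<lambda>t. a t * b t)" by (rule smooth_mult)
  fix k t assume k: "k \<le> (2::nat)" and t: "\<bar>t - c\<bar> \<le> e"
  have bd: "cmod (nth_deriv i a t) \<le> A / e ^ i" "cmod (nth_deriv i b t) \<le> B / e ^ i" if "i \<le> 2" for i
    using a b t that by (auto simp: scale_bounded_def)
  have AB: "A \<ge> 0" "B \<ge> 0" using bd[of 0] by (simp_all add: order_trans[OF norm_ge_zero])
  have m: "cmod (nth_deriv i a t * nth_deriv j b t) \<le> A * B / e ^ (i + j)" if "i \<le> 2" "j \<le> 2" for i j
    using mult_mono[OF bd(1)[OF that(1)] bd(2)[OF that(2)]] AB e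
    by (simp add: norm_mult power_add)
  consider "k = 0" | "k = Suc 0" | "k = 2" using k by linarith
  then show "cmod (nth_deriv k (\<lambda>t. a t * b t) t) \<le> 4 * A * B / e ^ k"
  proof cases
    case 1
    have "A * B \<le> 4 * A * B" using AB by simp
    with m[of 0 0] 1 show ?thesis by simp
  next
    case 2
    have "cmod (nth_deriv (Suc 0) a t * b t + a t * nth_deriv (Suc 0) b t) \<le> A * B / e + A * B / e"
      using m[of "Suc 0" 0] m[of 0 "Suc 0"] by (intro norm_triangle_le) simp
    also have "\<dots> \<le> 4 * A * B / e" using AB e by (simp add: field_simps)
    finally show ?thesis unfolding 2 nth_deriv_mult[OF s] by simp
  next
    case 3
    have "cmod (nth_deriv 2 a t * b t + 2 * (nth_deriv (Suc 0) a t * nth_deriv (Suc 0) b t) + a t * nth_deriv 2 b t)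
      \<le> A * B / e\<^sup>2 + 2 * (A * B / e\<^sup>2) + A * B / e\<^sup>2"
      using m[of 2 0] m[of 0 2] m[of "Suc 0" "Suc 0"]
      by (intro norm_triangle_le add_mono) (simp_all add: norm_mult numeral_2_eq_2)
    also have "\<dots> = 4 * A * B / e\<^sup>2" by simp
    finally show ?thesis unfolding 3 nth_deriv_mult[OF s] by (simp add: mult.assoc)
  qed
qed

lemma scale_bounded_bump:
  obtains Q where "Q > 0" "\<And>c e. e > 0 \<Longrightarrow> scale_bounded c e Q (scaled_bump c e)"
proof -
  obtain B where B: "B > 0" "\<And>k t. k \<le> 2 \<Longrightarrow> t \<in> {-2..2} \<Longrightarrow> cmod (nth_deriv k bump t) \<le> B"
    using smooth_bounded_Icc[OF smooth_bump] by metis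
  have "scale_bounded c e (4 * B) (scaled_bump c e)" if e: "e > 0" for c e
    unfolding scale_bounded_def
  proof (intro conjI allI impI)
    show "smooth (scaled_bump c e)" by (rule scaled_bump[OF e])
    fix k t assume k: "k \<le> (2::nat)" and t: "\<bar>t - c\<bar> \<le> e"
    let ?u = "2 / e * t + - (2 / e) * c"
    have "?u = 2 / e * (t - c)" by (simp add: right_diff_distrib)
    then have "\<bar>?u\<bar> \<le> 2" using e t by (simp add: abs_mult field_simps)
    then have u: "cmod (nth_deriv k bump ?u) \<le> B" by (intro B(2) k) auto
    have "nth_deriv k (scaled_bump c e) t = of_real (2 / e) ^ k * nth_deriv k bump ?u"
      unfolding scaled_bump_def[abs_def] nth_deriv_affine(1)[OF smooth_bump] ..
    then have "cmod (nth_deriv k (scaled_bump c e) t) \<le> (2 / e) ^ k * B"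
      using e u by (simp add: norm_mult norm_power norm_divide divide_right_mono power_divide mult_left_mono)
    also have "\<dots> \<le> 4 * B / e ^ k"
      using e B(1) power_increasing[OF k, of "2::real"] by (simp add: power_divide divide_right_mono)
    finally show "cmod (nth_deriv k (scaled_bump c e) t) \<le> 4 * B / e ^ k" .
  qed
  then show ?thesis using that[of "4 * B"] B(1) by simp
qed

lemma scale_bounded_smooth:
  assumes "smooth \<psi>"
  obtains P where "P > 0" "\<And>e. 0 < e \<Longrightarrow> e \<le> 1 \<Longrightarrow> scale_bounded c e P \<psi>"
proof -
  obtain P where P: "P > 0" "\<And>k t. k \<le> 2 \<Longrightarrow> t \<in> {c-1..c+1} \<Longrightarrow> cmod (nth_deriv k \<psi> t) \<le> P"
    using smooth_bounded_Icc[OF assms] by metis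
  have "scale_bounded c e P \<psi>" if e: "0 < e" "e \<le> 1" for e
    unfolding scale_bounded_def
  proof (intro conjI allI impI assms)
    fix k t assume k: "k \<le> (2::nat)" and t: "\<bar>t - c\<bar> \<le> e"
    have "cmod (nth_deriv k \<psi> t) \<le> P" by (intro P(2) k) (use t e in auto)
    also have "\<dots> \<le> P / e ^ k" using P(1) e by (simp add: field_simps power_le_one)
    finally show "cmod (nth_deriv k \<psi> t) \<le> P / e ^ k" .
  qed
  then show ?thesis using that[of P] P(1) by blast
qed

lemma scale_bounded_large:
  assumes "smooth \<phi>" "R \<ge> 1" "B \<ge> 0" and B: "\<And>k t. k \<le> 2 \<Longrightarrow> \<bar>t\<bar> \<le> R \<Longrightarrow> cmod (nth_deriv k \<phi> t) \<le> B"
  shows "scale_bounded 0 R (B * R\<^sup>2) \<phi>"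
  unfolding scale_bounded_def
proof (intro conjI allI impI assms(1))
  fix k t assume k: "k \<le> (2::nat)" and t: "\<bar>t - 0\<bar> \<le> R"
  have "B * R ^ k \<le> B * R\<^sup>2"
    using power_increasing[OF k assms(2)] assms(3) by (rule mult_left_mono)
  then have "B \<le> B * R\<^sup>2 / R ^ k" using assms(2) by (simp add: pos_le_divide_eq)
  then show "cmod (nth_deriv k \<phi> t) \<le> B * R\<^sup>2 / R ^ k" using B[OF k, of t] t by simp
qed

text \<open>The factor \<open>e\<close> in this bound comes from the zero of the function at the centre \<open>c\<close>.\<close>

lemma scale_bounded_exp_minus_1:
  assumes e: "0 < e" "e \<le> 1" and h: "h \<ge> 0"
  shows "scale_bounded c e ((h + h\<^sup>2) * e) (\<lambda>t. exp (\<i> * of_real h * of_real (t - c)) - 1)"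
  unfolding scale_bounded_def
proof (intro conjI allI impI)
  let ?E = "\<lambda>t. exp (\<i> * of_real h * of_real (t - c))"
  have D: "((\<lambda>t. ?E t - 1) has_vector_derivative \<i> * of_real h * ?E t) (at t)"
    "((\<lambda>t. \<i> * of_real h * ?E t) has_vector_derivative - (of_real h)\<^sup>2 * ?E t) (at t)" for t
    unfolding of_real_diff
    by (rule has_vector_derivative_real_field,
        auto intro!: derivative_eq_intros simp: power2_eq_square algebra_simps)+
  show "smooth (\<lambda>t. ?E t - 1)"
  proof -
    have "smooth (\<lambda>t. exp (\<i> * of_real h * of_real (1 * t + - c)))"
      by (rule nth_deriv_affine(2)[OF smooth_exp])
    then show ?thesis by (intro smooth_diff smooth_const) simp
  qed
  have d1: "nth_deriv (Suc 0) (\<lambda>t. ?E t - 1) = (\<lambda>t. \<i> * of_real h * ?E t)"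
    using nth_deriv_Suc_derivative[OF D(1), of 0] by simp
  have d2: "nth_deriv 2 (\<lambda>t. ?E t - 1) = (\<lambda>t. - (of_real h)\<^sup>2 * ?E t)"
    using nth_deriv_Suc_derivative[OF D(1), of "Suc 0"] nth_deriv_Suc_derivative[OF D(2), of 0]
    by (simp add: numeral_2_eq_2)
  have nE: "cmod (?E t) = 1" for t by (simp add: norm_exp_eq_Re)
  fix k t assume k: "k \<le> (2::nat)" and t: "\<bar>t - c\<bar> \<le> e"
  consider "k = 0" | "k = Suc 0" | "k = 2" using k by linarith
  then show "cmod (nth_deriv k (\<lambda>t. ?E t - 1) t) \<le> (h + h\<^sup>2) * e / e ^ k"
  proof cases
    case 1
    have "cmod (?E t - 1) \<le> \<bar>h * (t - c)\<bar>"
      using dist_exp_i_1[of "h * (t - c)"] abs_sin_x_le_abs_x[of "h * (t - c) / 2"]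
      by (simp add: mult.assoc dist_norm)
    also have "\<dots> \<le> h * e" using t h by (simp add: abs_mult mult_left_mono)
    also have "\<dots> \<le> (h + h\<^sup>2) * e" using e by (simp add: algebra_simps)
    finally show ?thesis using 1 by simp
  next
    case 2
    have "cmod (nth_deriv k (\<lambda>t. ?E t - 1) t) = h"
      using h unfolding 2 d1 norm_mult nE by simp
    then show ?thesis using e h 2 by simp
  next
    case 3
    have "cmod (nth_deriv k (\<lambda>t. ?E t - 1) t) = h\<^sup>2"
      unfolding 3 d2 norm_mult nE by (simp add: norm_power)
    also have "\<dots> \<le> (h + h\<^sup>2) / e"
      using mult_right_mono[of e 1 "h\<^sup>2"] e h by (simp add: field_simps)
    also have "\<dots> = (h + h\<^sup>2) * e / e ^ k" using e 3 by (simp add: power2_eq_square)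
    finally show ?thesis .
  qed
qed

section \<open>The Fourier transform of test functions\<close>

lemma fourier_eq_integral_Icc:
  assumes "\<And>t. t \<notin> {a..b} \<Longrightarrow> \<phi> t = 0"
  shows "fourier \<phi> s = integral {a..b} (\<lambda>t. exp (- \<i> * of_real s * of_real t) * \<phi> t)"
proof -
  have "(\<lambda>t. exp (- \<i> * of_real s * of_real t) * \<phi> t) =
      (\<lambda>t. if t \<in> {a..b} then exp (- \<i> * of_real s * of_real t) * \<phi> t else 0)"
    using assms by auto
  then have "fourier \<phi> s = integral UNIV (\<lambda>t. if t \<in> {a..b}
      then exp (- \<i> * of_real s * of_real t) * \<phi> t else 0)"
    unfolding fourier_def by (rule arg_cong)
  then show ?thesis unfolding integral_restrict_UNIV .
qed

lemma continuous_on_fourier: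
  assumes "\<phi> \<in> test_functions I"
  shows "continuous_on S (fourier \<phi>)"
proof -
  obtain R where R: "\<And>t. \<bar>t\<bar> > R \<Longrightarrow> \<phi> t = 0"
    using test_functions_bounded_support[OF assms] by metis
  have "\<phi> t = 0" if "t \<notin> {-R..R}" for t using that by (intro R) auto
  then have eq: "fourier \<phi> s = integral {-R..R} (\<lambda>t. exp (- \<i> * of_real s * of_real t) * \<phi> t)" for s
    by (rule fourier_eq_integral_Icc)
  have "continuous_on UNIV \<phi>"
    by (rule smooth_continuous_on_0[OF test_functions_smooth[OF assms]])
  then have "continuous_on (S \<times> cbox (-R) R) (\<lambda>(s, t). exp (- \<i> * of_real s * of_real t) * \<phi> t)"
    by (auto simp: split_beta intro!: continuous_intros elim: continuous_on_compose2)
  then show ?thesis unfolding eq[abs_def] using integral_continuous_on_param by fastforce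
qed

lemma fourier_lincomb:
  assumes "\<phi> \<in> test_functions I" "\<psi> \<in> test_functions I"
  shows "fourier (\<lambda>t. a * \<phi> t + b * \<psi> t) s = a * fourier \<phi> s + b * fourier \<psi> s"
proof -
  have *: "(\<lambda>t. exp (- \<i> * of_real s * of_real t) * \<phi> t) integrable_on UNIV"
    if \<phi>: "\<phi> \<in> test_functions I" for \<phi>
  proof -
    obtain R where R: "\<And>t. \<bar>t\<bar> > R \<Longrightarrow> \<phi> t = 0"
      using test_functions_bounded_support[OF \<phi>] by metis
    have "continuous_on UNIV \<phi>"
      by (rule smooth_continuous_on_0[OF test_functions_smooth[OF \<phi>]])
    then have "(\<lambda>t. exp (- \<i> * of_real s * of_real t) * \<phi> t) integrable_on {-R..R}"
      by (intro integrable_continuous_interval continuous_intros) (auto elim: continuous_on_subset)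
    then show ?thesis
      by (rule integrable_on_superset) (use R in \<open>auto simp: not_le abs_less_iff\<close>)
  qed
  have "fourier (\<lambda>t. a * \<phi> t + b * \<psi> t) s = integral UNIV (\<lambda>t.
      a * (exp (- \<i> * of_real s * of_real t) * \<phi> t) + b * (exp (- \<i> * of_real s * of_real t) * \<psi> t))"
    unfolding fourier_def by (simp add: algebra_simps)
  also have "\<dots> = a * fourier \<phi> s + b * fourier \<psi> s"
    unfolding fourier_def using *[OF assms(1)] *[OF assms(2)]
    by (subst integral_add) (auto intro: integrable_on_mult_right)
  finally show ?thesis .
qed

text \<open>Modulations of a test function correspond to translations of its transform, and conversely.\<close>

lemma fourier_modulation:
  "fourier (\<lambda>\<xi>. \<phi> \<xi> * exp (\<i> * of_real t * of_real \<xi>)) s = fourier \<phi> (s - t)"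
  unfolding fourier_def by (simp add: algebra_simps flip: exp_add)

lemma fourier_translation:
  assumes "\<phi> \<in> test_functions UNIV"
  shows "fourier (\<lambda>\<xi>. \<phi> (\<xi> + \<eta>)) s = exp (\<i> * of_real \<eta> * of_real s) * fourier \<phi> s"
proof -
  obtain R where R: "\<And>t. \<bar>t\<bar> > R \<Longrightarrow> \<phi> t = 0"
    using test_functions_bounded_support[OF assms] by metis
  let ?g = "\<lambda>\<xi>. exp (- \<i> * of_real s * of_real (\<xi> - \<eta>)) * \<phi> \<xi>"
  have c: "continuous_on UNIV \<phi>"
    by (rule smooth_continuous_on_0[OF test_functions_smooth[OF assms]])
  have "fourier (\<lambda>\<xi>. \<phi> (\<xi> + \<eta>)) s =
      integral {-R-\<eta>..R-\<eta>} (\<lambda>\<xi>. exp (- \<i> * of_real s * of_real \<xi>) * \<phi> (\<xi> + \<eta>))"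
    by (rule fourier_eq_integral_Icc, rule R) auto
  also have "\<dots> = integral {-R-\<eta>..R-\<eta>} (?g \<circ> (\<lambda>\<xi>. \<xi> + \<eta>))"
    by (simp add: o_def)
  also have "\<dots> = integral {-R-\<eta>+\<eta>..R-\<eta>+\<eta>} ?g"
    by (rule integral_shift) (auto intro!: continuous_intros continuous_on_subset[OF c])
  also have "\<dots> = integral {-R..R} (\<lambda>\<xi>. exp (\<i> * of_real \<eta> * of_real s) *
      (exp (- \<i> * of_real s * of_real \<xi>) * \<phi> \<xi>))"
  proof -
    have "exp (- \<i> * of_real s * of_real (\<xi> - \<eta>)) =
        exp (\<i> * of_real \<eta> * of_real s) * exp (- \<i> * of_real s * of_real \<xi>)" for \<xi>
      unfolding mult_exp_exp by (rule arg_cong[of _ _ exp]) (simp add: algebra_simps)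
    then show ?thesis by (simp add: mult.assoc)
  qed
  also have "\<dots> = exp (\<i> * of_real \<eta> * of_real s) *
      integral {-R..R} (\<lambda>\<xi>. exp (- \<i> * of_real s * of_real \<xi>) * \<phi> \<xi>)"
    by (rule integral_mult_right)
  also have "integral {-R..R} (\<lambda>\<xi>. exp (- \<i> * of_real s * of_real \<xi>) * \<phi> \<xi>) = fourier \<phi> s"
    by (rule fourier_eq_integral_Icc[symmetric], rule R) auto
  finally show ?thesis .
qed

lemma norm_fourier_le:
  assumes c: "continuous_on UNIV \<phi>" and e: "e \<ge> 0"
    and 0: "\<And>t. \<bar>t - c\<bar> > e \<Longrightarrow> \<phi> t = 0" and B: "\<And>t. \<bar>t - c\<bar> \<le> e \<Longrightarrow> cmod (\<phi> t) \<le> B"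
  shows "cmod (fourier \<phi> s) \<le> B * (2 * e)"
proof -
  have "fourier \<phi> s = integral {c-e..c+e} (\<lambda>t. exp (- \<i> * of_real s * of_real t) * \<phi> t)"
    by (rule fourier_eq_integral_Icc, rule 0) auto
  also have "cmod \<dots> \<le> B * ((c + e) - (c - e))"
  proof (rule integral_bound)
    show "continuous_on {c - e..c + e} (\<lambda>t. exp (- \<i> * of_real s * of_real t) * \<phi> t)"
      by (intro continuous_intros continuous_on_subset[OF c]) auto
    show "cmod (exp (- \<i> * of_real s * of_real t) * \<phi> t) \<le> B" if "t \<in> {c - e..c + e}" for t
      using that B[of t] by (simp add: norm_mult abs_le_iff)
  qed (use e in simp)
  finally show ?thesis by simp
qed

lemma derivative_zero_outside:
  assumes s: "smooth \<phi>" and 0: "\<And>t. \<bar>t - c\<bar> > e \<Longrightarrow> \<phi> t = 0" and t: "\<bar>t - c\<bar> > e"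
  shows "nth_deriv (Suc 0) \<phi> t = 0"
proof -
  have "open {t. \<bar>t - c\<bar> > e}" by (intro open_Collect_less continuous_intros)
  moreover have "((\<lambda>_. 0 :: complex) has_vector_derivative 0) (at t)" by simp
  ultimately have "(\<phi> has_vector_derivative 0) (at t)"
    using has_vector_derivative_transform_within_open[of "\<lambda>_. 0" 0 t "{t. \<bar>t - c\<bar> > e}" \<phi>] 0 t by auto
  then show ?thesis
    using smooth_has_vector_derivative_1[OF s] vector_derivative_unique_at by blast
qed

lemma fourier_derivative:
  assumes s: "smooth \<phi>" and e: "e \<ge> 0" and 0: "\<And>t. \<bar>t - c\<bar> > e \<Longrightarrow> \<phi> t = 0"
  shows "fourier (nth_deriv (Suc 0) \<phi>) s = \<i> * of_real s * fourier \<phi> s"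
proof -
  let ?a = "c - e - 1" and ?b = "c + e + 1"
  let ?E = "\<lambda>t. exp (- \<i> * of_real s * of_real t)"
  have z: "fourier \<phi> s = integral {?a..?b} (\<lambda>t. ?E t * \<phi> t)"
    by (rule fourier_eq_integral_Icc, rule 0) auto
  have z': "fourier (nth_deriv (Suc 0) \<phi>) s = integral {?a..?b} (\<lambda>t. ?E t * nth_deriv (Suc 0) \<phi> t)"
    by (rule fourier_eq_integral_Icc, rule derivative_zero_outside[OF s 0]) auto
  have E: "(?E has_vector_derivative (- \<i> * of_real s) * ?E t) (at t)" for t
    by (rule has_vector_derivative_real_field) (auto intro!: derivative_eq_intros)
  have cE: "continuous_on {?a..?b} ?E" by (intro continuous_intros)
  have ends: "\<phi> ?a = 0" "\<phi> ?b = 0" using e by (auto intro!: 0)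
  have "((\<lambda>t. \<phi> t * ((- \<i> * of_real s) * ?E t)) has_integral
      (- \<i> * of_real s) * fourier \<phi> s) {?a..?b}"
  proof -
    have "(\<lambda>t. ?E t * \<phi> t) integrable_on {?a..?b}"
      by (intro integrable_continuous_interval continuous_intros smooth_continuous_on_0 s)
    then have "((\<lambda>t. ?E t * \<phi> t) has_integral fourier \<phi> s) {?a..?b}"
      unfolding z by (rule integrable_integral)
    from has_integral_mult_right[OF this, of "- \<i> * of_real s"]
    show ?thesis by (simp add: algebra_simps)
  qed
  then have "((\<lambda>t. nth_deriv (Suc 0) \<phi> t * ?E t) has_integral \<i> * of_real s * fourier \<phi> s) {?a..?b}"
    by (intro integration_by_parts[OF bounded_bilinear_mult, of ?a ?b \<phi> ?E])
       (use e ends E smooth_continuous_on_0[OF s] cE in \<open>auto intro!: smooth_has_vector_derivative_1 s\<close>)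
  then show ?thesis unfolding z' by (simp add: has_integral_iff mult.commute)
qed

text \<open>Two integrations by parts, at the scale \<open>e\<close> of the support. The bound has integral
  \<open>4 \<pi> B\<close>, whatever \<open>e\<close> is.\<close>

lemma fourier_scale_bound:
  assumes b: "scale_bounded c e B \<phi>" and e: "e > 0" and 0: "\<And>t. \<bar>t - c\<bar> > e \<Longrightarrow> \<phi> t = 0"
  shows "cmod (fourier \<phi> s) \<le> 4 * B * (e / (1 + (e * s)\<^sup>2))"
proof -
  let ?d1 = "nth_deriv (Suc 0) \<phi>" and ?d2 = "nth_deriv (Suc 0) (nth_deriv (Suc 0) \<phi>)"
  have d2: "?d2 = nth_deriv 2 \<phi>" by (auto simp: nth_deriv_def numeral_2_eq_2)
  have s: "smooth \<phi>" and B: "\<And>t. \<bar>t - c\<bar> \<le> e \<Longrightarrow> cmod (\<phi> t) \<le> B"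
    "\<And>t. \<bar>t - c\<bar> \<le> e \<Longrightarrow> cmod (?d2 t) \<le> B / e\<^sup>2"
    using b unfolding scale_bounded_def d2 by (force, force, auto)
  note s1 = smooth_derivative[OF s, of "Suc 0"]
  have z1: "?d1 t = 0" if "\<bar>t - c\<bar> > e" for t
    using derivative_zero_outside[OF s, of e c t] 0 that by blast
  have z2: "?d2 t = 0" if "\<bar>t - c\<bar> > e" for t
    using derivative_zero_outside[OF s1, of e c t] z1 that by blast
  have "cmod (fourier \<phi> s) \<le> B * (2 * e)"
    by (rule norm_fourier_le[OF smooth_continuous_on_0[OF s] _ 0 B(1)]) (use e in auto)
  moreover have "cmod (fourier ?d2 s) \<le> B / e\<^sup>2 * (2 * e)"
    by (rule norm_fourier_le[OF smooth_continuous_on_0[OF smooth_derivative[OF s1]] _ z2 B(2)])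
       (use e in auto)
  moreover have "fourier ?d2 s = - (of_real s)\<^sup>2 * fourier \<phi> s"
    using fourier_derivative[OF s, of e c s] fourier_derivative[OF s1, of e c s] e 0 z1
    by (simp add: power2_eq_square mult.assoc mult.left_commute[of "of_real s" \<i>])
  ultimately have "cmod (fourier \<phi> s) \<le> B * (2 * e)" "s\<^sup>2 * cmod (fourier \<phi> s) \<le> B / e\<^sup>2 * (2 * e)"
    by (simp_all add: norm_mult norm_power)
  then have "cmod (fourier \<phi> s) + e\<^sup>2 * (s\<^sup>2 * cmod (fourier \<phi> s)) \<le>
      B * (2 * e) + e\<^sup>2 * (B / e\<^sup>2 * (2 * e))"
    by (intro add_mono mult_left_mono) auto
  also have "\<dots> = 4 * B * e" using e by simp
  finally have "(1 + (e * s)\<^sup>2) * cmod (fourier \<phi> s) \<le> 4 * B * e"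
    by (simp add: algebra_simps power_mult_distrib)
  moreover have "1 + (e * s)\<^sup>2 > 0" by (rule add_pos_nonneg) auto
  ultimately show ?thesis by (simp add: field_simps)
qed

lemma fourier_decay:
  assumes "\<phi> \<in> test_functions I"
  obtains C where "C > 0" "\<And>s. cmod (fourier \<phi> s) \<le> C * (1 / (1 + s\<^sup>2))"
proof -
  from assms obtain R where R: "R \<ge> 1" "\<And>t. \<bar>t\<bar> > R \<Longrightarrow> \<phi> t = 0"
    by (rule test_functions_bounded_support) blast
  have s: "smooth \<phi>" by (rule test_functions_smooth[OF assms])
  obtain B where B: "B > 0" "\<And>k t. k \<le> 2 \<Longrightarrow> t \<in> {-R..R} \<Longrightarrow> cmod (nth_deriv k \<phi> t) \<le> B"
    using smooth_bounded_Icc[OF s] by metis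
  define A where "A = B * R\<^sup>2"
  have A: "A > 0" using B(1) R(1) by (simp add: A_def)
  have "scale_bounded 0 R A \<phi>"
    unfolding A_def
  proof (rule scale_bounded_large[OF s R(1)])
    show "cmod (nth_deriv k \<phi> t) \<le> B" if "k \<le> 2" "\<bar>t\<bar> \<le> R" for k t
      by (rule B(2)[OF that(1)]) (use that(2) in auto)
  qed (use B(1) in simp)
  then have *: "cmod (fourier \<phi> s) \<le> 4 * A * (R / (1 + (R * s)\<^sup>2))" for s
    by (rule fourier_scale_bound) (use R in auto)
  define C where "C = 4 * A * (R + 1 / R)"
  show ?thesis
  proof (rule that[of C])
    show "C > 0" using A R(1) by (simp add: C_def add_pos_pos)
    fix s
    have p: "1 + (R * s)\<^sup>2 > 0" "1 + s\<^sup>2 > 0" by (auto intro: add_pos_nonneg)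
    have "R * (1 + s\<^sup>2) \<le> (R + 1 / R) * (1 + (R * s)\<^sup>2)"
      using R(1) by (simp add: field_simps power2_eq_square)
    then have "R / (1 + (R * s)\<^sup>2) \<le> (R + 1 / R) * (1 / (1 + s\<^sup>2))"
      using p by (simp add: divide_simps mult.commute)
    then have "4 * A * (R / (1 + (R * s)\<^sup>2)) \<le> 4 * A * ((R + 1 / R) * (1 / (1 + s\<^sup>2)))"
      using A by (intro mult_left_mono) auto
    with *[of s] show "cmod (fourier \<phi> s) \<le> C * (1 / (1 + s\<^sup>2))"
      by (simp add: C_def mult.assoc)
  qed
qed

lemma has_integral_Cauchy: "((\<lambda>s. 1 / (1 + (s - t)\<^sup>2)) has_integral pi) UNIV"
  using has_integral_Poisson[of 1 t] by simp

lemma integrable_fourier: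
  assumes "\<phi> \<in> test_functions I"
  shows "fourier \<phi> integrable_on UNIV"
proof -
  from assms obtain C where C: "C > 0" "\<And>s. cmod (fourier \<phi> s) \<le> C * (1 / (1 + s\<^sup>2))"
    by (rule fourier_decay) blast
  show ?thesis
    by (rule norm_integral_dominated(1)[OF _ _ continuous_on_fourier[OF assms]
        has_integral_mult_right[OF has_integral_Cauchy[of 0], of C]])
       (use C in \<open>auto simp: add_nonneg_nonneg\<close>)
qed

text \<open>Split at distance \<open>d\<close> from \<open>t\<close>: near \<open>t\<close> the weight is small, and away from \<open>t\<close> the
  Poisson kernel is at most \<open>1/N\<close> times a fixed integrable function.\<close>

lemma Poisson_weight_bound:
  fixes w :: real
  assumes d: "d > 0" and N: "N > 0" and w: "w \<le> D" "\<bar>s - t\<bar> \<le> d \<Longrightarrow> w \<le> k" and kD: "k \<ge> 0" "D \<ge> 0"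
  shows "w * (N / (1 + (N * (s - t))\<^sup>2)) \<le>
    k * (N / (1 + (N * (s - t))\<^sup>2)) + D * (1 + 1 / d\<^sup>2) / N * (1 / (1 + (s - t)\<^sup>2))"
proof (cases "\<bar>s - t\<bar> \<le> d")
  case True
  have "w * (N / (1 + (N * (s - t))\<^sup>2)) \<le> k * (N / (1 + (N * (s - t))\<^sup>2))"
    using w(2)[OF True] N by (intro mult_right_mono) auto
  moreover have "D * (1 + 1 / d\<^sup>2) / N * (1 / (1 + (s - t)\<^sup>2)) \<ge> 0"
    using kD N by (intro mult_nonneg_nonneg divide_nonneg_nonneg) auto
  ultimately show ?thesis by linarith
next
  case False
  define r where "r = (s - t)\<^sup>2"
  have r: "r \<ge> d\<^sup>2" unfolding r_def using False d
    by (metis abs_le_square_iff abs_of_pos linear)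
  have d2: "d\<^sup>2 > 0" "r > 0" using d r by (auto intro: less_le_trans[of 0 "d\<^sup>2"])
  have "N / (1 + N\<^sup>2 * r) \<le> N / (N\<^sup>2 * r)"
    using N d2 by (intro divide_left_mono) (auto intro!: mult_pos_pos add_pos_pos)
  also have "\<dots> = 1 / N * (1 / r)" using N by (simp add: power2_eq_square)
  also have "1 / r \<le> (1 + 1 / d\<^sup>2) * (1 / (1 + r))"
  proof -
    have "1 / r = (1 + 1 / r) * (1 / (1 + r))" using d2 by (simp add: field_simps)
    also have "\<dots> \<le> (1 + 1 / d\<^sup>2) * (1 / (1 + r))"
      using r d2 by (intro mult_right_mono add_left_mono divide_left_mono) auto
    finally show ?thesis .
  qed
  finally have *: "N / (1 + N\<^sup>2 * r) \<le> 1 / N * ((1 + 1 / d\<^sup>2) * (1 / (1 + r)))"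
    using N by (simp add: mult_left_mono divide_right_mono)
  have "w * (N / (1 + N\<^sup>2 * r)) \<le> D * (N / (1 + N\<^sup>2 * r))"
    using w(1) N d2 by (intro mult_right_mono) auto
  also have "\<dots> \<le> D * (1 / N * ((1 + 1 / d\<^sup>2) * (1 / (1 + r))))"
    using * kD by (intro mult_left_mono) auto
  finally have "w * (N / (1 + N\<^sup>2 * r)) \<le> D * (1 + 1 / d\<^sup>2) / N * (1 / (1 + r))"
    by simp
  moreover have "k * (N / (1 + N\<^sup>2 * r)) \<ge> 0"
    using kD N d2 by auto
  ultimately show ?thesis unfolding r_def by (simp add: power_mult_distrib)
qed

text \<open>The error made when a kernel dominated by the Poisson kernel is applied to a function that is
  small near \<open>t\<close>; it is small once \<open>N\<close> is large.\<close>

lemma Poisson_approximation: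
  fixes w :: "real \<Rightarrow> 'a::complex_banach"
  assumes S: "closed S" "is_interval S" "continuous_on S K" "continuous_on S w"
    and K: "\<And>s. cmod (K s) \<le> c * (N / (1 + (N * (s - t))\<^sup>2))" and N: "N > 0" "c \<ge> 0"
    and d: "d > 0" "k \<ge> 0" "D \<ge> 0"
    and w: "\<And>s. s \<in> S \<Longrightarrow> norm (w s) \<le> D" "\<And>s. s \<in> S \<Longrightarrow> \<bar>s - t\<bar> \<le> d \<Longrightarrow> norm (w s) \<le> k"
  shows "norm (integral S (\<lambda>s. K s *\<^sub>C w s)) \<le> c * (k * pi + D * (1 + 1 / d\<^sup>2) / N * pi)"
proof (rule norm_integral_dominated(2)[OF S(1,2)])
  let ?h = "\<lambda>s. c * (k * (N / (1 + (N * (s - t))\<^sup>2)) + D * (1 + 1 / d\<^sup>2) / N * (1 / (1 + (s - t)\<^sup>2)))"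
  show "(?h has_integral c * (k * pi + D * (1 + 1 / d\<^sup>2) / N * pi)) UNIV"
    by (intro has_integral_mult_right has_integral_add has_integral_Poisson has_integral_Cauchy N)
  show "0 \<le> ?h s" for s
    using d N by (intro mult_nonneg_nonneg add_nonneg_nonneg divide_nonneg_nonneg) auto
  show "norm (K s *\<^sub>C w s) \<le> ?h s" if s: "s \<in> S" for s
  proof -
    have "norm (K s *\<^sub>C w s) \<le> c * (N / (1 + (N * (s - t))\<^sup>2)) * norm (w s)"
      unfolding norm_scaleC using K by (rule mult_right_mono) simp
    also have "\<dots> = c * (norm (w s) * (N / (1 + (N * (s - t))\<^sup>2)))" by simp
    also have "\<dots> \<le> ?h s"
      by (intro mult_left_mono Poisson_weight_bound d N w s)
    finally show ?thesis .
  qed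
qed (intro continuous_intros S)

section \<open>Fourier inversion\<close>

lemma has_integral_exp_halfline:
  assumes "Re \<mu> > 0"
  shows "((\<lambda>t. exp (- \<mu> * of_real t)) has_integral 1 / \<mu>) {0..}"
proof -
  have l0: "\<mu> \<noteq> 0" using assms by auto
  have int: "(\<lambda>t. exp (- \<mu> * of_real t)) integrable_on {0..}"
  proof (rule integrable_dominated)
    show "(\<lambda>t. exp (- Re \<mu> * t)) integrable_on {0..}"
      by (rule integrable_on_exp_minus_to_infinity[OF assms])
  qed (auto intro!: continuous_intros simp: norm_exp_eq_Re)
  have "integral ({0..} \<inter> {- real n..real n}) (\<lambda>t. exp (- \<mu> * of_real t)) =
      1 / \<mu> - exp (- \<mu> * of_real (real n)) / \<mu>" for n
  proof -
    have "((\<lambda>t. - (exp (- \<mu> * of_real t) / \<mu>)) has_vector_derivative exp (- \<mu> * of_real t)) (at t within S)" for t S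
      by (rule has_vector_derivative_real_field)
         (use l0 in \<open>auto intro!: derivative_eq_intros\<close>)
    then have "((\<lambda>t. exp (- \<mu> * of_real t)) has_integral
        (- (exp (- \<mu> * of_real (real n)) / \<mu>) - - (exp (- \<mu> * of_real 0) / \<mu>))) {0..real n}"
      by (intro fundamental_theorem_of_calculus) auto
    moreover have "{0..} \<inter> {- real n..real n} = {0..real n}" by auto
    ultimately show ?thesis by (simp add: has_integral_iff)
  qed
  then have lim: "(\<lambda>n. 1 / \<mu> - exp (- \<mu> * of_real (real n)) / \<mu>)
      \<longlonglongrightarrow> integral {0..} (\<lambda>t. exp (- \<mu> * of_real t))"
    using integral_truncated_tendsto[OF int] by simp
  have "(\<lambda>n. exp (- Re \<mu> * real n)) \<longlonglongrightarrow> 0"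
    using assms by (intro filterlim_compose[OF exp_at_bot] filterlim_tendsto_neg_mult_at_bot[OF tendsto_const _ filterlim_real_sequentially]) auto
  then have "(\<lambda>n. exp (- \<mu> * of_real (real n))) \<longlonglongrightarrow> 0"
    by (rule Lim_null_comparison[rotated]) (simp add: norm_exp_eq_Re)
  then have "(\<lambda>n. 1 / \<mu> - exp (- \<mu> * of_real (real n)) / \<mu>) \<longlonglongrightarrow> 1 / \<mu> - 0 / \<mu>"
    using l0 by (intro tendsto_intros)
  with lim have "integral {0..} (\<lambda>t. exp (- \<mu> * of_real t)) = 1 / \<mu>"
    using LIMSEQ_unique by fastforce
  with int show ?thesis by (simp add: has_integral_iff)
qed

lemma has_integral_UNIV_halflines:
  fixes f :: "real \<Rightarrow> 'a::banach"
  assumes "(f has_integral a) {0..}" "((\<lambda>t. f (- t)) has_integral b) {0..}"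
  shows "(f has_integral (b + a)) UNIV"
proof -
  have "(f has_integral b) {..0}"
    using has_integral_reflect_set[OF assms(2)] by (simp add: atMost_def)
  from has_integral_Un[OF this assms(1)] have "(f has_integral (b + a)) ({..0} \<union> {0..})"
    by (simp add: atMost_def atLeast_def Int_def order_eq_iff[symmetric])
  moreover have "{..0} \<union> {0..} = (UNIV :: real set)" by auto
  ultimately show ?thesis by simp
qed

lemma integral_UNIV_halflines:
  fixes f :: "real \<Rightarrow> 'a::banach"
  assumes "f integrable_on {0..}" "(\<lambda>t. f (- t)) integrable_on {0..}"
  shows "integral UNIV f = integral {0..} (\<lambda>t. f (- t)) + integral {0..} f"
  using has_integral_UNIV_halflines[OF integrable_integral[OF assms(1)] integrable_integral[OF assms(2)]]
  by (rule integral_unique)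

text \<open>By Fubini, damping the integral of the transform by \<open>exp (- |s| / N)\<close> gives the Poisson integral
  of \<open>\<phi>\<close>, since the Poisson kernel is the transform of the damping factor.\<close>

lemma integral_fourier_damped:
  assumes \<phi>: "\<phi> \<in> test_functions I" and R: "\<And>t. \<bar>t\<bar> > R \<Longrightarrow> \<phi> t = 0" and N: "N > 0"
  shows "integral UNIV (\<lambda>s. exp (- of_real (\<bar>s\<bar> / N)) * fourier \<phi> s) =
    integral {-R..R} (\<lambda>t. \<phi> t * of_real (2 * (N / (1 + (N * t)\<^sup>2))))"
proof -
  let ?H = "\<lambda>t s. exp (- of_real (\<bar>s\<bar> / N)) * (exp (- \<i> * of_real s * of_real t) * \<phi> t)"
  have c: "continuous_on UNIV \<phi>"
    by (rule smooth_continuous_on_0[OF test_functions_smooth[OF \<phi>]])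
  from \<phi> obtain B where B0: "B > 0" and B: "\<And>t. cmod (\<phi> t) \<le> B"
    by (rule test_functions_bounded) blast
  have *: "((\<lambda>s::real. exp (- (1/N) * s)) has_integral N) {0..}"
    using has_integral_exp_minus_to_infinity[of "1/N" 0] N by simp
  have "((\<lambda>s::real. exp (- (\<bar>s\<bar> / N))) has_integral (N + N)) UNIV"
    by (rule has_integral_UNIV_halflines)
       (rule has_integral_eq[OF _ *]; simp)+
  then have h: "(\<lambda>s::real. exp (- (\<bar>s\<bar> / N)) * B) integrable_on UNIV"
    by (intro integrable_on_mult_left) blast
  have "integral {-R..R} (\<lambda>t. integral UNIV (?H t)) =
      integral UNIV (\<lambda>s. integral {-R..R} (\<lambda>t. ?H t s))"
  proof (rule integral_swap_dominated(1)[OF _ _ _ h])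
    show "continuous_on ({- R..R} \<times> UNIV) (\<lambda>(t, s). ?H t s)"
      using N by (auto simp: split_beta intro!: continuous_intros intro: continuous_on_compose2[OF c])
    show "norm (?H t s) \<le> exp (- (\<bar>s\<bar> / N)) * B" if "t \<in> {-R..R}" for t s
      using B[of t] by (simp add: norm_mult)
  qed auto
  moreover have "integral {-R..R} (\<lambda>t. ?H t s) = exp (- of_real (\<bar>s\<bar> / N)) * fourier \<phi> s" for s
  proof -
    have "fourier \<phi> s = integral {-R..R} (\<lambda>t. exp (- \<i> * of_real s * of_real t) * \<phi> t)"
      by (rule fourier_eq_integral_Icc, rule R) auto
    then show ?thesis by simp
  qed
  moreover have "integral UNIV (?H t) = \<phi> t * of_real (2 * (N / (1 + (N * t)\<^sup>2)))" for t
  proof -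
    let ?l = "of_real (1 / N) + \<i> * of_real t"
    have Re: "Re ?l > 0" "Re (cnj ?l) > 0" using N by auto
    have "((\<lambda>s. exp (- of_real (\<bar>s\<bar> / N)) * exp (- \<i> * of_real s * of_real t))
        has_integral (1 / cnj ?l + 1 / ?l)) UNIV"
    proof (rule has_integral_UNIV_halflines)
      show "((\<lambda>s. exp (- of_real (\<bar>s\<bar> / N)) * exp (- \<i> * of_real s * of_real t))
        has_integral 1 / ?l) {0..}"
        by (rule has_integral_eq[OF _ has_integral_exp_halfline[OF Re(1)]], unfold mult_exp_exp,
            rule arg_cong[of _ _ exp]) (simp add: algebra_simps)
      show "((\<lambda>s. exp (- of_real (\<bar>- s\<bar> / N)) * exp (- \<i> * of_real (- s) * of_real t))
        has_integral 1 / cnj ?l) {0..}"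
        by (rule has_integral_eq[OF _ has_integral_exp_halfline[OF Re(2)]], unfold mult_exp_exp,
            rule arg_cong[of _ _ exp]) (simp add: algebra_simps)
    qed
    moreover have "1 / cnj ?l + 1 / ?l = of_real (2 * (N / (1 + (N * t)\<^sup>2)))"
    proof -
      have nz: "?l \<noteq> 0" "cnj ?l \<noteq> 0" using Re by (metis zero_complex.sel(1) less_irrefl)+
      have "?l * cnj ?l = of_real ((1 / N)\<^sup>2 + t\<^sup>2)"
        by (simp add: complex_eq_iff power2_eq_square)
      moreover have "?l + cnj ?l = of_real (2 / N)" by (simp add: complex_eq_iff)
      moreover have "1 / b + 1 / a = (a + b) / (a * b)" if "a \<noteq> 0" "b \<noteq> 0" for a b :: complex
        using that by (simp add: field_simps)
      note this[OF nz]
      ultimately have "1 / cnj ?l + 1 / ?l = of_real ((2 / N) / ((1 / N)\<^sup>2 + t\<^sup>2))"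
        by (metis of_real_divide)
      also have "(2 / N) / ((1 / N)\<^sup>2 + t\<^sup>2) = 2 * (N / (1 + (N * t)\<^sup>2))"
        using N by (simp add: field_simps power2_eq_square)
      finally show ?thesis .
    qed
    ultimately have "((\<lambda>s. exp (- of_real (\<bar>s\<bar> / N)) * exp (- \<i> * of_real s * of_real t))
        has_integral of_real (2 * (N / (1 + (N * t)\<^sup>2)))) UNIV" by simp
    from has_integral_mult_right[OF this, of "\<phi> t"] show ?thesis
      by (intro integral_unique) (simp add: algebra_simps)
  qed
  ultimately show ?thesis by simp
qed

text \<open>As \<open>N \<rightarrow> \<infinity>\<close>, the damping disappears on one side by dominated convergence, and on the other
  side the Poisson kernels concentrate at 0.\<close>

lemma fourier_inversion_0:
  fixes \<phi> :: "real \<Rightarrow> complex"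
  assumes \<phi>: "\<phi> \<in> test_functions I"
  shows "integral UNIV (fourier \<phi>) = of_real (2 * pi) * \<phi> 0"
proof -
  from \<phi> obtain R where R: "\<And>t. \<bar>t\<bar> > R \<Longrightarrow> \<phi> t = 0"
    by (rule test_functions_bounded_support) blast
  from \<phi> obtain C where C: "C > 0" "\<And>s. cmod (fourier \<phi> s) \<le> C * (1 / (1 + s\<^sup>2))"
    by (rule fourier_decay) blast
  have c: "continuous_on UNIV \<phi>"
    by (rule smooth_continuous_on_0[OF test_functions_smooth[OF \<phi>]])
  from \<phi> obtain B where B: "B > 0" "\<And>t. cmod (\<phi> t) \<le> B"
    by (rule test_functions_bounded) blast
  let ?P = "\<lambda>N t. N / (1 + (N * t)\<^sup>2)"
  let ?A = "\<lambda>N. integral UNIV (\<lambda>s. exp (- of_real (\<bar>s\<bar> / N)) * fourier \<phi> s)"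
  have "(\<lambda>n. ?A (real (Suc n))) \<longlonglongrightarrow> integral UNIV (fourier \<phi>)"
  proof (rule dominated_convergence(2)[where h = "\<lambda>s. C * (1 / (1 + (s - 0)\<^sup>2))"])
    show "(\<lambda>s. C * (1 / (1 + (s - 0)\<^sup>2))) integrable_on UNIV"
      using has_integral_mult_right[OF has_integral_Cauchy[of 0], of C] by blast
    show bd: "cmod (exp (- of_real (\<bar>s\<bar> / real (Suc n))) * fourier \<phi> s) \<le> C * (1 / (1 + (s - 0)\<^sup>2))" for n s
    proof -
      have "cmod (exp (- of_real (\<bar>s\<bar> / real (Suc n))) * fourier \<phi> s) \<le> 1 * cmod (fourier \<phi> s)"
        unfolding norm_mult by (intro mult_right_mono) auto
      with C(2)[of s] show ?thesis by simp
    qed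
    show "(\<lambda>s. exp (- of_real (\<bar>s\<bar> / real (Suc n))) * fourier \<phi> s) integrable_on UNIV" for n
      by (rule norm_integral_dominated(1)[OF _ _ _ has_integral_mult_right[OF has_integral_Cauchy[of 0], of C] _ bd])
         (use C in \<open>auto intro!: continuous_intros continuous_on_fourier[OF \<phi>] simp: add_nonneg_nonneg simp del: of_nat_Suc\<close>)
    show "(\<lambda>n. exp (- of_real (\<bar>s\<bar> / real (Suc n))) * fourier \<phi> s) \<longlonglongrightarrow> fourier \<phi> s" for s
    proof -
      have "(\<lambda>n. \<bar>s\<bar> / real (Suc n)) \<longlonglongrightarrow> 0"
        by (intro tendsto_divide_0[OF tendsto_const] filterlim_at_top_imp_at_infinity
            filterlim_compose[OF filterlim_real_sequentially] filterlim_Suc)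
      then have "(\<lambda>n. exp (- complex_of_real (\<bar>s\<bar> / real (Suc n))) * fourier \<phi> s)
          \<longlonglongrightarrow> exp (- complex_of_real 0) * fourier \<phi> s"
        by (intro tendsto_intros)
      then show ?thesis by simp
    qed
  qed
  moreover have "(\<lambda>n. ?A (real (Suc n))) \<longlonglongrightarrow> of_real (2 * pi) * \<phi> 0"
  proof (rule LIMSEQ_I)
    fix e :: real assume e: "e > 0"
    define k where "k = e / (8 * pi)"
    have k: "k > 0" using e by (simp add: k_def)
    from c have "isCont \<phi> 0" by (simp add: continuous_on_eq_continuous_at)
    then obtain d' where d': "d' > 0" "\<And>t. \<bar>t\<bar> < d' \<Longrightarrow> cmod (\<phi> t - \<phi> 0) < k"
      using k by (auto simp: continuous_at_eps_delta dist_norm)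
    define d where "d = d' / 2"
    have d: "d > 0" "\<And>t. \<bar>t\<bar> \<le> d \<Longrightarrow> cmod (\<phi> t - \<phi> 0) \<le> k"
      using d' by (auto simp: d_def intro!: less_imp_le)
    have D: "cmod (\<phi> t - \<phi> 0) \<le> 2 * B" for t
      using B(2)[of t] B(2)[of 0] norm_triangle_ineq4[of "\<phi> t" "\<phi> 0"] by linarith
    define Q where "Q = 2 * (2 * B * (1 + 1 / d\<^sup>2)) * pi"
    have bound: "cmod (?A N - of_real (2 * pi) * \<phi> 0) \<le> e / 4 + Q / N" if N: "N > 0" for N
    proof -
      have int: "((\<lambda>t. of_real (2 * ?P N t)) has_integral (of_real (2 * pi) :: complex)) UNIV"
        using has_integral_of_real[OF has_integral_mult_right[OF has_integral_Poisson[OF N, of 0], of 2]]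
        by (simp only: diff_zero)
      have damped: "?A N = integral {-R..R} (\<lambda>t. \<phi> t * of_real (2 * ?P N t))"
        by (rule integral_fourier_damped[OF \<phi> _ N]) (rule R)
      have eq: "(\<lambda>t. if t \<in> {-R..R} then \<phi> t * of_real (2 * ?P N t) else 0) = (\<lambda>t. \<phi> t * of_real (2 * ?P N t))"
      proof
        fix t
        have "\<phi> t = 0" if "t \<notin> {-R..R}" using that by (intro R) auto
        then show "(if t \<in> {-R..R} then \<phi> t * of_real (2 * ?P N t) else 0) = \<phi> t * of_real (2 * ?P N t)"
          by simp
      qed
      have pos: "1 + (N * t)\<^sup>2 > 0" for t by (rule add_pos_nonneg) auto
      then have nz: "1 + (N * t)\<^sup>2 \<noteq> 0" for t by (metis less_irrefl)
      have cP: "continuous_on S (\<lambda>t. complex_of_real (2 * ?P N t))" for S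
        by (intro continuous_intros) (use nz in auto)
      have "(\<lambda>t. \<phi> t * of_real (2 * ?P N t)) integrable_on {-R..R}"
        by (intro integrable_continuous_interval continuous_on_mult cP continuous_on_subset[OF c]) auto
      then have "((\<lambda>t. if t \<in> {-R..R} then \<phi> t * of_real (2 * ?P N t) else 0) has_integral ?A N) UNIV"
        unfolding damped by (simp only: has_integral_restrict_UNIV has_integral_integral)
      then have "((\<lambda>t. \<phi> t * of_real (2 * ?P N t)) has_integral ?A N) UNIV" unfolding eq .
      from has_integral_diff[OF this has_integral_mult_right[OF int, of "\<phi> 0"]]
      have "((\<lambda>t. of_real (2 * ?P N t) *\<^sub>C (\<phi> t - \<phi> 0)) has_integral (?A N - of_real (2 * pi) * \<phi> 0)) UNIV"
        by (simp only: scaleC_complex_def right_diff_distrib mult.commute[of "of_real (2 * pi)" "\<phi> 0"]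
            mult.commute[of "of_real (2 * ?P N _)"])
      then have "integral UNIV (\<lambda>t. of_real (2 * ?P N t) *\<^sub>C (\<phi> t - \<phi> 0)) = ?A N - of_real (2 * pi) * \<phi> 0"
        by (rule integral_unique)
      moreover have "norm (integral UNIV (\<lambda>t. of_real (2 * ?P N t) *\<^sub>C (\<phi> t - \<phi> 0))) \<le>
          2 * (k * pi + 2 * B * (1 + 1 / d\<^sup>2) / N * pi)"
      proof (rule Poisson_approximation[where t = 0])
        show "cmod (of_real (2 * ?P N s)) \<le> 2 * (N / (1 + (N * (s - 0))\<^sup>2))" for s
          unfolding norm_of_real using N pos[of s] by simp
        show "continuous_on UNIV (\<lambda>t. complex_of_real (2 * ?P N t))" by (rule cP)
      qed (use d D k B N in \<open>auto intro: continuous_on_diff c\<close>)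
      moreover have "2 * (k * pi + 2 * B * (1 + 1 / d\<^sup>2) / N * pi) = e / 4 + Q / N"
        by (simp add: k_def Q_def distrib_left)
      ultimately show ?thesis by (simp only:)
    qed
    have Q: "Q \<ge> 0" using B(1) by (simp add: Q_def)
    obtain n0 where n0: "real n0 > 2 * Q / e" using reals_Archimedean2 by blast
    have "cmod (?A (real (Suc n)) - of_real (2 * pi) * \<phi> 0) < e" if "n \<ge> n0" for n
    proof -
      have "2 * Q / e < real (Suc n)" using n0 that by linarith
      then have "Q / real (Suc n) < e / 2" using e by (simp add: field_simps)
      with bound[of "real (Suc n)"] e show ?thesis by linarith
    qed
    then show "\<exists>n0. \<forall>n\<ge>n0. cmod (?A (real (Suc n)) - of_real (2 * pi) * \<phi> 0) < e" by blast
  qed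
  ultimately show ?thesis by (rule LIMSEQ_unique)
qed

lemma fourier_inversion:
  fixes \<phi> :: "real \<Rightarrow> complex"
  assumes \<phi>: "\<phi> \<in> test_functions UNIV"
  shows "integral UNIV (\<lambda>s. exp (\<i> * of_real \<eta> * of_real s) * fourier \<phi> s) = of_real (2 * pi) * \<phi> \<eta>"
proof -
  obtain R where R: "\<And>t. \<bar>t\<bar> > R \<Longrightarrow> \<phi> t = 0"
    using test_functions_bounded_support[OF \<phi>] by metis
  have "(\<lambda>\<xi>. \<phi> (\<xi> + \<eta>)) \<in> test_functions UNIV"
  proof (rule test_functionsI)
    show "smooth (\<lambda>\<xi>. \<phi> (\<xi> + \<eta>))"
      using nth_deriv_affine(2)[OF test_functions_smooth[OF \<phi>], of 1 \<eta>] by simp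
    show "\<phi> (t + \<eta>) = 0" if "t \<notin> {-R-\<eta>..R-\<eta>}" for t
      using that by (intro R) auto
  qed auto
  from fourier_inversion_0[OF this] show ?thesis
    unfolding fourier_translation[OF \<phi>] by simp
qed

lemma fourier_Parseval:
  fixes \<phi> p :: "real \<Rightarrow> complex"
  assumes \<phi>: "\<phi> \<in> test_functions UNIV" and p: "p \<in> test_functions UNIV"
    and R: "\<And>t. \<bar>t\<bar> > R \<Longrightarrow> p t = 0"
  shows "integral UNIV (\<lambda>t. fourier \<phi> t * fourier p (- t)) = of_real (2 * pi) * integral {-R..R} (\<lambda>\<xi>. \<phi> \<xi> * p \<xi>)"
proof -
  let ?H = "\<lambda>\<xi> t. p \<xi> * (exp (\<i> * of_real \<xi> * of_real t) * fourier \<phi> t)"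
  from \<phi> obtain C where C: "C > 0" "\<And>s. cmod (fourier \<phi> s) \<le> C * (1 / (1 + s\<^sup>2))"
    by (rule fourier_decay) blast
  have c: "continuous_on UNIV p"
    by (rule smooth_continuous_on_0[OF test_functions_smooth[OF p]])
  from p obtain B where B0: "B > 0" and B: "\<And>t. cmod (p t) \<le> B"
    by (rule test_functions_bounded) blast
  have "integral {-R..R} (\<lambda>\<xi>. integral UNIV (?H \<xi>)) =
      integral UNIV (\<lambda>t. integral {-R..R} (\<lambda>\<xi>. ?H \<xi> t))"
  proof (rule integral_swap_dominated(1))
    show "(\<lambda>t. B * (C * (1 / (1 + (t - 0)\<^sup>2)))) integrable_on UNIV"
      using has_integral_mult_right[OF has_integral_mult_right[OF has_integral_Cauchy[of 0], of C], of B] by blast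
    show "continuous_on ({- R..R} \<times> UNIV) (\<lambda>(\<xi>, t). ?H \<xi> t)"
      by (auto simp: split_beta intro!: continuous_intros continuous_on_compose2[OF c]
          continuous_on_compose2[OF continuous_on_fourier[OF \<phi>, of UNIV]])
    show "norm (?H \<xi> t) \<le> B * (C * (1 / (1 + (t - 0)\<^sup>2)))" if "\<xi> \<in> {-R..R}" for \<xi> t
      using mult_mono[OF B[of \<xi>] C(2)[of t]] B0 by (simp add: norm_mult)
  qed auto
  moreover have "integral UNIV (?H \<xi>) = p \<xi> * (of_real (2 * pi) * \<phi> \<xi>)" for \<xi>
    using fourier_inversion[OF \<phi>, of \<xi>] by simp
  moreover have "integral {-R..R} (\<lambda>\<xi>. ?H \<xi> t) = fourier \<phi> t * fourier p (- t)" for t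
  proof -
    have "fourier p (- t) = integral {-R..R} (\<lambda>\<xi>. exp (- \<i> * of_real (- t) * of_real \<xi>) * p \<xi>)"
      by (rule fourier_eq_integral_Icc, rule R) auto
    then have "fourier \<phi> t * fourier p (- t) =
        integral {-R..R} (\<lambda>\<xi>. fourier \<phi> t * (exp (- \<i> * of_real (- t) * of_real \<xi>) * p \<xi>))"
      by simp
    also have "\<dots> = integral {-R..R} (\<lambda>\<xi>. ?H \<xi> t)"
      by (rule integral_cong) (simp add: algebra_simps)
    finally show ?thesis ..
  qed
  ultimately have "integral UNIV (\<lambda>t. fourier \<phi> t * fourier p (- t)) =
      integral {-R..R} (\<lambda>\<xi>. p \<xi> * (of_real (2 * pi) * \<phi> \<xi>))" by (simp only:)
  also have "\<dots> = integral {-R..R} (\<lambda>\<xi>. of_real (2 * pi) * (\<phi> \<xi> * p \<xi>))"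
    by (rule integral_cong) (simp add: algebra_simps)
  finally show ?thesis by simp
qed

lemma integral_fourier_exp_halfline:
  assumes \<phi>: "\<phi> \<in> test_functions UNIV" and R: "\<And>t. \<bar>t\<bar> > R \<Longrightarrow> \<phi> t = 0"
  shows "integral {0..} (\<lambda>t. fourier \<phi> (- t) * exp (- of_real t)) =
    integral {-R..R} (\<lambda>\<xi>. \<phi> \<xi> * inverse (1 - \<i> * of_real \<xi>))"
proof -
  let ?H = "\<lambda>\<xi> t. \<phi> \<xi> * exp (- (1 - \<i> * of_real \<xi>) * of_real t)"
  have c: "continuous_on UNIV \<phi>"
    by (rule smooth_continuous_on_0[OF test_functions_smooth[OF \<phi>]])
  from \<phi> obtain B where B0: "B > 0" and B: "\<And>t. cmod (\<phi> t) \<le> B"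
    by (rule test_functions_bounded) blast
  have "integral {-R..R} (\<lambda>\<xi>. integral {0..} (?H \<xi>)) =
      integral {0..} (\<lambda>t. integral {-R..R} (\<lambda>\<xi>. ?H \<xi> t))"
  proof (rule integral_swap_dominated(1))
    show "(\<lambda>t. B * exp (- 1 * t)) integrable_on {0..}"
      by (intro integrable_on_mult_right integrable_on_exp_minus_to_infinity) simp
    show "continuous_on ({- R..R} \<times> {0..}) (\<lambda>(\<xi>, t). ?H \<xi> t)"
      by (auto simp: split_beta intro!: continuous_intros continuous_on_compose2[OF c])
    show "norm (?H \<xi> t) \<le> B * exp (- 1 * t)" if "\<xi> \<in> {-R..R}" for \<xi> t
      using B[of \<xi>] by (simp add: norm_mult norm_exp_eq_Re)
  qed auto
  moreover have "integral {0..} (?H \<xi>) = \<phi> \<xi> * inverse (1 - \<i> * of_real \<xi>)" for \<xi>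
    using has_integral_mult_right[OF has_integral_exp_halfline[of "1 - \<i> * of_real \<xi>"], of "\<phi> \<xi>"]
    by (intro integral_unique) (simp add: divide_inverse)
  moreover have "integral {-R..R} (\<lambda>\<xi>. ?H \<xi> t) = fourier \<phi> (- t) * exp (- of_real t)" for t
  proof -
    have "fourier \<phi> (- t) = integral {-R..R} (\<lambda>\<xi>. exp (- \<i> * of_real (- t) * of_real \<xi>) * \<phi> \<xi>)"
      by (rule fourier_eq_integral_Icc, rule R) auto
    then have "fourier \<phi> (- t) * exp (- of_real t) =
        integral {-R..R} (\<lambda>\<xi>. exp (- \<i> * of_real (- t) * of_real \<xi>) * \<phi> \<xi> * exp (- of_real t))"
      by simp
    also have "\<dots> = integral {-R..R} (\<lambda>\<xi>. ?H \<xi> t)"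
    proof (rule integral_cong)
      fix \<xi>
      have "exp (- (1 - \<i> * of_real \<xi>) * of_real t) = exp (- \<i> * of_real (- t) * of_real \<xi>) * exp (- of_real t)"
        unfolding mult_exp_exp by (rule arg_cong[of _ _ exp]) (simp add: algebra_simps)
      then show "exp (- \<i> * of_real (- t) * of_real \<xi>) * \<phi> \<xi> * exp (- of_real t) = ?H \<xi> t"
        by (simp add: algebra_simps)
    qed
    finally show ?thesis ..
  qed
  ultimately show ?thesis by (simp only:)
qed

lemma integral_halfline_shift:
  fixes f :: "real \<Rightarrow> 'a::banach"
  assumes f: "f integrable_on {0..}" and h: "h \<ge> 0"
  shows "integral {0..} (\<lambda>t. f (t + h)) = integral {0..} f - integral {0..h} f"
proof -
  have 1: "f integrable_on {0..h}" "f integrable_on {h..}"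
  proof -
    have *: "(\<lambda>x. if x \<in> {0..} then f x else 0) integrable_on {0..h}"
      using integrable_altD(1)[OF f, of 0 h] by simp
    show 1: "f integrable_on {0..h}"
      by (rule integrable_eq[OF *]) auto
    have "(\<lambda>x. if x \<in> {h..} then f x else 0) integrable_on {0..}"
    proof -
      have "{0..h} \<inter> {0..} = {0..h}" by auto
      then have "(\<lambda>x. (if x \<in> {0..h} then f x else 0)) integrable_on {0..}"
        using 1 by (simp only: integrable_restrict_Int)
      from integrable_diff[OF f this]
      have "(\<lambda>x. f x - (if x \<in> {0..h} then f x else 0)) integrable_on {0..}" .
      then show ?thesis
        by (rule integrable_spike[of _ _ "{h}"]) auto
    qed
    moreover have "{h..} \<inter> {0..} = {h..}" using h by auto
    ultimately show "f integrable_on {h..}"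
      by (simp only: integrable_restrict_Int)
  qed
  have "(f has_integral (integral {0..h} f + integral {h..} f)) ({0..h} \<union> {h..})"
    using 1 by (intro has_integral_Un integrable_integral) (auto intro: negligible_subset[of "{h}"])
  moreover have "{0..h} \<union> {h..} = {0..}" using h by auto
  ultimately have "integral {0..} f = integral {0..h} f + integral {h..} f"
    by (simp add: has_integral_iff)
  moreover have "((\<lambda>t. f (t + h)) has_integral integral {h..} f) {0..}"
    using has_integral_isometry[OF integrable_integral[OF 1(2)], of 1 h] by (simp add: atLeast_def)
  ultimately show ?thesis by (simp add: has_integral_iff)
qed

lemma integral_average_tendsto:
  fixes g :: "real \<Rightarrow> 'b::banach"
  assumes "continuous_on {0..} g"
  shows "((\<lambda>h. (1 / h) *\<^sub>R integral {0..h} g) \<longlongrightarrow> g 0) (at_right 0)"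
proof (rule tendstoI)
  fix e :: real assume e: "e > 0"
  then obtain d where d: "d > 0" "\<And>t. t \<ge> 0 \<Longrightarrow> t < d \<Longrightarrow> norm (g t - g 0) < e / 2"
    using assms[unfolded continuous_on_iff, rule_format, of 0 "e / 2"] by (auto simp: dist_norm)
  show "\<forall>\<^sub>F h in at_right 0. dist ((1 / h) *\<^sub>R integral {0..h} g) (g 0) < e"
    unfolding eventually_at_right_field
  proof (intro exI[of _ d] conjI allI impI d(1))
    fix h assume h: "0 < h" "h < d"
    have c: "continuous_on {0..h} g" by (rule continuous_on_subset[OF assms]) auto
    have "norm (integral {0..h} (\<lambda>t. g t - g 0)) \<le> e / 2 * (h - 0)"
      using h d(2) by (intro integral_bound continuous_intros c) (auto intro!: less_imp_le)
    moreover have "integral {0..h} (\<lambda>t. g t - g 0) = integral {0..h} g - h *\<^sub>R g 0"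
      using h by (subst integral_diff) (auto intro: integrable_continuous_interval c)
    moreover have "(1 / h) *\<^sub>R integral {0..h} g - g 0 = (1 / h) *\<^sub>R (integral {0..h} g - h *\<^sub>R g 0)"
      using h by (simp add: scaleR_diff_right)
    then have "norm ((1 / h) *\<^sub>R integral {0..h} g - g 0) = norm (integral {0..h} g - h *\<^sub>R g 0) / h"
      using h by simp
    ultimately have "norm ((1 / h) *\<^sub>R integral {0..h} g - g 0) \<le> e / 2"
      using h by (simp add: pos_divide_le_eq)
    then show "dist ((1 / h) *\<^sub>R integral {0..h} g) (g 0) < e"
      using e by (simp add: dist_norm)
  qed
qed

lemma exp_difference_quotient:
  fixes c :: complex
  shows "((\<lambda>h. (exp (c * of_real h) - 1) / of_real h) \<longlongrightarrow> c) (at_right 0)"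
proof -
  have "((\<lambda>z. exp (c * z)) has_field_derivative c) (at 0)"
    by (auto intro!: derivative_eq_intros)
  then have "((\<lambda>z. (exp (c * z) - 1) / z) \<longlongrightarrow> c) (at 0)"
    by (simp add: has_field_derivative_iff)
  moreover have "filterlim complex_of_real (at 0) (at_right 0)"
    unfolding filterlim_at
    by (auto intro!: tendsto_eq_intros simp: eventually_at_filter)
  ultimately show ?thesis by (rule filterlim_compose)
qed

section \<open>Bounded semigroups and their resolvents\<close>

locale bounded_C0_semigroup =
  fixes T :: "real \<Rightarrow> 'a::complex_banach \<Rightarrow> 'a" and M :: real
  assumes C0: "C0_semigroup T" and M_pos: "M > 0"
    and T_bound: "\<And>t x. t \<ge> 0 \<Longrightarrow> norm (T t x) \<le> M * norm x"
begin

lemma T_linear: "t \<ge> 0 \<Longrightarrow> bounded_linear (T t)"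
  and T_scaleC: "t \<ge> 0 \<Longrightarrow> T t (c *\<^sub>C x) = c *\<^sub>C T t x"
  using C0 by (auto simp: C0_semigroup_def bounded_clinear_def)

lemma T_plus: "t \<ge> 0 \<Longrightarrow> T t (x + y) = T t x + T t y"
  and T_diff: "t \<ge> 0 \<Longrightarrow> T t (x - y) = T t x - T t y"
  and T_scaleR: "t \<ge> 0 \<Longrightarrow> T t (r *\<^sub>R x) = r *\<^sub>R T t x"
  using T_linear[of t] by (simp_all add: linear_simps)

lemma T_0 [simp]: "T 0 x = x"
  using C0 by (simp add: C0_semigroup_def)

lemma T_add: "s \<ge> 0 \<Longrightarrow> t \<ge> 0 \<Longrightarrow> T (s + t) x = T s (T t x)"
  using C0 by (simp add: C0_semigroup_def)

lemma T_commute: "s \<ge> 0 \<Longrightarrow> t \<ge> 0 \<Longrightarrow> T s (T t x) = T t (T s x)"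
  using T_add[of s t x] T_add[of t s x] by (simp add: add.commute)

lemma T_at_right_0: "((\<lambda>t. T t x) \<longlongrightarrow> x) (at_right 0)"
  using C0 by (simp add: C0_semigroup_def)

lemma norm_T_diff_le:
  assumes "s \<ge> 0" "t \<ge> 0"
  shows "norm (T t x - T s x) \<le> M * norm (T \<bar>t - s\<bar> x - x)"
proof -
  have *: "norm (T t x - T s x) \<le> M * norm (T (t - s) x - x)" if "s \<ge> 0" "t \<ge> s" for s t
  proof -
    have "T t x - T s x = T s (T (t - s) x - x)"
      using that T_add[of s "t - s" x] T_diff[of s "T (t - s) x" x] by simp
    then show ?thesis using T_bound[OF that(1)] by metis
  qed
  show ?thesis
  proof (cases "t \<ge> s")
    case True then show ?thesis using *[of s t] assms by simp
  next
    case False then show ?thesis using *[of t s] assms by (simp add: norm_minus_commute)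
  qed
qed

lemma orbit_modulus:
  assumes "e > 0"
  obtains d where "d > 0" "\<And>s t. s \<ge> 0 \<Longrightarrow> t \<ge> 0 \<Longrightarrow> \<bar>t - s\<bar> \<le> d \<Longrightarrow> norm (T t x - T s x) \<le> e"
proof -
  have "\<forall>\<^sub>F t in at_right 0. dist (T t x) x < e / M"
    using tendstoD[OF T_at_right_0] assms M_pos by simp
  then obtain b where b: "b > 0" "\<And>t. 0 < t \<Longrightarrow> t < b \<Longrightarrow> norm (T t x - x) < e / M"
    by (auto simp: eventually_at_right_field dist_norm)
  show ?thesis
  proof (rule that[of "b / 2"])
    fix s t :: real assume st: "s \<ge> 0" "t \<ge> 0" "\<bar>t - s\<bar> \<le> b / 2"
    have "norm (T \<bar>t - s\<bar> x - x) \<le> e / M"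
      using b(2)[of "\<bar>t - s\<bar>"] b(1) st assms M_pos by (cases "t = s") auto
    then have "M * norm (T \<bar>t - s\<bar> x - x) \<le> e" using M_pos by (simp add: field_simps)
    then show "norm (T t x - T s x) \<le> e" using norm_T_diff_le[OF st(1,2), of x] by linarith
  qed (use b in simp)
qed

lemma continuous_on_orbit [continuous_intros]: "continuous_on {0..} (\<lambda>t. T t x)"
  unfolding continuous_on_iff
proof (intro ballI allI impI)
  fix s e :: real assume s: "s \<in> {0..}" and e: "e > 0"
  from e have "e / 2 > 0" by simp
  then obtain d where d: "d > 0" "\<And>s t. s \<ge> 0 \<Longrightarrow> t \<ge> 0 \<Longrightarrow> \<bar>t - s\<bar> \<le> d \<Longrightarrow> norm (T t x - T s x) \<le> e / 2"
    by (rule orbit_modulus[of _ x]) blast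
  have "dist (T t x) (T s x) < e" if "t \<in> {0..}" "dist t s < d" for t
    using d(2)[of s t] that s e by (simp add: dist_norm)
  then show "\<exists>d>0. \<forall>t\<in>{0..}. dist t s < d \<longrightarrow> dist (T t x) (T s x) < e"
    using d(1) by blast
qed

definition laplace :: "complex \<Rightarrow> 'a \<Rightarrow> 'a"
  where "laplace \<mu> x = integral {0..} (\<lambda>t. exp (- \<mu> * of_real t) *\<^sub>C T t x)"

lemma laplace_integrable:
  assumes "Re \<mu> > 0"
  shows "(\<lambda>t. exp (- \<mu> * of_real t) *\<^sub>C T t x) integrable_on {0..}"
proof (rule integrable_dominated)
  show "(\<lambda>t. exp (- Re \<mu> * t) * (M * norm x)) integrable_on {0..}"
    by (intro integrable_on_mult_left integrable_on_exp_minus_to_infinity assms)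
qed (use T_bound in \<open>auto intro!: continuous_intros mult_left_mono simp: norm_scaleC norm_exp_eq_Re\<close>)

lemma laplace_linear:
  assumes "Re \<mu> > 0"
  shows "laplace \<mu> (x + y) = laplace \<mu> x + laplace \<mu> y"
    and "laplace \<mu> (x - y) = laplace \<mu> x - laplace \<mu> y"
    and "laplace \<mu> (c *\<^sub>C x) = c *\<^sub>C laplace \<mu> x"
proof -
  note i = laplace_integrable[OF assms]
  have "laplace \<mu> (x + y) = integral {0..} (\<lambda>t. exp (- \<mu> * of_real t) *\<^sub>C T t x + exp (- \<mu> * of_real t) *\<^sub>C T t y)"
    unfolding laplace_def by (rule integral_cong) (simp add: T_plus scaleC_add_right)
  also have "\<dots> = laplace \<mu> x + laplace \<mu> y"
    unfolding laplace_def by (rule integral_add[OF i i])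
  finally show "laplace \<mu> (x + y) = laplace \<mu> x + laplace \<mu> y" .
  have "laplace \<mu> (x - y) = integral {0..} (\<lambda>t. exp (- \<mu> * of_real t) *\<^sub>C T t x - exp (- \<mu> * of_real t) *\<^sub>C T t y)"
    unfolding laplace_def by (rule integral_cong) (simp add: T_diff scaleC_diff_right)
  also have "\<dots> = laplace \<mu> x - laplace \<mu> y"
    unfolding laplace_def by (rule integral_diff[OF i i])
  finally show "laplace \<mu> (x - y) = laplace \<mu> x - laplace \<mu> y" .
  have "laplace \<mu> (c *\<^sub>C x) = integral {0..} (\<lambda>t. c *\<^sub>C exp (- \<mu> * of_real t) *\<^sub>C T t x)"
    unfolding laplace_def by (rule integral_cong) (simp add: T_scaleC scaleC_scaleC mult.commute)
  also have "\<dots> = c *\<^sub>C laplace \<mu> x"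
    unfolding laplace_def by (rule integral_scaleC_right(1)[OF i])
  finally show "laplace \<mu> (c *\<^sub>C x) = c *\<^sub>C laplace \<mu> x" .
qed

lemma norm_laplace_le:
  assumes "Re \<mu> > 0"
  shows "norm (laplace \<mu> x) \<le> norm x * (M / Re \<mu>)"
proof -
  have "((\<lambda>t. exp (- Re \<mu> * t) * (M * norm x)) has_integral (exp (- Re \<mu> * 0) / Re \<mu> * (M * norm x))) {0..}"
    by (intro has_integral_mult_left has_integral_exp_minus_to_infinity assms)
  then have i: "(\<lambda>t. exp (- Re \<mu> * t) * (M * norm x)) integrable_on {0..}"
    "integral {0..} (\<lambda>t. exp (- Re \<mu> * t) * (M * norm x)) = norm x * (M / Re \<mu>)"
    unfolding has_integral_iff by simp_all
  have "norm (laplace \<mu> x) \<le> integral {0..} (\<lambda>t. exp (- Re \<mu> * t) * (M * norm x))"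
    unfolding laplace_def
    by (rule integral_norm_bound_integral[OF laplace_integrable[OF assms] i(1)])
       (use T_bound in \<open>auto simp: norm_scaleC norm_exp_eq_Re mult_left_mono\<close>)
  then show ?thesis unfolding i(2) .
qed

lemma T_laplace:
  assumes "Re \<mu> > 0" "h \<ge> 0"
  shows "T h (laplace \<mu> x) = integral {0..} (\<lambda>t. exp (- \<mu> * of_real t) *\<^sub>C T (t + h) x)"
    and "T h (laplace \<mu> x) = laplace \<mu> (T h x)"
proof -
  have "T h (laplace \<mu> x) = integral {0..} (T h \<circ> (\<lambda>t. exp (- \<mu> * of_real t) *\<^sub>C T t x))"
    unfolding laplace_def
    by (rule integral_linear[OF laplace_integrable[OF assms(1)] T_linear[OF assms(2)], symmetric])
  also have "\<dots> = integral {0..} (\<lambda>t. exp (- \<mu> * of_real t) *\<^sub>C T (t + h) x)"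
    by (rule integral_cong) (use assms(2) in \<open>simp add: T_scaleC T_add T_commute[of h]\<close>)
  finally show 1: "T h (laplace \<mu> x) = integral {0..} (\<lambda>t. exp (- \<mu> * of_real t) *\<^sub>C T (t + h) x)" .
  show "T h (laplace \<mu> x) = laplace \<mu> (T h x)"
    unfolding 1 unfolding laplace_def
    by (rule integral_cong) (use assms(2) in \<open>simp add: T_add\<close>)
qed

text \<open>The difference quotients of the semigroup at \<open>laplace \<mu> x\<close> are explicit, because shifting the
  orbit multiplies the Laplace integral by \<open>exp (\<mu> h)\<close> and cuts off the interval \<open>[0, h]\<close>.\<close>

lemma laplace_in_generator:
  assumes "Re \<mu> > 0"
  shows "(laplace \<mu> x, \<mu> *\<^sub>C laplace \<mu> x - x) \<in> generator T"
proof -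
  let ?g = "\<lambda>t. exp (- \<mu> * of_real t) *\<^sub>C T t x" and ?u = "laplace \<mu> x"
  have q: "(1 / h) *\<^sub>R (T h ?u - ?u) = ((exp (\<mu> * of_real h) - 1) / of_real h) *\<^sub>C ?u
      - exp (\<mu> * of_real h) *\<^sub>C ((1 / h) *\<^sub>R integral {0..h} ?g)" if h: "h > 0" for h
  proof -
    have g: "(\<lambda>t. ?g (t + h)) integrable_on {0..}"
    proof (rule integrable_dominated)
      show "(\<lambda>t. exp (- Re \<mu> * t) * (exp (- Re \<mu> * h) * (M * norm x))) integrable_on {0..}"
        by (intro integrable_on_mult_left integrable_on_exp_minus_to_infinity assms)
      show "continuous_on {0..} (\<lambda>t. ?g (t + h))"
        using h by (intro continuous_intros continuous_on_compose2[OF continuous_on_orbit]) auto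
      show "norm (?g (t + h)) \<le> exp (- Re \<mu> * t) * (exp (- Re \<mu> * h) * (M * norm x))" if "t \<in> {0..}" for t
      proof -
        have "exp (- Re \<mu> * (t + h)) = exp (- Re \<mu> * t) * exp (- Re \<mu> * h)"
          by (simp add: distrib_left exp_add[symmetric])
        then show ?thesis
          using T_bound[of "t + h" x] that h by (simp add: norm_scaleC norm_exp_eq_Re mult.assoc)
      qed
    qed auto
    have "T h ?u = integral {0..} (\<lambda>t. exp (\<mu> * of_real h) *\<^sub>C ?g (t + h))"
      unfolding T_laplace(1)[OF assms less_imp_le[OF h]] scaleC_scaleC mult_exp_exp
      by (simp add: algebra_simps)
    also have "\<dots> = exp (\<mu> * of_real h) *\<^sub>C (?u - integral {0..h} ?g)"
      unfolding integral_scaleC_right(1)[OF g]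
        integral_halfline_shift[OF laplace_integrable[OF assms] less_imp_le[OF h]] laplace_def ..
    finally have Th: "T h ?u = exp (\<mu> * of_real h) *\<^sub>C (?u - integral {0..h} ?g)" .
    show ?thesis
      unfolding Th by (simp add: scaleR_scaleC scaleC_scaleC scaleC_add_right scaleC_diff_right scaleC_diff_left algebra_simps
          diff_divide_distrib)
  qed
  have "((\<lambda>h. ((exp (\<mu> * of_real h) - 1) / of_real h) *\<^sub>C ?u
      - exp (\<mu> * of_real h) *\<^sub>C ((1 / h) *\<^sub>R integral {0..h} ?g))
      \<longlongrightarrow> \<mu> *\<^sub>C ?u - exp (\<mu> * of_real 0) *\<^sub>C ?g 0) (at_right 0)"
    by (intro tendsto_intros exp_difference_quotient integral_average_tendsto) (auto intro!: continuous_intros)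
  then have "((\<lambda>h. ((exp (\<mu> * of_real h) - 1) / of_real h) *\<^sub>C ?u
      - exp (\<mu> * of_real h) *\<^sub>C ((1 / h) *\<^sub>R integral {0..h} ?g))
      \<longlongrightarrow> \<mu> *\<^sub>C ?u - x) (at_right 0)" by simp
  then have "((\<lambda>h. (1 / h) *\<^sub>R (T h ?u - ?u)) \<longlongrightarrow> \<mu> *\<^sub>C ?u - x) (at_right 0)"
    by (rule Lim_transform_eventually) (auto simp: eventually_at_filter q)
  then show ?thesis by (simp add: generator_def)
qed

text \<open>The Laplace transform is bounded and commutes with the semigroup. So the limit of its values at
  the difference quotients of \<open>u\<close> is both \<open>laplace \<mu> v\<close> and \<open>\<mu> laplace \<mu> u - u\<close>.\<close>

lemma laplace_inverse:
  assumes \<mu>: "Re \<mu> > 0" and uv: "(u, v) \<in> generator T"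
  shows "laplace \<mu> (\<mu> *\<^sub>C u - v) = u"
proof -
  have "((\<lambda>h. (1 / h) *\<^sub>R (T h (laplace \<mu> u) - laplace \<mu> u)) \<longlongrightarrow> \<mu> *\<^sub>C laplace \<mu> u - u) (at_right 0)"
    using laplace_in_generator[OF \<mu>] by (simp add: generator_def)
  moreover have "((\<lambda>h. (1 / h) *\<^sub>R (T h (laplace \<mu> u) - laplace \<mu> u)) \<longlongrightarrow> laplace \<mu> v) (at_right 0)"
  proof -
    have "((\<lambda>h. (1 / h) *\<^sub>R (T h u - u)) \<longlongrightarrow> v) (at_right 0)" using uv by (simp add: generator_def)
    moreover have "bounded_linear (laplace \<mu>)"
    proof (rule bounded_linear_intro[where K = "M / Re \<mu>"])
      show "laplace \<mu> (r *\<^sub>R y) = r *\<^sub>R laplace \<mu> y" for r y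
        by (simp add: scaleR_scaleC laplace_linear[OF \<mu>])
    qed (use norm_laplace_le[OF \<mu>] laplace_linear[OF \<mu>] in auto)
    ultimately have "((\<lambda>h. laplace \<mu> ((1 / h) *\<^sub>R (T h u - u))) \<longlongrightarrow> laplace \<mu> v) (at_right 0)"
      by (rule bounded_linear.tendsto[rotated])
    then show ?thesis
      by (rule Lim_transform_eventually)
         (auto simp: eventually_at_filter laplace_linear[OF \<mu>] T_laplace(2)[OF \<mu>] scaleR_scaleC)
  qed
  ultimately have "\<mu> *\<^sub>C laplace \<mu> u - u = laplace \<mu> v"
    by (rule tendsto_unique[OF trivial_limit_at_right_real])
  then show ?thesis by (simp add: laplace_linear[OF \<mu>] algebra_simps)
qed

lemma resolvent_eq_laplace:
  assumes \<mu>: "Re \<mu> > 0"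
  shows "resolvent \<mu> (generator T) y = laplace \<mu> y"
  unfolding resolvent_def
proof (rule the_equality)
  show "(laplace \<mu> y, y) \<in> scalar_minus \<mu> (generator T)"
    unfolding scalar_minus_def using laplace_in_generator[OF \<mu>, of y] by force
  show "u = laplace \<mu> y" if "(u, y) \<in> scalar_minus \<mu> (generator T)" for u
    using that laplace_inverse[OF \<mu>] by (auto simp: scalar_minus_def)
qed

end

section \<open>The boundary resolvent as a Fourier transform\<close>

lemma fourier_kernel_integral:
  fixes g :: "real \<Rightarrow> 'a::complex_banach"
  assumes \<phi>: "\<phi> \<in> test_functions I" and S: "closed S" "is_interval S"
    and g: "continuous_on S g" "\<And>s. s \<in> S \<Longrightarrow> norm (g s) \<le> D" "D \<ge> 0"
    and B: "\<And>s. cmod (fourier \<phi> s) \<le> B * (e / (1 + (e * s)\<^sup>2))" and e: "e > 0" "B \<ge> 0"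
  shows "(\<lambda>s. fourier \<phi> (s - t) *\<^sub>C g s) integrable_on S"
    and "norm (integral S (\<lambda>s. fourier \<phi> (s - t) *\<^sub>C g s)) \<le> B * pi * D"
proof -
  have c: "continuous_on S (\<lambda>s. fourier \<phi> (s - t) *\<^sub>C g s)"
    by (intro continuous_intros g continuous_on_compose2[OF continuous_on_fourier[OF \<phi>, of UNIV]]) auto
  have h: "((\<lambda>s. B * (e / (1 + (e * (s - t))\<^sup>2)) * D) has_integral B * pi * D) UNIV"
    by (intro has_integral_mult_left has_integral_mult_right has_integral_Poisson e)
  have b: "norm (fourier \<phi> (s - t) *\<^sub>C g s) \<le> B * (e / (1 + (e * (s - t))\<^sup>2)) * D" if "s \<in> S" for s
    unfolding norm_scaleC using B[of "s - t"] g(2)[OF that] by (intro mult_mono) (auto intro: order_trans[OF norm_ge_zero])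
  have p: "0 \<le> B * (e / (1 + (e * (s - t))\<^sup>2)) * D" for s
    using e g(3) by (intro mult_nonneg_nonneg divide_nonneg_nonneg add_nonneg_nonneg) auto
  show "(\<lambda>s. fourier \<phi> (s - t) *\<^sub>C g s) integrable_on S"
    "norm (integral S (\<lambda>s. fourier \<phi> (s - t) *\<^sub>C g s)) \<le> B * pi * D"
    using norm_integral_dominated[OF S c h p b] by auto
qed

lemma fourier_kernel_integrable:
  fixes g :: "real \<Rightarrow> 'a::complex_banach"
  assumes \<phi>: "\<phi> \<in> test_functions I" and S: "closed S" "is_interval S"
    and g: "continuous_on S g" "\<And>s. s \<in> S \<Longrightarrow> norm (g s) \<le> D"
  shows "(\<lambda>s. fourier \<phi> (s - t) *\<^sub>C g s) integrable_on S"
proof -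
  from \<phi> obtain C where C: "C > 0" "\<And>s. cmod (fourier \<phi> s) \<le> C * (1 / (1 + s\<^sup>2))"
    by (rule fourier_decay) blast
  show ?thesis
  proof (rule fourier_kernel_integral(1)[OF \<phi> S g(1), of "\<bar>D\<bar>" C 1])
    show "norm (g s) \<le> \<bar>D\<bar>" if "s \<in> S" for s using g(2)[OF that] by simp
  qed (use C in auto)
qed

context bounded_C0_semigroup
begin

text \<open>Up to reflection, the convolution of the zero extension of the orbit with the transform of
  \<open>\<phi>\<close>; equivalently, the boundary resolvent tested against \<open>\<phi>\<close> modulated by \<open>exp (\<i> t \<xi>)\<close>.\<close>

definition orbit_filter :: "'a \<Rightarrow> (real \<Rightarrow> complex) \<Rightarrow> real \<Rightarrow> 'a"
  where "orbit_filter z \<phi> t = integral {0..} (\<lambda>s. fourier \<phi> (s - t) *\<^sub>C T s z)"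

lemma orbit_filter_integrable:
  "\<phi> \<in> test_functions I \<Longrightarrow> (\<lambda>s. fourier \<phi> (s - t) *\<^sub>C T s z) integrable_on {0..}"
  by (rule fourier_kernel_integrable[where D = "M * norm z"])
     (auto intro!: continuous_on_orbit T_bound)

lemma norm_orbit_filter_le:
  assumes \<phi>: "\<phi> \<in> test_functions I" and B: "\<And>s. cmod (fourier \<phi> s) \<le> B * (e / (1 + (e * s)\<^sup>2))"
    and e: "e > 0" "B \<ge> 0"
  shows "norm (orbit_filter z \<phi> t) \<le> B * pi * (M * norm z)"
  unfolding orbit_filter_def
  by (rule fourier_kernel_integral(2)[OF \<phi> _ _ _ _ _ B e])
     (use M_pos in \<open>auto intro!: continuous_on_orbit T_bound\<close>)

lemma orbit_filter_lincomb:
  assumes "\<phi> \<in> test_functions I" "\<psi> \<in> test_functions I"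
  shows "orbit_filter z (\<lambda>\<xi>. a * \<phi> \<xi> + b * \<psi> \<xi>) t = a *\<^sub>C orbit_filter z \<phi> t + b *\<^sub>C orbit_filter z \<psi> t"
proof -
  note i = orbit_filter_integrable[OF assms(1)] orbit_filter_integrable[OF assms(2)]
  have "orbit_filter z (\<lambda>\<xi>. a * \<phi> \<xi> + b * \<psi> \<xi>) t =
      integral {0..} (\<lambda>s. a *\<^sub>C fourier \<phi> (s - t) *\<^sub>C T s z + b *\<^sub>C fourier \<psi> (s - t) *\<^sub>C T s z)"
    unfolding orbit_filter_def fourier_lincomb[OF assms] by (simp add: scaleC_add_left scaleC_scaleC)
  also have "\<dots> = a *\<^sub>C orbit_filter z \<phi> t + b *\<^sub>C orbit_filter z \<psi> t"
    unfolding orbit_filter_def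
    by (simp add: integral_add integral_scaleC_right[OF i(1)] integral_scaleC_right[OF i(2)])
  finally show ?thesis .
qed

lemma orbit_filter_diff:
  assumes "\<phi> \<in> test_functions I"
  shows "orbit_filter (y - z) \<phi> t = orbit_filter y \<phi> t - orbit_filter z \<phi> t"
proof -
  note i = orbit_filter_integrable[OF assms]
  have "orbit_filter (y - z) \<phi> t =
      integral {0..} (\<lambda>s. fourier \<phi> (s - t) *\<^sub>C T s y - fourier \<phi> (s - t) *\<^sub>C T s z)"
    unfolding orbit_filter_def by (rule integral_cong) (simp add: T_diff scaleC_diff_right)
  then show ?thesis unfolding orbit_filter_def by (simp add: integral_diff[OF i i])
qed

lemma orbit_filter_modulation:
  "orbit_filter z (\<lambda>\<xi>. \<phi> \<xi> * exp (\<i> * of_real t * of_real \<xi>)) 0 = orbit_filter z \<phi> t"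
  unfolding orbit_filter_def fourier_modulation by simp

text \<open>The damping factor is \<open>exp (- \<alpha> t)\<close> with \<open>\<alpha> = e\<^sup>2\<close>. Before \<open>t = 1 / e\<close> it differs from 1 by at
  most \<open>e\<close>; after that time the decaying kernel is at most \<open>2 e\<close> times a Poisson kernel.\<close>

lemma damping_error_le:
  fixes e :: real
  assumes e: "e > 0" and t: "t \<ge> 0"
  shows "(1 - exp (- (e\<^sup>2 * t))) * (1 / (1 + t\<^sup>2)) \<le> e * (1 / (1 + t\<^sup>2)) + 2 * e * (e / (1 + (e * t)\<^sup>2))"
proof -
  have p: "1 + t\<^sup>2 > 0" "1 + (e * t)\<^sup>2 > 0" by (auto intro: add_pos_nonneg)
  show ?thesis
  proof (cases "e * t \<le> 1")
    case True
    have "1 - exp (- (e\<^sup>2 * t)) \<le> e\<^sup>2 * t" using exp_ge_add_one_self[of "- (e\<^sup>2 * t)"] by simp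
    also have "\<dots> \<le> e" using mult_left_mono[OF True, of e] e by (simp add: power2_eq_square mult.assoc)
    finally have "(1 - exp (- (e\<^sup>2 * t))) * (1 / (1 + t\<^sup>2)) \<le> e * (1 / (1 + t\<^sup>2))"
      using p by (intro mult_right_mono) auto
    moreover have "2 * e * (e / (1 + (e * t)\<^sup>2)) \<ge> 0" using e p by simp
    ultimately show ?thesis by linarith
  next
    case False
    then have "(e * t)\<^sup>2 \<ge> 1" by simp
    then have "1 + (e * t)\<^sup>2 \<le> 2 * e\<^sup>2 * (1 + t\<^sup>2)" using e
      by (simp add: power_mult_distrib algebra_simps add_increasing)
    then have "1 / (1 + t\<^sup>2) \<le> 2 * e * (e / (1 + (e * t)\<^sup>2))"
      using p by (simp add: divide_simps power2_eq_square mult.assoc mult.commute mult.left_commute)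
    moreover have "(1 - exp (- (e\<^sup>2 * t))) * (1 / (1 + t\<^sup>2)) \<le> 1 * (1 / (1 + t\<^sup>2))"
      using p by (intro mult_right_mono) auto
    moreover have "e * (1 / (1 + t\<^sup>2)) \<ge> 0" using e p by simp
    ultimately show ?thesis by linarith
  qed
qed

text \<open>Writing the resolvent as a Laplace transform and applying Fubini turns the integral over
  \<open>\<xi>\<close> into the damped filtered orbit; then \<open>\<alpha> \<rightarrow> 0\<close>. In particular, the limit in the definition of
  the boundary resolvent exists on test functions.\<close>

lemma boundary_resolvent_eq:
  assumes \<phi>: "\<phi> \<in> test_functions I"
  shows "boundary_resolvent (generator T) x \<phi> = orbit_filter x \<phi> 0"
proof -
  from \<phi> obtain R where R: "\<And>t. \<bar>t\<bar> > R \<Longrightarrow> \<phi> t = 0"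
    by (rule test_functions_bounded_support) blast
  from \<phi> obtain C where C: "C > 0" "\<And>s. cmod (fourier \<phi> s) \<le> C * (1 / (1 + s\<^sup>2))"
    by (rule fourier_decay) blast
  have c: "continuous_on UNIV \<phi>"
    by (rule smooth_continuous_on_0[OF test_functions_smooth[OF \<phi>]])
  from \<phi> obtain B where B0: "B > 0" and B: "\<And>t. cmod (\<phi> t) \<le> B"
    by (rule test_functions_bounded) blast
  let ?I = "\<lambda>\<alpha>. integral UNIV (\<lambda>\<xi>. \<phi> \<xi> *\<^sub>C resolvent (of_real \<alpha> + \<i> * of_real \<xi>) (generator T) x)"
  let ?K = "\<lambda>\<alpha> t. (of_real (exp (- (\<alpha> * t))) * fourier \<phi> (t - 0)) *\<^sub>C T t x"
  have I: "?I \<alpha> = integral {0..} (?K \<alpha>)" "?K \<alpha> integrable_on {0..}" if \<alpha>: "\<alpha> > 0" for \<alpha>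
  proof -
    let ?H = "\<lambda>\<xi> t. \<phi> \<xi> *\<^sub>C exp (- (of_real \<alpha> + \<i> * of_real \<xi>) * of_real t) *\<^sub>C T t x"
    have \<mu>: "Re (of_real \<alpha> + \<i> * of_real \<xi>) > 0" for \<xi> using \<alpha> by simp
    have H: "integral {0..} (?H \<xi>) = \<phi> \<xi> *\<^sub>C resolvent (of_real \<alpha> + \<i> * of_real \<xi>) (generator T) x" for \<xi>
      unfolding resolvent_eq_laplace[OF \<mu>] laplace_def
      by (rule integral_scaleC_right(1)[OF laplace_integrable[OF \<mu>]])
    have "(\<lambda>\<xi>. integral {0..} (?H \<xi>)) = (\<lambda>\<xi>. if \<xi> \<in> {-R..R} then integral {0..} (?H \<xi>) else 0)"
    proof
      fix \<xi>
      have "\<phi> \<xi> = 0" if "\<xi> \<notin> {-R..R}" using that by (intro R) auto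
      then show "integral {0..} (?H \<xi>) = (if \<xi> \<in> {-R..R} then integral {0..} (?H \<xi>) else 0)" by simp
    qed
    then have "integral UNIV (\<lambda>\<xi>. integral {0..} (?H \<xi>)) =
        integral UNIV (\<lambda>\<xi>. if \<xi> \<in> {-R..R} then integral {0..} (?H \<xi>) else 0)"
      by (rule arg_cong)
    then have "?I \<alpha> = integral {-R..R} (\<lambda>\<xi>. integral {0..} (?H \<xi>))"
      unfolding H integral_restrict_UNIV .
    moreover have swap: "integral {-R..R} (\<lambda>\<xi>. integral {0..} (?H \<xi>)) =
        integral {0..} (\<lambda>t. integral {-R..R} (\<lambda>\<xi>. ?H \<xi> t))"
      "(\<lambda>t. integral {-R..R} (\<lambda>\<xi>. ?H \<xi> t)) integrable_on {0..}"
    proof -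
      have h: "(\<lambda>t. B * (exp (- \<alpha> * t) * (M * norm x))) integrable_on {0..}"
        by (intro integrable_on_mult_right integrable_on_mult_left integrable_on_exp_minus_to_infinity \<alpha>)
      have cH: "continuous_on ({-R..R} \<times> {0..}) (\<lambda>(\<xi>, t). ?H \<xi> t)"
        unfolding split_beta
        by (intro continuous_intros continuous_on_compose2[OF c] continuous_on_compose2[OF continuous_on_orbit]) auto
      have b: "norm (?H \<xi> t) \<le> B * (exp (- \<alpha> * t) * (M * norm x))" if "\<xi> \<in> {-R..R}" "t \<in> {0..}" for \<xi> t
        unfolding norm_scaleC using B[of \<xi>] T_bound[of t x] that B0
        by (intro mult_mono) (auto simp: norm_exp_eq_Re)
      show "integral {-R..R} (\<lambda>\<xi>. integral {0..} (?H \<xi>)) =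
          integral {0..} (\<lambda>t. integral {-R..R} (\<lambda>\<xi>. ?H \<xi> t))"
        "(\<lambda>t. integral {-R..R} (\<lambda>\<xi>. ?H \<xi> t)) integrable_on {0..}"
        using integral_swap_dominated(1,2)[OF _ _ cH h b] by auto
    qed
    moreover have inner: "integral {-R..R} (\<lambda>\<xi>. ?H \<xi> t) = ?K \<alpha> t" for t
    proof -
      have "?H \<xi> t = (of_real (exp (- (\<alpha> * t))) * (exp (- \<i> * of_real t * of_real \<xi>) * \<phi> \<xi>)) *\<^sub>C T t x" for \<xi>
      proof -
        have "exp (- (of_real \<alpha> + \<i> * of_real \<xi>) * of_real t) =
            of_real (exp (- (\<alpha> * t))) * exp (- \<i> * of_real t * of_real \<xi>)"
          unfolding exp_of_real[symmetric] mult_exp_exp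
          by (rule arg_cong[of _ _ exp]) (simp add: algebra_simps)
        then show ?thesis by (simp add: scaleC_scaleC mult_ac)
      qed
      moreover have i: "(\<lambda>\<xi>. exp (- \<i> * of_real t * of_real \<xi>) * \<phi> \<xi>) integrable_on {-R..R}"
        by (intro integrable_continuous_interval continuous_intros continuous_on_subset[OF c]) auto
      moreover have "integral {-R..R} (\<lambda>\<xi>. exp (- \<i> * of_real t * of_real \<xi>) * \<phi> \<xi>) = fourier \<phi> t"
        by (rule fourier_eq_integral_Icc[symmetric], rule R) auto
      ultimately show ?thesis
        by (simp add: integral_scaleC_left integrable_on_mult_right)
    qed
    ultimately show "?I \<alpha> = integral {0..} (?K \<alpha>)" by (simp only: inner)
    show "?K \<alpha> integrable_on {0..}" using swap(2) unfolding inner .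
  qed
  have D: "norm (?I \<alpha> - orbit_filter x \<phi> 0) \<le> C * (M * norm x) * (3 * pi) * sqrt \<alpha>" if \<alpha>: "\<alpha> > 0" for \<alpha>
  proof -
    define e where "e = sqrt \<alpha>"
    have e: "e > 0" "\<alpha> = e\<^sup>2" using \<alpha> by (auto simp: e_def)
    let ?h = "\<lambda>t. C * (M * norm x) * (e * (1 / (1 + (t - 0)\<^sup>2)) + 2 * e * (e / (1 + (e * (t - 0))\<^sup>2)))"
    have h: "(?h has_integral C * (M * norm x) * (e * pi + 2 * e * pi)) UNIV"
      by (intro has_integral_mult_right has_integral_add has_integral_Poisson has_integral_Cauchy e)
    have "orbit_filter x \<phi> 0 - ?I \<alpha> = integral {0..} (\<lambda>t. fourier \<phi> (t - 0) *\<^sub>C T t x - ?K \<alpha> t)"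
      unfolding I(1)[OF \<alpha>] orbit_filter_def
      by (rule integral_diff[symmetric, OF orbit_filter_integrable[OF \<phi>] I(2)[OF \<alpha>]])
    also have "norm \<dots> \<le> C * (M * norm x) * (e * pi + 2 * e * pi)"
    proof (rule norm_integral_dominated(2)[OF _ _ _ h])
      show "continuous_on {0..} (\<lambda>t. fourier \<phi> (t - 0) *\<^sub>C T t x - ?K \<alpha> t)"
        by (intro continuous_intros continuous_on_orbit continuous_on_compose2[OF continuous_on_fourier[OF \<phi>, of UNIV]]) auto
      show "0 \<le> ?h t" for t
        using C e M_pos by (intro mult_nonneg_nonneg add_nonneg_nonneg divide_nonneg_nonneg) auto
      show "norm (fourier \<phi> (t - 0) *\<^sub>C T t x - ?K \<alpha> t) \<le> ?h t" if t: "t \<in> {0..}" for t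
      proof -
        have "fourier \<phi> (t - 0) *\<^sub>C T t x - ?K \<alpha> t =
            (of_real (1 - exp (- (\<alpha> * t))) * fourier \<phi> t) *\<^sub>C T t x"
          by (simp add: scaleC_diff_left left_diff_distrib)
        also have "norm \<dots> = (1 - exp (- (\<alpha> * t))) * cmod (fourier \<phi> t) * norm (T t x)"
          unfolding norm_scaleC norm_mult norm_of_real using t \<alpha> by simp
        also have "\<dots> \<le> (1 - exp (- (\<alpha> * t))) * (C * (1 / (1 + t\<^sup>2))) * (M * norm x)"
          using t \<alpha> C T_bound[of t x] by (intro mult_mono) (auto simp: add_nonneg_nonneg)
        also have "\<dots> = C * (M * norm x) * ((1 - exp (- (e\<^sup>2 * t))) * (1 / (1 + t\<^sup>2)))"
          unfolding e(2) by (simp only: mult_ac)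
        also have "\<dots> \<le> ?h t"
          using damping_error_le[OF e(1), of t] t C M_pos by (intro mult_left_mono) auto
        finally show ?thesis .
      qed
    qed auto
    finally show ?thesis unfolding e_def by (simp add: norm_minus_commute algebra_simps)
  qed
  have "((\<lambda>\<alpha>. C * (M * norm x) * (3 * pi) * sqrt \<alpha>) \<longlongrightarrow> C * (M * norm x) * (3 * pi) * sqrt 0) (at_right 0)"
    by (intro tendsto_intros)
  then have "((\<lambda>\<alpha>. C * (M * norm x) * (3 * pi) * sqrt \<alpha>) \<longlongrightarrow> 0) (at_right 0)" by simp
  then have "((\<lambda>\<alpha>. ?I \<alpha> - orbit_filter x \<phi> 0) \<longlongrightarrow> 0) (at_right 0)"
    by (rule Lim_null_comparison[rotated]) (use D in \<open>auto simp: eventually_at_filter\<close>)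
  then have "(?I \<longlongrightarrow> orbit_filter x \<phi> 0) (at_right 0)" by (simp add: LIM_zero_iff)
  then show ?thesis
    unfolding boundary_resolvent_def by (intro tendsto_Lim) (auto simp: trivial_limit_at_right_real)
qed

lemma boundary_resolvent_lincomb:
  assumes "\<phi> \<in> test_functions I" "\<psi> \<in> test_functions I"
  shows "boundary_resolvent (generator T) x (\<lambda>\<xi>. a * \<phi> \<xi> + b * \<psi> \<xi>) =
    a *\<^sub>C boundary_resolvent (generator T) x \<phi> + b *\<^sub>C boundary_resolvent (generator T) x \<psi>"
  unfolding boundary_resolvent_eq[OF assms(1)] boundary_resolvent_eq[OF assms(2)]
    boundary_resolvent_eq[OF test_functions_lincomb[OF assms]] by (rule orbit_filter_lincomb[OF assms])

text \<open>On functions supported in \<open>[-R, R]\<close> the \<open>L\<^sup>1\<close> norm of the transform, hence the distribution, is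
  controlled by two derivatives.\<close>

lemma boundary_resolvent_distribution: "boundary_resolvent (generator T) x \<in> distributions UNIV"
proof -
  let ?F = "boundary_resolvent (generator T) x"
  have nbhd: "basic_nbhd_0 UNIV {\<psi> \<in> test_functions UNIV. norm (?F \<psi>) < e}" if e: "e > 0" for e
    unfolding basic_nbhd_0_def
  proof (intro conjI ballI allI impI)
    fix \<phi> \<psi> and a b :: complex
    assume 1: "\<phi> \<in> {\<psi> \<in> test_functions UNIV. norm (?F \<psi>) < e}"
      and 2: "\<psi> \<in> {\<psi> \<in> test_functions UNIV. norm (?F \<psi>) < e}" and ab: "cmod a + cmod b \<le> 1"
    define m where "m = max (norm (?F \<phi>)) (norm (?F \<psi>))"
    have m: "norm (?F \<phi>) \<le> m" "norm (?F \<psi>) \<le> m" "m < e" "m \<ge> 0" using 1 2 by (auto simp: m_def max_def)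
    have "norm (?F (\<lambda>t. a * \<phi> t + b * \<psi> t)) \<le> cmod a * norm (?F \<phi>) + cmod b * norm (?F \<psi>)"
      using 1 2 norm_triangle_ineq[of "a *\<^sub>C ?F \<phi>" "b *\<^sub>C ?F \<psi>"]
      by (simp add: boundary_resolvent_lincomb[of \<phi> UNIV \<psi>] norm_scaleC)
    also have "\<dots> \<le> cmod a * m + cmod b * m"
      using m by (intro add_mono mult_left_mono) auto
    also have "\<dots> \<le> 1 * m" unfolding distrib_right[symmetric] using ab m by (intro mult_right_mono) auto
    also have "\<dots> < e" using m by simp
    finally show "(\<lambda>t. a * \<phi> t + b * \<psi> t) \<in> {\<psi> \<in> test_functions UNIV. norm (?F \<psi>) < e}"
      using 1 2 test_functions_lincomb[of \<phi> UNIV \<psi> a b] by simp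
  next
    fix K assume "compact K \<and> K \<subseteq> (UNIV :: real set)"
    then obtain R0 where R0: "\<And>t. t \<in> K \<Longrightarrow> norm t \<le> R0"
      using compact_imp_bounded bounded_iff by metis
    define R where "R = max 1 R0"
    have R: "R \<ge> 1" "\<And>t. t \<in> K \<Longrightarrow> \<bar>t\<bar> \<le> R" using R0 by (force simp: R_def)+
    define d where "d = e / (4 * R\<^sup>2 * pi * M * (norm x + 1))"
    have pos: "4 * R\<^sup>2 * pi * M * (norm x + 1) > 0"
      using R M_pos by (intro mult_pos_pos) (auto simp: add_nonneg_pos)
    have d: "d > 0" using e pos by (simp add: d_def)
    have "norm (?F \<psi>) < e" if \<psi>: "\<psi> \<in> test_functions K" and small: "\<forall>n\<le>2. \<forall>t. cmod (nth_deriv n \<psi> t) < d" for \<psi>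
    proof -
      have s: "smooth \<psi>" by (rule test_functions_smooth[OF \<psi>])
      have "scale_bounded 0 R (d * R\<^sup>2) \<psi>"
        by (rule scale_bounded_large[OF s R(1)]) (use d small in \<open>auto intro: less_imp_le\<close>)
      moreover have "\<psi> t = 0" if "\<bar>t - 0\<bar> > R" for t
      proof -
        have "t \<notin> K" using R(2)[of t] that by auto
        then show ?thesis using \<psi> unfolding test_functions_def by (metis (mono_tags, lifting) closure_subset mem_Collect_eq subsetD)
      qed
      ultimately have "cmod (fourier \<psi> s) \<le> 4 * (d * R\<^sup>2) * (R / (1 + (R * s)\<^sup>2))" for s
        using R(1) by (intro fourier_scale_bound) auto
      then have "norm (orbit_filter x \<psi> 0) \<le> 4 * (d * R\<^sup>2) * pi * (M * norm x)"
        by (rule norm_orbit_filter_le[OF \<psi>]) (use R(1) d in auto)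
      also have "\<dots> < 4 * (d * R\<^sup>2) * pi * (M * (norm x + 1))"
        using d R(1) M_pos by (intro mult_strict_left_mono mult_pos_pos) auto
      also have "\<dots> = e" unfolding d_def using pos by (simp add: field_simps)
      finally show ?thesis by (simp add: boundary_resolvent_eq[OF \<psi>])
    qed
    then show "\<exists>N. \<exists>\<epsilon>>0. \<forall>\<phi>\<in>test_functions K. (\<forall>n\<le>N. \<forall>t. cmod (nth_deriv n \<phi> t) < \<epsilon>) \<longrightarrow>
        \<phi> \<in> {\<psi> \<in> test_functions UNIV. norm (?F \<psi>) < e}"
      using d test_functions_mono[of K UNIV] by (intro exI[of _ "2::nat"] exI[of _ d]) auto
  qed auto
  have "openin (test_topology UNIV) {\<phi> \<in> test_functions UNIV. ?F \<phi> \<in> W}" if W: "open W" for W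
    unfolding openin_test_topology
  proof (intro conjI ballI)
    fix \<phi> assume \<phi>: "\<phi> \<in> {\<phi> \<in> test_functions UNIV. ?F \<phi> \<in> W}"
    with W obtain e where e: "e > 0" "ball (?F \<phi>) e \<subseteq> W" unfolding open_contains_ball by blast
    have "(\<lambda>t. \<phi> t + \<psi> t) \<in> {\<phi> \<in> test_functions UNIV. ?F \<phi> \<in> W}"
      if \<psi>: "\<psi> \<in> test_functions UNIV" "norm (?F \<psi>) < e" for \<psi>
    proof -
      have "?F (\<lambda>t. \<phi> t + \<psi> t) = ?F \<phi> + ?F \<psi>"
        using boundary_resolvent_lincomb[of \<phi> UNIV \<psi> x 1 1] \<phi> \<psi> by simp
      then have "?F (\<lambda>t. \<phi> t + \<psi> t) \<in> ball (?F \<phi>) e" using \<psi>(2) by (simp add: dist_norm)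
      then show ?thesis
        using e(2) test_functions_lincomb[of \<phi> UNIV \<psi> 1 1] \<phi> \<psi> by auto
    qed
    then show "\<exists>V. basic_nbhd_0 UNIV V \<and> (\<forall>\<psi>\<in>V. (\<lambda>t. \<phi> t + \<psi> t) \<in> {\<phi> \<in> test_functions UNIV. ?F \<phi> \<in> W})"
      using nbhd[OF e(1)] by blast
  qed auto
  then have "continuous_map (test_topology UNIV) euclidean ?F"
    by (simp add: continuous_map_def topspace_test_topology)
  moreover have "?F (\<lambda>t. \<phi> t + \<psi> t) = ?F \<phi> + ?F \<psi>" if "\<phi> \<in> test_functions UNIV" "\<psi> \<in> test_functions UNIV" for \<phi> \<psi>
    using boundary_resolvent_lincomb[OF that, of x 1 1] by simp
  moreover have "?F (\<lambda>t. c * \<phi> t) = c *\<^sub>C ?F \<phi>" if "\<phi> \<in> test_functions UNIV" for \<phi> c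
    using boundary_resolvent_lincomb[OF that that, of x c 0] by simp
  ultimately show ?thesis unfolding distributions_def by blast
qed

text \<open>The boundary resolvent is a distribution on the whole line, so that membership of its singular support
  is a matter of local representations as transforms of \<open>C\<^sub>0\<close> functions.\<close>

lemma notin_sing_supp_iff:
  "\<xi> \<notin> sing_supp_PF (boundary_resolvent (generator T) x) \<longleftrightarrow>
    (\<exists>I. open I \<and> \<xi> \<in> I \<and> (\<exists>g\<in>C0_functions. \<forall>\<phi>\<in>test_functions I.
      orbit_filter x \<phi> 0 = integral UNIV (\<lambda>t. fourier \<phi> t *\<^sub>C g t)))"
proof
  assume "\<xi> \<notin> sing_supp_PF (boundary_resolvent (generator T) x)"
  then obtain I where "open I" "\<xi> \<in> I" "local_pseudofunction_on I (boundary_resolvent (generator T) x)"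
    unfolding sing_supp_PF_def by blast
  then obtain J h where J: "open J" "\<xi> \<in> J" "h \<in> pseudofunctions"
      "\<forall>\<phi>\<in>test_functions J. boundary_resolvent (generator T) x \<phi> = h \<phi>"
    unfolding local_pseudofunction_on_def by blast
  then obtain g where g: "g \<in> C0_functions" "h = fourier_distr (distr_of_fun g)"
    unfolding pseudofunctions_def by blast
  have "orbit_filter x \<phi> 0 = integral UNIV (\<lambda>t. fourier \<phi> t *\<^sub>C g t)" if "\<phi> \<in> test_functions J" for \<phi>
    using J(4) that g(2) by (simp add: boundary_resolvent_eq fourier_distr_def distr_of_fun_def)
  then show "\<exists>I. open I \<and> \<xi> \<in> I \<and> (\<exists>g\<in>C0_functions. \<forall>\<phi>\<in>test_functions I.
      orbit_filter x \<phi> 0 = integral UNIV (\<lambda>t. fourier \<phi> t *\<^sub>C g t))"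
    using J(1,2) g(1) by blast
next
  assume "\<exists>I. open I \<and> \<xi> \<in> I \<and> (\<exists>g\<in>C0_functions. \<forall>\<phi>\<in>test_functions I.
      orbit_filter x \<phi> 0 = integral UNIV (\<lambda>t. fourier \<phi> t *\<^sub>C g t))"
  then obtain I g where I: "open I" "\<xi> \<in> I" "g \<in> C0_functions"
    "\<And>\<phi>. \<phi> \<in> test_functions I \<Longrightarrow> orbit_filter x \<phi> 0 = integral UNIV (\<lambda>t. fourier \<phi> t *\<^sub>C g t)" by blast
  let ?h = "fourier_distr (distr_of_fun g)"
  have h: "?h \<in> pseudofunctions" using I(3) by (auto simp: pseudofunctions_def)
  have eq: "\<forall>\<phi>\<in>test_functions I. boundary_resolvent (generator T) x \<phi> = ?h \<phi>"
    using I(4) by (simp add: boundary_resolvent_eq fourier_distr_def distr_of_fun_def)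
  have "local_pseudofunction_on I (boundary_resolvent (generator T) x)"
    unfolding local_pseudofunction_on_def
    using distributions_restrict[OF boundary_resolvent_distribution, of I] I(1) h eq by blast
  then show "\<xi> \<notin> sing_supp_PF (boundary_resolvent (generator T) x)"
    using I(1,2) unfolding sing_supp_PF_def by blast
qed

end

section \<open>Decay of the filtered orbit\<close>

lemma inverse_quadratic_tendsto_0: "((\<lambda>t::real. 1 / (1 + (t - S)\<^sup>2)) \<longlongrightarrow> 0) at_top"
proof -
  have "filterlim (\<lambda>t::real. - S + t) at_top at_top"
    by (rule filterlim_tendsto_add_at_top[OF tendsto_const filterlim_ident])
  then have "filterlim (\<lambda>t::real. (t - S)\<^sup>2) at_top at_top"
    by (intro filterlim_pow_at_top) simp_all
  then have "filterlim (\<lambda>t::real. 1 + (t - S)\<^sup>2) at_top at_top"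
    by (rule filterlim_tendsto_add_at_top[OF tendsto_const])
  then show ?thesis
    by (intro tendsto_divide_0[OF tendsto_const] filterlim_at_top_imp_at_infinity)
qed

lemma C0_functions_bounded:
  assumes "g \<in> C0_functions"
  obtains D where "D > 0" "\<And>s. norm (g s) \<le> D"
proof -
  have "\<forall>\<^sub>F s in at_infinity. dist (g s) 0 < 1"
    using assms tendstoD[of g 0 at_infinity 1] by (simp add: C0_functions_def)
  then obtain S where S: "\<And>s. norm s \<ge> S \<Longrightarrow> norm (g s) < 1"
    by (auto simp: eventually_at_infinity)
  have "compact (g ` {-S..S})"
    using assms by (intro compact_continuous_image) (auto simp: C0_functions_def elim: continuous_on_subset)
  then obtain B where B: "\<And>s. s \<in> {-S..S} \<Longrightarrow> norm (g s) \<le> B"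
    using compact_imp_bounded bounded_iff by (metis imageI)
  have "norm (g s) \<le> max 1 B" for s
  proof (cases "\<bar>s\<bar> \<ge> S")
    case True then show ?thesis using S[of s] by simp
  next
    case False
    then have "s \<in> {-S..S}" by auto
    then show ?thesis using B[of s] by simp
  qed
  then show ?thesis using that[of "max 1 B"] by simp
qed

text \<open>Outside \<open>[-S, S]\<close> the function \<open>g\<close> is small, and on \<open>[-S, S]\<close> the kernel centred at \<open>t\<close> is small for
  large \<open>t\<close>.\<close>

lemma fourier_kernel_C0_tendsto_0:
  assumes \<phi>: "\<phi> \<in> test_functions I" and g: "g \<in> C0_functions"
  shows "((\<lambda>t. integral UNIV (\<lambda>s. fourier \<phi> (s - t) *\<^sub>C g s)) \<longlongrightarrow> 0) at_top"
proof (rule tendstoI)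
  fix e :: real assume e: "e > 0"
  from \<phi> obtain C where C: "C > 0" "\<And>s. cmod (fourier \<phi> s) \<le> C * (1 / (1 + s\<^sup>2))"
    by (rule fourier_decay) blast
  from g obtain D where D: "D > 0" "\<And>s. norm (g s) \<le> D" by (rule C0_functions_bounded) blast
  define k where "k = e / (2 * C * pi)"
  have k: "k > 0" using e C by (simp add: k_def)
  have "\<forall>\<^sub>F s in at_infinity. dist (g s) 0 < k"
    using g tendstoD[of g 0 at_infinity k] k by (simp add: C0_functions_def)
  then obtain S where S: "\<And>s. norm s \<ge> S \<Longrightarrow> norm (g s) < k"
    by (auto simp: eventually_at_infinity)
  define Q where "Q = C * D * (1 + S\<^sup>2) * pi"
  have bound: "norm (integral UNIV (\<lambda>s. fourier \<phi> (s - t) *\<^sub>C g s)) \<le> e / 2 + Q * (1 / (1 + (t - S)\<^sup>2))"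
    if t: "t \<ge> S" for t
  proof -
    let ?q = "1 / (1 + (t - S)\<^sup>2)"
    let ?h = "\<lambda>s. C * (k * (1 / (1 + (s - t)\<^sup>2))) + C * (D * (1 + S\<^sup>2) * ?q * (1 / (1 + (s - 0)\<^sup>2)))"
    have h: "(?h has_integral C * (k * pi) + C * (D * (1 + S\<^sup>2) * ?q * pi)) UNIV"
      by (intro has_integral_add has_integral_mult_right has_integral_Cauchy)
    have p: "1 + u\<^sup>2 > 0" for u :: real by (intro add_pos_nonneg) auto
    have h0: "C * (k * (1 / (1 + (s - t)\<^sup>2))) \<ge> 0" "C * (D * (1 + S\<^sup>2) * ?q * (1 / (1 + (s - 0)\<^sup>2))) \<ge> 0" for s
      using C D k by (intro mult_nonneg_nonneg divide_nonneg_nonneg add_nonneg_nonneg; simp)+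
    have "norm (fourier \<phi> (s - t) *\<^sub>C g s) \<le> ?h s" for s
    proof (cases "\<bar>s\<bar> \<ge> S")
      case True
      then have "norm (g s) \<le> k" using S[of s] by simp
      then have "norm (fourier \<phi> (s - t) *\<^sub>C g s) \<le> C * (1 / (1 + (s - t)\<^sup>2)) * k"
        unfolding norm_scaleC using C p[of "s - t"] k by (intro mult_mono) (auto simp: add_nonneg_nonneg)
      also have "\<dots> = C * (k * (1 / (1 + (s - t)\<^sup>2)))" by simp
      finally show ?thesis using h0(2)[of s] by linarith
    next
      case False
      have st: "(t - S)\<^sup>2 \<le> (s - t)\<^sup>2" using False t by (intro abs_le_square_iff[THEN iffD1]) auto
      have ss: "s\<^sup>2 \<le> S\<^sup>2" using False by (intro abs_le_square_iff[THEN iffD1]) auto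
      have "1 / (1 + (s - t)\<^sup>2) \<le> ?q" using st p by (intro divide_left_mono mult_pos_pos) auto
      also have "\<dots> \<le> ?q * ((1 + S\<^sup>2) * (1 / (1 + s\<^sup>2)))"
        using ss p[of s] p[of "t - S"] by (simp add: divide_simps) 
      finally have "C * (1 / (1 + (s - t)\<^sup>2)) \<le> C * (?q * ((1 + S\<^sup>2) * (1 / (1 + s\<^sup>2))))"
        by (rule mult_left_mono) (use C in simp)
      with C(2)[of "s - t"] have "cmod (fourier \<phi> (s - t)) \<le> C * (?q * ((1 + S\<^sup>2) * (1 / (1 + s\<^sup>2))))"
        by linarith
      then have "norm (fourier \<phi> (s - t) *\<^sub>C g s) \<le> C * (?q * ((1 + S\<^sup>2) * (1 / (1 + s\<^sup>2)))) * D"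
        unfolding norm_scaleC using D(2)[of s] by (intro mult_mono) (auto intro: order_trans[OF norm_ge_zero])
      also have "\<dots> = C * (D * (1 + S\<^sup>2) * ?q * (1 / (1 + (s - 0)\<^sup>2)))" by simp
      finally show ?thesis using h0(1)[of s] by linarith
    qed
    moreover have "continuous_on UNIV (\<lambda>s. fourier \<phi> (s - t) *\<^sub>C g s)"
      using g by (intro continuous_intros continuous_on_compose2[OF continuous_on_fourier[OF \<phi>, of UNIV]])
        (auto simp: C0_functions_def)
    ultimately have "norm (integral UNIV (\<lambda>s. fourier \<phi> (s - t) *\<^sub>C g s)) \<le>
        C * (k * pi) + C * (D * (1 + S\<^sup>2) * ?q * pi)"
      by (intro norm_integral_dominated(2)[OF _ _ _ h]) (use h0 in \<open>auto intro: add_nonneg_nonneg\<close>)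
    also have "C * (k * pi) = e / 2" using C by (simp add: k_def)
    finally show ?thesis by (simp add: Q_def mult_ac)
  qed
  have "((\<lambda>t. Q * (1 / (1 + (t - S)\<^sup>2))) \<longlongrightarrow> Q * 0) at_top"
    by (intro tendsto_intros inverse_quadratic_tendsto_0)
  then have "\<forall>\<^sub>F t in at_top. Q * (1 / (1 + (t - S)\<^sup>2)) < e / 2"
    by (rule order_tendstoD(2)) (use e in simp)
  moreover have "\<forall>\<^sub>F t in at_top. t \<ge> S" by (rule eventually_ge_at_top)
  ultimately show "\<forall>\<^sub>F t in at_top. dist (integral UNIV (\<lambda>s. fourier \<phi> (s - t) *\<^sub>C g s)) 0 < e"
  proof eventually_elim
    case (elim t)
    then have "norm (integral UNIV (\<lambda>s. fourier \<phi> (s - t) *\<^sub>C g s)) < e"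
      using bound[of t] by linarith
    then show ?case by simp
  qed
qed

text \<open>Otherwise the complements of the points are countably many dense open subsets of \<open>S\<close> with empty
  intersection, against Baire's theorem.\<close>

lemma countable_closed_isolated_point:
  fixes S :: "real set"
  assumes "closed S" "countable S" "S \<noteq> {}"
  obtains \<xi> U where "\<xi> \<in> S" "open U" "U \<inter> S = {\<xi>}"
proof (rule ccontr)
  assume "\<not> thesis"
  then have no: "U \<inter> S \<noteq> {\<xi>}" if "\<xi> \<in> S" "open U" for \<xi> U using that \<open>\<And>\<xi> U. \<xi> \<in> S \<Longrightarrow> open U \<Longrightarrow> U \<inter> S = {\<xi>} \<Longrightarrow> thesis\<close> by blast
  have "S \<subseteq> closure (\<Inter>((\<lambda>\<xi>. S - {\<xi>}) ` S))"
  proof (rule Baire[OF assms(1)])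
    show "countable ((\<lambda>\<xi>. S - {\<xi>}) ` S)" using assms(2) by simp
    fix V assume "V \<in> (\<lambda>\<xi>. S - {\<xi>}) ` S"
    then obtain \<xi> where \<xi>: "\<xi> \<in> S" "V = S - {\<xi>}" by blast
    have "openin (top_of_set S) (S \<inter> (- {\<xi>}))" by (intro openin_open_Int) auto
    then have "openin (top_of_set S) V" using \<xi> by (simp add: Diff_eq)
    moreover have "\<xi> \<in> closure V"
    proof (rule ccontr)
      assume "\<xi> \<notin> closure V"
      then have "open (- closure V)" "\<xi> \<in> - closure V" by auto
      moreover have "- closure V \<inter> S = {\<xi>}"
        using \<open>\<xi> \<notin> closure V\<close> \<xi> closure_subset[of V] by auto
      ultimately show False using no[OF \<xi>(1)] by blast
    qed
    then have "S \<subseteq> closure V" using \<xi> closure_subset[of V] by auto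
    ultimately show "openin (top_of_set S) V \<and> S \<subseteq> closure V" by blast
  qed
  moreover have "\<Inter>((\<lambda>\<xi>. S - {\<xi>}) ` S) = {}" using assms(3) by auto
  ultimately show False using assms(3) by simp
qed

context bounded_C0_semigroup
begin

definition decays_on :: "'a \<Rightarrow> real set \<Rightarrow> bool"
  where "decays_on z I \<longleftrightarrow> (\<forall>\<phi>\<in>test_functions I. (orbit_filter z \<phi> \<longlongrightarrow> 0) at_top)"

lemma decays_onD: "decays_on z I \<Longrightarrow> \<phi> \<in> test_functions I \<Longrightarrow> (orbit_filter z \<phi> \<longlongrightarrow> 0) at_top"
  by (simp add: decays_on_def)

text \<open>The neighbourhood \<open>I\<close> works for all \<open>t\<close> at once, because modulation does not change the support.\<close>

lemma local_pseudofunction_decays: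
  assumes "\<xi> \<notin> sing_supp_PF (boundary_resolvent (generator T) x)"
  obtains I where "open I" "\<xi> \<in> I" "decays_on x I"
proof -
  obtain I g where I: "open I" "\<xi> \<in> I" "g \<in> C0_functions"
    "\<And>\<phi>. \<phi> \<in> test_functions I \<Longrightarrow> orbit_filter x \<phi> 0 = integral UNIV (\<lambda>t. fourier \<phi> t *\<^sub>C g t)"
    using assms unfolding notin_sing_supp_iff by blast
  have "decays_on x I"
    unfolding decays_on_def
  proof
    fix \<phi> assume \<phi>: "\<phi> \<in> test_functions I"
    have "orbit_filter x \<phi> t = integral UNIV (\<lambda>s. fourier \<phi> (s - t) *\<^sub>C g s)" for t
      using I(4)[OF test_functions_mult[OF \<phi> smooth_exp[of "\<i> * of_real t"]]]
      unfolding orbit_filter_modulation fourier_modulation .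
    then show "(orbit_filter x \<phi> \<longlongrightarrow> 0) at_top"
      using fourier_kernel_C0_tendsto_0[OF \<phi> I(3)] by presburger
  qed
  then show ?thesis using that I by blast
qed

lemma orbit_filter_zero: "orbit_filter z (\<lambda>_. 0) = (\<lambda>_. 0)"
  by (simp add: orbit_filter_def[abs_def] fourier_def)

lemma orbit_filter_add_tendsto_0:
  assumes "\<phi> \<in> test_functions I" "\<psi> \<in> test_functions I"
    and "(orbit_filter z \<phi> \<longlongrightarrow> 0) at_top" "(orbit_filter z \<psi> \<longlongrightarrow> 0) at_top"
  shows "(orbit_filter z (\<lambda>\<xi>. \<phi> \<xi> + \<psi> \<xi>) \<longlongrightarrow> 0) at_top"
proof -
  have "orbit_filter z (\<lambda>\<xi>. \<phi> \<xi> + \<psi> \<xi>) = (\<lambda>t. orbit_filter z \<phi> t + orbit_filter z \<psi> t)"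
    using orbit_filter_lincomb[OF assms(1,2), of z 1 1] by auto
  then show ?thesis using tendsto_add[OF assms(3,4)] by simp
qed

text \<open>Telescoping differences of translated smooth steps form a partition of unity. Once the mesh is
  below a Lebesgue number of the cover, each piece of \<open>\<phi>\<close> lives in one member of the cover.\<close>

lemma decays_on_local:
  assumes loc: "\<And>\<xi>. \<xi> \<in> U \<Longrightarrow> \<exists>I. open I \<and> \<xi> \<in> I \<and> decays_on z I"
  shows "decays_on z U"
  unfolding decays_on_def
proof
  fix \<phi> assume \<phi>: "\<phi> \<in> test_functions U"
  from \<phi> obtain K where K: "smooth \<phi>" "compact K" "K \<subseteq> U" "\<And>t. t \<notin> K \<Longrightarrow> \<phi> t = 0"
    by (rule test_functionsE) blast
  show "(orbit_filter z \<phi> \<longlongrightarrow> 0) at_top"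
  proof (cases "K = {}")
    case True
    then have "\<phi> = (\<lambda>_. 0)" using K(4) by auto
    then show ?thesis by (simp add: orbit_filter_zero)
  next
    case False
    define \<C> where "\<C> = {I. open I \<and> decays_on z I}"
    have cover: "K \<subseteq> \<Union>\<C>" unfolding \<C>_def using loc K(3) by blast
    then have "\<C> \<noteq> {}" using False by auto
    have ope: "\<And>I. I \<in> \<C> \<Longrightarrow> open I" by (simp add: \<C>_def)
    obtain \<delta> where \<delta>: "\<delta> > 0" "\<And>V. V \<subseteq> K \<Longrightarrow> diameter V < \<delta> \<Longrightarrow> \<exists>I\<in>\<C>. V \<subseteq> I"
      by (rule Lebesgue_number_lemma[OF K(2) \<open>\<C> \<noteq> {}\<close> cover]) (use ope in blast)+
    define r where "r = \<delta> / 3"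
    have r: "r > 0" "2 * r < \<delta>" using \<delta> by (auto simp: r_def)
    obtain R where R: "\<And>t. t \<in> K \<Longrightarrow> norm t \<le> R"
      using compact_imp_bounded[OF K(2)] bounded_iff by metis
    obtain n :: nat where n: "R / r \<le> real n" using real_arch_simple by blast
    \<comment> \<open>\<open>?f 0\<close> is 1 and \<open>?f (2 n + 2)\<close> is 0 on \<open>[- n r, n r]\<close>, which contains \<open>K\<close>.\<close>
    let ?f = "\<lambda>j \<xi>. smooth_step ((1 / r) * \<xi> + (real n + 1 - real j))"
    let ?p = "\<lambda>j \<xi>. \<phi> \<xi> * (?f j \<xi> - ?f (Suc j) \<xi>)"
    have sf: "smooth (?f j)" for j by (rule nth_deriv_affine(2)[OF smooth_smooth_step])
    have p: "?p j \<in> test_functions U" "(orbit_filter z (?p j) \<longlongrightarrow> 0) at_top" for j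
    proof -
      have sp: "smooth (\<lambda>\<xi>. ?f j \<xi> - ?f (Suc j) \<xi>)" by (intro smooth_diff sf)
      show "?p j \<in> test_functions U" by (rule test_functions_mult[OF \<phi> sp])
      define c where "c = (real j - real n) * r"
      define V where "V = K \<inter> {c - r..c + r}"
      have "diameter V \<le> 2 * r"
        by (rule diameter_le) (use r in \<open>auto simp: V_def dist_real_def\<close>)
      then obtain I where I: "I \<in> \<C>" "V \<subseteq> I" using \<delta>(2)[of V] r by (auto simp: V_def)
      have "?p j \<in> test_functions I"
      proof (rule test_functionsI[of _ V])
        show "smooth (?p j)" by (rule smooth_mult[OF K(1) sp])
        show "compact V" unfolding V_def by (intro compact_Int_closed K) simp
        show "?p j \<xi> = 0" if nV: "\<xi> \<notin> V" for \<xi>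
        proof (cases "\<xi> \<in> K")
          case True
          then consider "\<xi> < c - r" | "\<xi> > c + r" using nV by (force simp: V_def)
          then show ?thesis
          proof cases
            case 1
            then have "(1 / r) * \<xi> + (real n + 1 - real j) \<le> 0"
              using r by (simp add: c_def field_simps)
            then show ?thesis by (simp add: smooth_step_0)
          next
            case 2
            then have "(1 / r) * \<xi> + (real n + 1 - real (Suc j)) \<ge> 1"
              using r by (simp add: c_def field_simps)
            then show ?thesis by (simp add: smooth_step_1)
          qed
        qed (simp add: K(4))
      qed (use I in auto)
      then show "(orbit_filter z (?p j) \<longlongrightarrow> 0) at_top"
        using I(1) decays_onD by (auto simp: \<C>_def)
    qed
    have partial: "(\<lambda>\<xi>. \<Sum>j<m. ?p j \<xi>) \<in> test_functions U \<and>
        (orbit_filter z (\<lambda>\<xi>. \<Sum>j<m. ?p j \<xi>) \<longlongrightarrow> 0) at_top" for m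
    proof (induction m)
      case 0
      have "(\<lambda>_. 0) \<in> test_functions U" by (rule test_functionsI[of _ "{}"]) auto
      moreover have "(orbit_filter z (\<lambda>_. 0) \<longlongrightarrow> 0) at_top"
        unfolding orbit_filter_zero by (rule tendsto_const)
      ultimately show ?case by simp
    next
      case (Suc m)
      then show ?case
        using test_functions_lincomb[of "\<lambda>\<xi>. \<Sum>j<m. ?p j \<xi>" U "?p m" 1 1] p[of m]
          orbit_filter_add_tendsto_0[of "\<lambda>\<xi>. \<Sum>j<m. ?p j \<xi>" U "?p m"] by simp
    qed
    have "(\<lambda>\<xi>. \<Sum>j<2*n+2. ?p j \<xi>) = \<phi>"
    proof
      fix \<xi>
      show "(\<Sum>j<2*n+2. ?p j \<xi>) = \<phi> \<xi>"
      proof (cases "\<xi> \<in> K")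
        case True
        have "\<bar>\<xi>\<bar> \<le> real n * r" using R[OF True] n r by (simp add: field_simps)
        then have \<xi>: "(1 / r) * \<xi> \<le> real n" "- real n \<le> (1 / r) * \<xi>"
          using r by (auto simp: field_simps abs_le_iff)
        have "(\<Sum>j<2*n+2. ?f j \<xi> - ?f (Suc j) \<xi>) = ?f 0 \<xi> - ?f (2*n+2) \<xi>"
          by (rule sum_lessThan_telescope')
        also have "?f 0 \<xi> = 1" by (rule smooth_step_1) (use \<xi> in simp)
        also have "?f (2*n+2) \<xi> = 0" by (rule smooth_step_0) (use \<xi> in simp)
        finally show ?thesis unfolding sum_distrib_left[symmetric] by simp
      qed (simp add: K(4))
    qed
    then show ?thesis using partial[of "2*n+2"] by simp
  qed
qed

text \<open>The range of \<open>\<i> \<xi> - A\<close> consists of limits of difference quotients of the rescaled semigroup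
  \<open>exp (- \<i> \<xi> h) T h\<close>; the factor \<open>1 / h\<close> is absorbed into \<open>y\<close>.\<close>

lemma Range_approximation:
  assumes x: "x \<in> closure (Range (scalar_minus (\<i> * of_real \<xi>) (generator T)))" and k: "k > 0"
  obtains h y where "h > 0" "norm (x - (exp (- \<i> * of_real \<xi> * of_real h) *\<^sub>C T h y - y)) < k"
proof -
  from x k obtain w where w: "w \<in> Range (scalar_minus (\<i> * of_real \<xi>) (generator T))" "norm (x - w) < k / 2"
    unfolding closure_approachable by (metis dist_commute dist_norm half_gt_zero)
  then obtain u v where uv: "(u, v) \<in> generator T" "w = (\<i> * of_real \<xi>) *\<^sub>C u - v"
    by (auto simp: scalar_minus_def)
  let ?c = "- \<i> * of_real \<xi>" let ?E = "\<lambda>h. exp (?c * of_real h)"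
  have "((\<lambda>h. ((?E h - 1) / of_real h) *\<^sub>C u + ?E h *\<^sub>C ((1 / h) *\<^sub>R (T h u - u)))
      \<longlongrightarrow> ?c *\<^sub>C u + exp (?c * of_real 0) *\<^sub>C v) (at_right 0)"
    using uv(1) by (intro tendsto_intros exp_difference_quotient) (simp add: generator_def)
  then have "((\<lambda>h. ((?E h - 1) / of_real h) *\<^sub>C u + ?E h *\<^sub>C ((1 / h) *\<^sub>R (T h u - u))) \<longlongrightarrow> - w) (at_right 0)"
    by (simp add: uv(2) scaleC_minus_left)
  then have "\<forall>\<^sub>F h in at_right 0. dist (((?E h - 1) / of_real h) *\<^sub>C u + ?E h *\<^sub>C ((1 / h) *\<^sub>R (T h u - u))) (- w) < k / 2"
    by (rule tendstoD) (use k in simp)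
  then obtain b where b: "b > 0" "\<And>h. 0 < h \<Longrightarrow> h < b \<Longrightarrow>
      dist (((?E h - 1) / of_real h) *\<^sub>C u + ?E h *\<^sub>C ((1 / h) *\<^sub>R (T h u - u))) (- w) < k / 2"
    unfolding eventually_at_right_field by blast
  define h where "h = b / 2"
  have h: "h > 0" "h < b" using b(1) by (auto simp: h_def)
  define y where "y = - ((1 / h) *\<^sub>R u)"
  have "((?E h - 1) / of_real h) *\<^sub>C u + ?E h *\<^sub>C ((1 / h) *\<^sub>R (T h u - u)) = - (?E h *\<^sub>C T h y - y)"
  proof -
    have "T h y = - ((1 / h) *\<^sub>R T h u)"
      unfolding y_def using T_linear[of h] h by (simp add: linear_simps)
    then show ?thesis
      unfolding y_def by (simp add: scaleR_scaleC scaleC_scaleC scaleC_diff_right scaleC_diff_left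
          scaleC_minus_right diff_divide_distrib)
  qed
  moreover have "dist (- b) (- w) = norm (w - b)" for b
    by (simp add: dist_norm)
  ultimately have *: "norm (w - (?E h *\<^sub>C T h y - y)) < k / 2"
    using b(2)[OF h] by (simp only:)
  have "norm (x - (?E h *\<^sub>C T h y - y)) \<le> norm (x - w) + norm (w - (?E h *\<^sub>C T h y - y))"
    by (rule dist_triangle[of x _ w, unfolded dist_norm])
  also have "\<dots> < k" using w(2) * by simp
  finally show ?thesis using that h(1) by blast
qed

text \<open>Filtering \<open>exp (- \<i> \<xi>0 h) T h y - y\<close> amounts to filtering \<open>y\<close> with a test function that
  vanishes at \<open>\<xi>0\<close>. The last term comes from the part of the orbit lost by the shift.\<close>

lemma orbit_filter_coboundary:
  assumes \<phi>: "\<phi> \<in> test_functions I" and h: "h \<ge> 0"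
  shows "orbit_filter (exp (- \<i> * of_real \<xi>0 * of_real h) *\<^sub>C T h y - y) \<phi> t =
    orbit_filter y (\<lambda>\<xi>. \<phi> \<xi> * (exp (\<i> * of_real h * of_real (\<xi> - \<xi>0)) - 1)) t -
    exp (- \<i> * of_real \<xi>0 * of_real h) *\<^sub>C integral {0..h} (\<lambda>s. fourier \<phi> (s - (t + h)) *\<^sub>C T s y)"
proof -
  let ?c = "exp (- \<i> * of_real \<xi>0 * of_real h)"
  let ?m = "\<lambda>\<xi>. \<phi> \<xi> * exp (\<i> * of_real h * of_real \<xi>)"
  have m: "?m \<in> test_functions I" by (rule test_functions_mult[OF \<phi> smooth_exp])
  have "orbit_filter (T h y) \<phi> t = integral {0..} (\<lambda>s. fourier \<phi> (s + h - (t + h)) *\<^sub>C T (s + h) y)"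
    unfolding orbit_filter_def by (rule integral_cong) (use h in \<open>simp add: T_add\<close>)
  also have "\<dots> = orbit_filter y \<phi> (t + h) - integral {0..h} (\<lambda>s. fourier \<phi> (s - (t + h)) *\<^sub>C T s y)"
    unfolding orbit_filter_def by (rule integral_halfline_shift[OF orbit_filter_integrable[OF \<phi>] h])
  finally have 1: "orbit_filter (T h y) \<phi> t =
    orbit_filter y \<phi> (t + h) - integral {0..h} (\<lambda>s. fourier \<phi> (s - (t + h)) *\<^sub>C T s y)" .
  have 2: "orbit_filter (?c *\<^sub>C T h y) \<phi> t = ?c *\<^sub>C orbit_filter (T h y) \<phi> t"
  proof -
    have "orbit_filter (?c *\<^sub>C T h y) \<phi> t = integral {0..} (\<lambda>s. ?c *\<^sub>C fourier \<phi> (s - t) *\<^sub>C T s (T h y))"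
      unfolding orbit_filter_def by (rule integral_cong) (simp add: T_scaleC scaleC_scaleC mult.commute)
    also have "\<dots> = ?c *\<^sub>C orbit_filter (T h y) \<phi> t"
      unfolding orbit_filter_def by (rule integral_scaleC_right(1)[OF orbit_filter_integrable[OF \<phi>]])
    finally show ?thesis .
  qed
  have 3: "orbit_filter y ?m t = orbit_filter y \<phi> (t + h)"
    unfolding orbit_filter_def fourier_modulation by (simp add: algebra_simps)
  have "exp (\<i> * of_real h * of_real (\<xi> - \<xi>0)) = ?c * exp (\<i> * of_real h * of_real \<xi>)" for \<xi>
    unfolding mult_exp_exp by (rule arg_cong[of _ _ exp]) (simp add: algebra_simps)
  then have "(\<lambda>\<xi>. \<phi> \<xi> * (exp (\<i> * of_real h * of_real (\<xi> - \<xi>0)) - 1)) = (\<lambda>\<xi>. ?c * ?m \<xi> + (- 1) * \<phi> \<xi>)"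
    by (simp add: algebra_simps)
  then have 4: "orbit_filter y (\<lambda>\<xi>. \<phi> \<xi> * (exp (\<i> * of_real h * of_real (\<xi> - \<xi>0)) - 1)) t =
      ?c *\<^sub>C orbit_filter y \<phi> (t + h) - orbit_filter y \<phi> t"
    using orbit_filter_lincomb[OF m \<phi>, of y ?c "- 1" t] unfolding 3 by (simp add: scaleC_minus_left)
  show ?thesis
    unfolding orbit_filter_diff[OF \<phi>] 2 1 4 by (simp add: scaleC_diff_right)
qed

text \<open>The limit of the filtered orbit does not change when \<open>\<psi>\<close> is multiplied by a cut-off at scale
  \<open>\<epsilon>\<close> around \<open>\<xi>0\<close>. After the cut-off, \<open>x\<close> is replaced by \<open>z\<close> at a cost \<open>B0 \<pi> M k\<close> that does
  not depend on \<open>\<epsilon>\<close>, and the filtered orbit of \<open>z\<close> costs only \<open>B1 \<epsilon> \<pi> M norm y\<close> because of the zero of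
  \<open>exp (\<i> h (\<xi> - \<xi>0)) - 1\<close>. Therefore \<open>\<epsilon>\<close> is chosen last.\<close>

lemma decays_on_isolated_point:
  assumes x: "x \<in> closure (Range (scalar_minus (\<i> * of_real \<xi>0) (generator T)))"
    and U: "decays_on x (U - {\<xi>0})"
  shows "decays_on x U"
  unfolding decays_on_def
proof
  fix \<psi> assume \<psi>: "\<psi> \<in> test_functions U"
  from \<psi> obtain K where K: "smooth \<psi>" "compact K" "K \<subseteq> U" "\<And>t. t \<notin> K \<Longrightarrow> \<psi> t = 0"
    by (rule test_functionsE) blast
  obtain P where P: "P > 0" "\<And>e. 0 < e \<Longrightarrow> e \<le> 1 \<Longrightarrow> scale_bounded \<xi>0 e P \<psi>"
    using scale_bounded_smooth[OF K(1)] by metis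
  obtain Q where Q: "Q > 0" "\<And>c e. e > 0 \<Longrightarrow> scale_bounded c e Q (scaled_bump c e)"
    using scale_bounded_bump by metis
  show "(orbit_filter x \<psi> \<longlongrightarrow> 0) at_top"
  proof (rule tendstoI)
    fix e :: real assume e: "e > 0"
    define B0 where "B0 = 4 * (4 * P * Q)"
    have B0: "B0 > 0" using P Q by (simp add: B0_def)
    define k where "k = e / (4 * (B0 * pi * M))"
    have k: "k > 0" using e B0 M_pos by (simp add: k_def)
    obtain h y where h: "h > 0" and hy: "norm (x - (exp (- \<i> * of_real \<xi>0 * of_real h) *\<^sub>C T h y - y)) < k"
      using Range_approximation[OF x k] by metis
    let ?z = "exp (- \<i> * of_real \<xi>0 * of_real h) *\<^sub>C T h y - y"
    define B1 where "B1 = 4 * (4 * (4 * P * Q) * (h + h\<^sup>2))"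
    have B1: "B1 > 0" using P Q h by (simp add: B1_def add_pos_pos)
    \<comment> \<open>The summand 1 only keeps \<open>L\<close> positive when \<open>y = 0\<close>.\<close>
    define L where "L = 4 * (B1 * pi * (M * (norm y + 1)))"
    have L: "L > 0" using B1 M_pos by (simp add: L_def add_nonneg_pos)
    define \<epsilon> where "\<epsilon> = min 1 (e / L)"
    have \<epsilon>: "\<epsilon> > 0" "\<epsilon> \<le> 1" "\<epsilon> \<le> e / L" using e L by (auto simp: \<epsilon>_def)
    let ?\<chi> = "scaled_bump \<xi>0 \<epsilon>"
    let ?\<phi> = "\<lambda>\<xi>. \<psi> \<xi> * ?\<chi> \<xi>"
    let ?E = "\<lambda>\<xi>. exp (\<i> * of_real h * of_real (\<xi> - \<xi>0)) - 1"
    note \<chi> = scaled_bump[OF \<epsilon>(1), where c = \<xi>0]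
    have \<phi>: "?\<phi> \<in> test_functions U" by (rule test_functions_mult[OF \<psi> \<chi>(1)])
    have sb: "scale_bounded \<xi>0 \<epsilon> (4 * P * Q) ?\<phi>"
      by (rule scale_bounded_mult[OF P(2) Q(2)]) (use \<epsilon> in auto)
    have sE: "scale_bounded \<xi>0 \<epsilon> ((h + h\<^sup>2) * \<epsilon>) ?E"
      by (rule scale_bounded_exp_minus_1) (use \<epsilon> h in auto)
    have sbE: "scale_bounded \<xi>0 \<epsilon> (4 * (4 * P * Q) * ((h + h\<^sup>2) * \<epsilon>)) (\<lambda>\<xi>. ?\<phi> \<xi> * ?E \<xi>)"
      by (rule scale_bounded_mult[OF sb sE \<epsilon>(1)])
    have \<phi>E: "(\<lambda>\<xi>. ?\<phi> \<xi> * ?E \<xi>) \<in> test_functions U"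
      by (rule test_functions_mult[OF \<phi>]) (use sE in \<open>simp add: scale_bounded_def\<close>)
    have near: "norm (orbit_filter (x - ?z) ?\<phi> t) \<le> e / 4" for t
    proof -
      have "cmod (fourier ?\<phi> s) \<le> B0 * (\<epsilon> / (1 + (\<epsilon> * s)\<^sup>2))" for s
        unfolding B0_def by (rule fourier_scale_bound[OF sb \<epsilon>(1)]) (use \<chi>(3) in auto)
      then have "norm (orbit_filter (x - ?z) ?\<phi> t) \<le> B0 * pi * (M * norm (x - ?z))"
        by (rule norm_orbit_filter_le[OF \<phi>]) (use \<epsilon> B0 in auto)
      also have "\<dots> \<le> B0 * pi * (M * k)"
        using hy B0 M_pos by (intro mult_left_mono) auto
      also have "\<dots> = e / 4" using B0 M_pos by (simp add: k_def)
      finally show ?thesis .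
    qed
    have small: "norm (orbit_filter y (\<lambda>\<xi>. ?\<phi> \<xi> * ?E \<xi>) t) \<le> e / 4" for t
    proof -
      have "cmod (fourier (\<lambda>\<xi>. ?\<phi> \<xi> * ?E \<xi>) s) \<le> (B1 * \<epsilon>) * (\<epsilon> / (1 + (\<epsilon> * s)\<^sup>2))" for s
        using fourier_scale_bound[OF sbE \<epsilon>(1), of s] by (simp add: \<chi>(3) B1_def mult_ac)
      then have "norm (orbit_filter y (\<lambda>\<xi>. ?\<phi> \<xi> * ?E \<xi>) t) \<le> (B1 * \<epsilon>) * pi * (M * norm y)"
        by (rule norm_orbit_filter_le[OF \<phi>E]) (use \<epsilon> B1 in auto)
      also have "\<dots> \<le> (B1 * \<epsilon>) * pi * (M * (norm y + 1))"
        using \<epsilon> B1 M_pos by (intro mult_left_mono) auto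
      also have "\<dots> = \<epsilon> * L / 4" by (simp add: L_def)
      also have "\<dots> \<le> e / 4" using \<epsilon>(3) L by (simp add: pos_le_divide_eq)
      finally show ?thesis .
    qed
    from \<phi> obtain C where C: "C > 0" "\<And>s. cmod (fourier ?\<phi> s) \<le> C * (1 / (1 + s\<^sup>2))"
      by (rule fourier_decay) blast
    \<comment> \<open>The boundary term lives on the fixed interval \<open>[0, h]\<close>, where the kernel centred at \<open>t + h\<close> decays.\<close>
    let ?r = "\<lambda>t. integral {0..h} (\<lambda>s. fourier ?\<phi> (s - (t + h)) *\<^sub>C T s y)"
    have rem: "norm (?r t) \<le> C * (M * norm y) * h * (1 / (1 + (t - 0)\<^sup>2))" if t: "t \<ge> 0" for t
    proof -
      have "norm (?r t) \<le> C * (1 / (1 + (t - 0)\<^sup>2)) * (M * norm y) * (h - 0)"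
      proof (rule integral_bound)
        show "continuous_on {0..h} (\<lambda>s. fourier ?\<phi> (s - (t + h)) *\<^sub>C T s y)"
          by (intro continuous_intros continuous_on_compose2[OF continuous_on_fourier[OF \<phi>, of UNIV]]
              continuous_on_subset[OF continuous_on_orbit]) auto
        fix s assume s: "s \<in> {0..h}"
        have "(t - 0)\<^sup>2 \<le> (s - (t + h))\<^sup>2" using s t by (intro abs_le_square_iff[THEN iffD1]) auto
        then have "1 / (1 + (s - (t + h))\<^sup>2) \<le> 1 / (1 + (t - 0)\<^sup>2)"
          by (intro divide_left_mono mult_pos_pos add_pos_nonneg) auto
        then have "C * (1 / (1 + (s - (t + h))\<^sup>2)) \<le> C * (1 / (1 + (t - 0)\<^sup>2))"
            by (rule mult_left_mono) (use C in simp)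
        with C(2)[of "s - (t + h)"] have "cmod (fourier ?\<phi> (s - (t + h))) \<le> C * (1 / (1 + (t - 0)\<^sup>2))"
          by linarith
        then show "norm (fourier ?\<phi> (s - (t + h)) *\<^sub>C T s y) \<le> C * (1 / (1 + (t - 0)\<^sup>2)) * (M * norm y)"
          unfolding norm_scaleC using T_bound[of s y] s C by (intro mult_mono) (auto simp: add_nonneg_nonneg)
      qed (use h in simp)
      then show ?thesis by (simp add: mult_ac)
    qed
    have "((\<lambda>t. C * (M * norm y) * h * (1 / (1 + (t - 0)\<^sup>2))) \<longlongrightarrow> C * (M * norm y) * h * 0) at_top"
      by (intro tendsto_intros inverse_quadratic_tendsto_0)
    then have ev1: "\<forall>\<^sub>F t in at_top. C * (M * norm y) * h * (1 / (1 + (t - 0)\<^sup>2)) < e / 4"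
      by (rule order_tendstoD(2)) (use e in simp)
    let ?\<psi>' = "\<lambda>\<xi>. \<psi> \<xi> * (1 - ?\<chi> \<xi>)"
    have "?\<psi>' \<in> test_functions (U - {\<xi>0})"
    proof (rule test_functionsI[of _ "K \<inter> {\<xi>. \<epsilon> / 2 \<le> \<bar>\<xi> - \<xi>0\<bar>}"])
      show "smooth ?\<psi>'" by (intro smooth_mult K smooth_diff smooth_const \<chi>(1))
      show "compact (K \<inter> {\<xi>. \<epsilon> / 2 \<le> \<bar>\<xi> - \<xi>0\<bar>})"
        by (intro compact_Int_closed K closed_Collect_le continuous_intros)
      show "K \<inter> {\<xi>. \<epsilon> / 2 \<le> \<bar>\<xi> - \<xi>0\<bar>} \<subseteq> U - {\<xi>0}" using K(3) \<epsilon> by auto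
      show "?\<psi>' t = 0" if "t \<notin> K \<inter> {\<xi>. \<epsilon> / 2 \<le> \<bar>\<xi> - \<xi>0\<bar>}" for t
        using that K(4)[of t] \<chi>(2)[of t] by auto
    qed
    then have far: "?\<psi>' \<in> test_functions U" "(orbit_filter x ?\<psi>' \<longlongrightarrow> 0) at_top"
      using test_functions_mono[of "U - {\<xi>0}" U] decays_onD[OF U] by auto
    have ev2: "\<forall>\<^sub>F t in at_top. dist (orbit_filter x ?\<psi>' t) 0 < e / 4"
      by (rule tendstoD[OF far(2)]) (use e in simp)
    from ev1 ev2 eventually_ge_at_top[of "0::real"]
    show "\<forall>\<^sub>F t in at_top. dist (orbit_filter x \<psi> t) 0 < e"
    proof eventually_elim
      case (elim t)
      have "orbit_filter x \<psi> t = orbit_filter x ?\<psi>' t + orbit_filter x ?\<phi> t"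
        using orbit_filter_lincomb[OF far(1) \<phi>, of x 1 1 t] by (simp add: algebra_simps)
      also have "orbit_filter x ?\<phi> t = orbit_filter (x - ?z) ?\<phi> t + orbit_filter ?z ?\<phi> t"
        by (simp add: orbit_filter_diff[OF \<phi>])
      also have "orbit_filter ?z ?\<phi> t = orbit_filter y (\<lambda>\<xi>. ?\<phi> \<xi> * ?E \<xi>) t -
          exp (- \<i> * of_real \<xi>0 * of_real h) *\<^sub>C ?r t"
        by (rule orbit_filter_coboundary[OF \<phi>]) (use h in simp)
      finally have "norm (orbit_filter x \<psi> t) \<le> norm (orbit_filter x ?\<psi>' t) +
          (norm (orbit_filter (x - ?z) ?\<phi> t) + (norm (orbit_filter y (\<lambda>\<xi>. ?\<phi> \<xi> * ?E \<xi>) t) +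
          norm (exp (- \<i> * of_real \<xi>0 * of_real h) *\<^sub>C ?r t)))"
        by (simp only:) (intro norm_triangle_le norm_triangle_le_diff add_mono order_refl)
      moreover have "norm (exp (- \<i> * of_real \<xi>0 * of_real h) *\<^sub>C ?r t) = norm (?r t)"
        by (simp add: norm_scaleC norm_exp_eq_Re)
      moreover have "norm (orbit_filter x ?\<psi>' t) < e / 4" using elim by simp
      ultimately have "norm (orbit_filter x \<psi> t) < e"
        using near[of t] small[of t] rem[OF elim(3)] elim(1) by linarith
      then show ?case by simp
    qed
  qed
qed

text \<open>Filtering with a Fourier kernel of total mass \<open>2 \<pi>\<close> that is concentrated near 0
  reproduces \<open>2 \<pi> T t x\<close> up to a small error, because the orbit is uniformly continuous. The
  jump at time 0 is far away when \<open>t\<close> is large.\<close>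

lemma decays_imp_stable:
  assumes "decays_on x UNIV"
  shows "((\<lambda>t. norm (T t x)) \<longlongrightarrow> 0) at_top"
proof (rule tendstoI)
  fix e :: real assume e: "e > 0"
  obtain Q where Q: "Q > 0" "\<And>c e. e > 0 \<Longrightarrow> scale_bounded c e Q (scaled_bump c e)"
    using scale_bounded_bump by metis
  \<comment> \<open>The total error is \<open>8 Q (k \<pi> + Z \<pi> / N)\<close>; \<open>k\<close> and \<open>N\<close> make each part at most \<open>\<pi> e / 2\<close>.\<close>
  define k where "k = e / (16 * Q)"
  have k: "k > 0" using e Q by (simp add: k_def)
  then obtain d where d: "d > 0" "\<And>s t. s \<ge> 0 \<Longrightarrow> t \<ge> 0 \<Longrightarrow> \<bar>t - s\<bar> \<le> d \<Longrightarrow> norm (T t x - T s x) \<le> k"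
    using orbit_modulus[of k x] by metis
  define D where "D = 2 * (M * norm x)"
  have D: "D \<ge> 0" using M_pos by (simp add: D_def)
  define Z where "Z = D * (1 + 1 / d\<^sup>2)"
  have Z: "Z \<ge> 0" using D by (simp add: Z_def)
  define N where "N = 16 * Q * Z / e + 1"
  have N: "N > 0" using Q Z e by (simp add: N_def add_nonneg_pos)
  let ?\<chi> = "scaled_bump 0 N"
  note \<chi> = scaled_bump[OF N, where c = 0]
  have test: "?\<chi> \<in> test_functions UNIV"
    by (rule test_functionsI[of _ "{-N..N}"]) (use \<chi> in \<open>auto simp: abs_le_iff\<close>)
  have decay: "cmod (fourier ?\<chi> s) \<le> 4 * Q * (N / (1 + (N * s)\<^sup>2))" for s
    by (rule fourier_scale_bound[OF Q(2)[OF N] N]) (use \<chi>(3) in auto)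
  have main: "norm (of_real (2 * pi) *\<^sub>C T t x - orbit_filter x ?\<chi> t) \<le> 8 * Q * (k * pi + Z / N * pi)"
    if t: "t > d" for t
  proof -
    have t0: "t \<ge> 0" using t d(1) by simp
    have bd: "norm (T t x) \<le> M * norm x" by (rule T_bound[OF t0])
    then have bD: "norm (T t x) \<le> D" using norm_ge_zero[of "T t x"] unfolding D_def by linarith
    have c: "continuous_on S (\<lambda>s. fourier ?\<chi> (s - t))" for S
      by (intro continuous_intros continuous_on_compose2[OF continuous_on_fourier[OF test, of UNIV]]) auto
    have i: "(\<lambda>s. fourier ?\<chi> (s - t) *\<^sub>C T t x) integrable_on S" if "closed S" "is_interval S" for S
      by (rule fourier_kernel_integrable[OF test that, of _ "norm (T t x)"]) auto
    have mod: "(\<lambda>\<xi>. ?\<chi> \<xi> * exp (\<i> * of_real t * of_real \<xi>)) \<in> test_functions UNIV"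
      by (rule test_functions_mult[OF test smooth_exp])
    have "integral UNIV (\<lambda>s. fourier ?\<chi> (s - t)) = of_real (2 * pi)"
      using fourier_inversion_0[OF mod] \<chi>(2)[of 0] N unfolding fourier_modulation by simp
    moreover have "(\<lambda>s. fourier ?\<chi> (s - t)) integrable_on UNIV"
      using integrable_fourier[OF mod] unfolding fourier_modulation .
    ultimately have "of_real (2 * pi) *\<^sub>C T t x = integral UNIV (\<lambda>s. fourier ?\<chi> (s - t) *\<^sub>C T t x)"
      by (simp add: integral_scaleC_left(1))
    also have "\<dots> = integral {..0} (\<lambda>s. fourier ?\<chi> (s - t) *\<^sub>C T t x) +
        integral {0..} (\<lambda>s. fourier ?\<chi> (s - t) *\<^sub>C T t x)"
    proof -
      have "{..0} \<union> {0..} = (UNIV :: real set)" "{..0} \<inter> {0..} = {0 :: real}" by auto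
      then show ?thesis
        using integral_Un[OF i[of "{..0}"] i[of "{0..}"]] by (simp add: is_interval_ic is_interval_ci)
    qed
    finally have split: "of_real (2 * pi) *\<^sub>C T t x - orbit_filter x ?\<chi> t =
        integral {..0} (\<lambda>s. fourier ?\<chi> (s - t) *\<^sub>C T t x) +
        integral {0..} (\<lambda>s. fourier ?\<chi> (s - t) *\<^sub>C (T t x - T s x))"
      unfolding orbit_filter_def scaleC_diff_right
      by (subst integral_diff) (use i[of "{0..}"] orbit_filter_integrable[OF test] in \<open>auto simp: is_interval_ci\<close>)
    have decay': "cmod (fourier ?\<chi> (s - t)) \<le> 4 * Q * (N / (1 + (N * (s - t))\<^sup>2))" for s
      by (rule decay)
    \<comment> \<open>As \<open>t > d\<close>, no \<open>s \<le> 0\<close> is within distance \<open>d\<close> of \<open>t\<close>, so only the far bound matters here.\<close>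
    have past: "norm (integral {..0} (\<lambda>s. fourier ?\<chi> (s - t) *\<^sub>C T t x)) \<le> 4 * Q * (k * pi + Z / N * pi)"
      unfolding Z_def
      by (rule Poisson_approximation[OF _ _ c _ decay' N _ d(1)])
         (use k D Q t bD in \<open>auto intro!: continuous_intros simp: is_interval_ic\<close>)
    have future: "norm (integral {0..} (\<lambda>s. fourier ?\<chi> (s - t) *\<^sub>C (T t x - T s x)))
        \<le> 4 * Q * (k * pi + Z / N * pi)"
      unfolding Z_def
    proof (rule Poisson_approximation[OF _ _ c _ decay' N _ d(1)])
      show "norm (T t x - T s x) \<le> D" if "s \<in> {0..}" for s
        using bd T_bound[of s x] that norm_triangle_ineq4[of "T t x" "T s x"] by (simp add: D_def)
      show "norm (T t x - T s x) \<le> k" if "s \<in> {0..}" "\<bar>s - t\<bar> \<le> d" for s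
        using d(2)[of s t] t0 that by (simp add: abs_minus_commute)
    qed (use k D Q in \<open>auto intro!: continuous_intros continuous_on_orbit simp: is_interval_ci\<close>)
    have "norm (of_real (2 * pi) *\<^sub>C T t x - orbit_filter x ?\<chi> t) \<le>
        norm (integral {..0} (\<lambda>s. fourier ?\<chi> (s - t) *\<^sub>C T t x)) +
        norm (integral {0..} (\<lambda>s. fourier ?\<chi> (s - t) *\<^sub>C (T t x - T s x)))"
      unfolding split by (rule norm_triangle_ineq)
    also have "\<dots> \<le> 4 * Q * (k * pi + Z / N * pi) + 4 * Q * (k * pi + Z / N * pi)"
      by (rule add_mono[OF past future])
    finally show ?thesis by simp
  qed
  have "8 * Q * (k * pi + Z / N * pi) \<le> pi * e"
  proof -
    have "8 * Q * k = e / 2" using Q by (simp add: k_def)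
    moreover have "8 * Q * (Z / N) \<le> e / 2"
    proof -
      have "16 * Q * Z \<le> e * N" using e by (simp add: N_def field_simps)
      then show ?thesis using N by (simp add: field_simps)
    qed
    ultimately have "8 * Q * k + 8 * Q * (Z / N) \<le> e" by linarith
    then have "(8 * Q * k + 8 * Q * (Z / N)) * pi \<le> e * pi" by (rule mult_right_mono) simp
    then show ?thesis by (simp add: algebra_simps)
  qed
  have "(orbit_filter x ?\<chi> \<longlongrightarrow> 0) at_top" by (rule decays_onD[OF assms test])
  then have "\<forall>\<^sub>F t in at_top. dist (orbit_filter x ?\<chi> t) 0 < pi * e"
    by (rule tendstoD) (use e in simp)
  with eventually_gt_at_top[of d]
  show "\<forall>\<^sub>F t in at_top. dist (norm (T t x)) 0 < e"
  proof eventually_elim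
    case (elim t)
    have "norm (of_real (2 * pi) *\<^sub>C T t x) \<le>
        norm (of_real (2 * pi) *\<^sub>C T t x - orbit_filter x ?\<chi> t) + norm (orbit_filter x ?\<chi> t)"
      using norm_triangle_ineq[of "of_real (2 * pi) *\<^sub>C T t x - orbit_filter x ?\<chi> t"
          "orbit_filter x ?\<chi> t"] by simp
    also have "\<dots> < pi * e + pi * e"
      using main[OF elim(1)] \<open>8 * Q * (k * pi + Z / N * pi) \<le> pi * e\<close> elim(2) by simp
    finally have "pi * (2 * norm (T t x)) < pi * (2 * e)" by (simp add: norm_scaleC norm_mult)
    then show ?case by simp
  qed
qed

text \<open>The removal of isolated points is applied to the complement of the largest set of decay \<open>G\<close>, not to
  the singular support, so that decay need not be turned back into local pseudofunction behaviour.\<close>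

lemma countable_spectrum_imp_stable:
  assumes count: "countable (sing_supp_PF (boundary_resolvent (generator T) x))"
    and range: "\<And>\<xi>. \<xi> \<in> sing_supp_PF (boundary_resolvent (generator T) x) \<Longrightarrow>
      x \<in> closure (Range (scalar_minus (\<i> * of_real \<xi>) (generator T)))"
  shows "((\<lambda>t. norm (T t x)) \<longlongrightarrow> 0) at_top"
proof -
  let ?E = "sing_supp_PF (boundary_resolvent (generator T) x)"
  define G where "G = \<Union>{I. open I \<and> decays_on x I}"
  have G: "open G" "\<And>\<xi>. \<xi> \<in> G \<Longrightarrow> \<exists>I. open I \<and> \<xi> \<in> I \<and> decays_on x I"
    by (auto simp: G_def)
  have GE: "- G \<subseteq> ?E"
  proof
    fix \<xi> assume "\<xi> \<in> - G"
    then show "\<xi> \<in> ?E" using local_pseudofunction_decays[of \<xi> x] by (auto simp: G_def)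
  qed
  have "- G = {}"
  proof (rule ccontr)
    assume "- G \<noteq> {}"
    moreover have "countable (- G)" using GE count by (rule countable_subset)
    ultimately obtain \<xi> U where \<xi>: "\<xi> \<in> - G" "open U" "U \<inter> - G = {\<xi>}"
      using countable_closed_isolated_point[of "- G"] G(1) by (metis closed_Compl)
    have "decays_on x (U - {\<xi>})"
      by (rule decays_on_local, rule G(2)) (use \<xi>(3) in blast)
    then have "decays_on x U"
      by (rule decays_on_isolated_point[rotated]) (use range GE \<xi>(1) in blast)
    then show False using \<xi> by (auto simp: G_def)
  qed
  then have "decays_on x UNIV" using G(2) by (intro decays_on_local) auto
  then show ?thesis by (rule decays_imp_stable)
qed

end

text \<open>The transform of the exponential \<open>exp t\<close> on the negative axis is \<open>1 / (1 - \<i> \<xi>)\<close>. A cut-off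
  of this smooth function is the transform of a function in \<open>C\<^sub>0\<close>. Hence, although the truncated
  exponential jumps at 0, near a given point its transform agrees with that of a \<open>C\<^sub>0\<close> function.\<close>

lemma halfline_exponential_pseudofunction:
  obtains L :: "real \<Rightarrow> complex" where "L \<in> C0_functions"
    "\<And>\<phi>. \<phi> \<in> test_functions (ball \<xi>0 1) \<Longrightarrow> integral UNIV (\<lambda>t. fourier \<phi> t * L t) =
      integral {0..} (\<lambda>t. fourier \<phi> (- t) * exp (- of_real t))"
proof -
  let ?\<chi> = "scaled_bump \<xi>0 2" and ?i = "\<lambda>\<xi>. inverse (1 - \<i> * complex_of_real \<xi>)"
  note \<chi> = scaled_bump[where e = 2 and c = \<xi>0, OF zero_less_numeral]
  define R where "R = \<bar>\<xi>0\<bar> + 2"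
  define p where "p \<xi> = ?\<chi> \<xi> * ?i \<xi>" for \<xi>
  define L where "L t = of_real (1 / (2 * pi)) * fourier p (- t)" for t
  have pR: "p t = 0" if "\<bar>t\<bar> > R" for t
    using that \<chi>(3)[of t] by (auto simp: R_def p_def)
  have "smooth (\<lambda>\<xi>. 1 - \<i> * complex_of_real \<xi>)"
  proof (rule smooth_coinduct[of "\<lambda>\<phi>. \<exists>a b. \<phi> = (\<lambda>\<xi>. a + b * complex_of_real \<xi>)"])
    show "\<exists>a b. (\<lambda>\<xi>. 1 - \<i> * complex_of_real \<xi>) = (\<lambda>\<xi>. a + b * complex_of_real \<xi>)"
      by (rule exI[of _ 1], rule exI[of _ "- \<i>"]) simp
    fix \<phi> assume "\<exists>a b. \<phi> = (\<lambda>\<xi>. a + b * complex_of_real \<xi>)"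
    then obtain a b where \<phi>: "\<phi> = (\<lambda>\<xi>. a + b * complex_of_real \<xi>)" by blast
    have "(\<phi> has_vector_derivative b + 0 * complex_of_real t) (at t)" for t
      unfolding \<phi> by (rule has_vector_derivative_real_field) (auto intro!: derivative_eq_intros)
    then show "\<exists>\<phi>'. (\<exists>a b. \<phi>' = (\<lambda>\<xi>. a + b * complex_of_real \<xi>)) \<and>
        (\<forall>t. (\<phi> has_vector_derivative \<phi>' t) (at t))" by blast
  qed
  moreover have "1 - \<i> * complex_of_real \<xi> \<noteq> 0" for \<xi> by (simp add: complex_eq_iff)
  ultimately have si: "smooth ?i" by (rule smooth_inverse)
  have p: "p \<in> test_functions UNIV"
  proof (rule test_functionsI[of _ "{-R..R}"])
    show "smooth p" unfolding p_def[abs_def] by (intro smooth_mult \<chi>(1) si)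
    show "p t = 0" if "t \<notin> {-R..R}" for t using that by (intro pR) auto
  qed auto
  have "continuous_on UNIV L"
    unfolding L_def[abs_def]
    by (intro continuous_intros continuous_on_compose2[OF continuous_on_fourier[OF p, of UNIV]]) auto
  moreover have "(L \<longlongrightarrow> 0) at_infinity"
  proof -
    from p obtain C where C: "\<And>s. cmod (fourier p s) \<le> C * (1 / (1 + s\<^sup>2))"
      by (rule fourier_decay) blast
    have bd: "cmod (L t) \<le> 1 / (2 * pi) * (C * (1 / (1 + (t - 0)\<^sup>2)))" for t
      unfolding L_def norm_mult norm_of_real using C[of "- t"] by (intro mult_mono) auto
    have "((\<lambda>t. 1 / (2 * pi) * (C * (1 / (1 + (t - 0)\<^sup>2)))) \<longlongrightarrow> 1 / (2 * pi) * (C * 0)) at_top"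
      by (intro tendsto_intros inverse_quadratic_tendsto_0) simp
    then have top: "((\<lambda>t. 1 / (2 * pi) * (C * (1 / (1 + (t - 0)\<^sup>2)))) \<longlongrightarrow> 0) at_top" by simp
    then have bot: "((\<lambda>t. 1 / (2 * pi) * (C * (1 / (1 + (t - 0)\<^sup>2)))) \<longlongrightarrow> 0) at_bot"
      unfolding filterlim_at_bot_mirror by simp
    show ?thesis
      unfolding at_infinity_eq_at_top_bot
      by (intro filterlim_sup Lim_null_comparison[OF always_eventually top] Lim_null_comparison[OF always_eventually bot])
         (use bd in blast)+
  qed
  ultimately have "L \<in> C0_functions" by (simp add: C0_functions_def)
  moreover have "integral UNIV (\<lambda>t. fourier \<phi> t * L t) =
      integral {0..} (\<lambda>t. fourier \<phi> (- t) * exp (- of_real t))"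
    if \<phi>I: "\<phi> \<in> test_functions (ball \<xi>0 1)" for \<phi>
  proof -
    have \<phi>: "\<phi> \<in> test_functions UNIV" using \<phi>I test_functions_mono[of "ball \<xi>0 1" UNIV] by blast
    from \<phi>I obtain K where K: "K \<subseteq> ball \<xi>0 1" "\<And>t. t \<notin> K \<Longrightarrow> \<phi> t = 0"
      by (rule test_functionsE) blast
    have \<phi>R: "\<phi> t = 0" if "\<bar>t\<bar> > R" for t
    proof -
      have "t \<notin> ball \<xi>0 1" using that by (auto simp: R_def dist_real_def)
      then show ?thesis using K by blast
    qed
    have \<phi>p: "\<phi> \<xi> * p \<xi> = \<phi> \<xi> * ?i \<xi>" for \<xi>
    proof (cases "\<xi> \<in> K")
      case True
      then have "\<bar>\<xi> - \<xi>0\<bar> \<le> 2 / 2" using K(1) by (auto simp: dist_real_def)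
      then show ?thesis unfolding p_def using \<chi>(2)[of \<xi>] by simp
    qed (simp add: K)
    have "integral UNIV (\<lambda>t. fourier \<phi> t * L t) =
        of_real (1 / (2 * pi)) * integral UNIV (\<lambda>t. fourier \<phi> t * fourier p (- t))"
      unfolding L_def by (subst integral_mult_right[symmetric]) (simp add: algebra_simps)
    also have "\<dots> = integral {-R..R} (\<lambda>\<xi>. \<phi> \<xi> * ?i \<xi>)"
      using fourier_Parseval[OF \<phi> p pR] unfolding \<phi>p by simp
    also have "\<dots> = integral {0..} (\<lambda>t. fourier \<phi> (- t) * exp (- of_real t))"
      by (rule integral_fourier_exp_halfline[OF \<phi>, symmetric]) (rule \<phi>R)
    finally show ?thesis .
  qed
  ultimately show ?thesis by (rule that)
qed

context bounded_C0_semigroup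
begin

text \<open>The zero extension of a stable orbit is in \<open>C\<^sub>0\<close> except for its jump at 0. Continuing it by
  \<open>exp t\<close> on the negative axis removes the jump; the surplus on the transform side is locally the
  transform of a \<open>C\<^sub>0\<close> function, which is subtracted again.\<close>

lemma stable_imp_sing_supp_empty:
  assumes stable: "((\<lambda>t. norm (T t x)) \<longlongrightarrow> 0) at_top"
  shows "sing_supp_PF (boundary_resolvent (generator T) x) = {}"
proof -
  have "\<xi>0 \<notin> sing_supp_PF (boundary_resolvent (generator T) x)" for \<xi>0
    unfolding notin_sing_supp_iff
  proof (intro exI[of _ "ball \<xi>0 1"] conjI)
    obtain L where L: "L \<in> C0_functions" "\<And>\<phi>. \<phi> \<in> test_functions (ball \<xi>0 1) \<Longrightarrow>
        integral UNIV (\<lambda>t. fourier \<phi> t * L t) = integral {0..} (\<lambda>t. fourier \<phi> (- t) * exp (- of_real t))"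
      using halfline_exponential_pseudofunction by metis
    from L(1) obtain D where D: "\<And>s. cmod (L s) \<le> D" by (rule C0_functions_bounded) blast
    have cL: "continuous_on UNIV L" and L0: "(L \<longlongrightarrow> 0) at_infinity"
      using L(1) by (simp_all add: C0_functions_def)
    define f where "f t = (if t \<ge> 0 then T t x else of_real (exp t) *\<^sub>C x)" for t
    define g where "g t = f t - L t *\<^sub>C x" for t
    have cf: "continuous_on UNIV f"
    proof -
      have "continuous_on ({0..} \<union> {..0}) f"
        unfolding f_def[abs_def]
        by (rule continuous_on_cases[where P = "\<lambda>t. t \<ge> 0"])
           (auto intro!: continuous_intros continuous_on_orbit)
      moreover have "{0..} \<union> {..0} = (UNIV :: real set)" by auto
      ultimately show ?thesis by simp
    qed
    have "(f \<longlongrightarrow> 0) at_top"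
    proof -
      have "((\<lambda>t. T t x) \<longlongrightarrow> 0) at_top" using stable by (rule tendsto_norm_zero_cancel)
      then show ?thesis
        by (rule Lim_transform_eventually) (auto simp: f_def intro: eventually_at_top_linorderI[of 0])
    qed
    moreover have "(f \<longlongrightarrow> 0) at_bot"
    proof -
      have "((\<lambda>t. complex_of_real (exp t) *\<^sub>C x) \<longlongrightarrow> of_real 0 *\<^sub>C x) at_bot"
        by (intro tendsto_intros exp_at_bot)
      then have "((\<lambda>t. complex_of_real (exp t) *\<^sub>C x) \<longlongrightarrow> 0) at_bot" by simp
      then show ?thesis
        by (rule Lim_transform_eventually) (auto simp: f_def eventually_at_bot_linorder intro!: exI[of _ "- 1"])
    qed
    ultimately have "(f \<longlongrightarrow> 0) at_infinity"
      by (simp add: at_infinity_eq_at_top_bot filterlim_sup)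
    from tendsto_diff[OF this tendsto_scaleC[OF L0 tendsto_const, of x]]
    have gC0: "g \<in> C0_functions"
      unfolding g_def[abs_def] C0_functions_def by (auto intro!: continuous_intros cf cL)
    have "orbit_filter x \<phi> 0 = integral UNIV (\<lambda>t. fourier \<phi> t *\<^sub>C g t)"
      if \<phi>: "\<phi> \<in> test_functions (ball \<xi>0 1)" for \<phi>
    proof -
      have iL: "(\<lambda>t. fourier \<phi> t * L t) integrable_on UNIV"
        using fourier_kernel_integrable[OF \<phi> closed_UNIV is_interval_univ cL D, of 0]
        by (simp add: scaleC_complex_def)
      have fb: "norm (f t) \<le> (M + 1) * norm x" for t
      proof (cases "t \<ge> 0")
        case True
        then show ?thesis using T_bound[OF True, of x] by (simp add: f_def distrib_right add_increasing2)
      next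
        case False
        then have "exp t * norm x \<le> 1 * norm x" by (intro mult_right_mono) auto
        also have "\<dots> \<le> (M + 1) * norm x" using M_pos by (intro mult_right_mono) auto
        finally show ?thesis using False by (simp add: f_def norm_scaleC)
      qed
      have if_: "(\<lambda>t. fourier \<phi> t *\<^sub>C f t) integrable_on S" if "closed S" "is_interval S" for S
        using fourier_kernel_integrable[OF \<phi> that continuous_on_subset[OF cf] fb, of 0] by simp
      have "(\<lambda>s. fourier \<phi> (s - 0) *\<^sub>C exp (complex_of_real s)) integrable_on {..0}"
        by (rule fourier_kernel_integrable[OF \<phi>, of _ _ 1])
           (auto intro!: continuous_intros simp: is_interval_ic norm_exp_eq_Re)
      then have "(\<lambda>t. fourier \<phi> t * exp (of_real t)) integrable_on {..0}"
        by (simp add: scaleC_complex_def)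
      then have j: "(\<lambda>t. fourier \<phi> (- t) * exp (- of_real t)) integrable_on {0..}"
        using has_integral_reflect_set[OF integrable_integral] by (fastforce simp: atLeast_def)
      have eq: "fourier \<phi> (- t) *\<^sub>C f (- t) = (fourier \<phi> (- t) * exp (- of_real t)) *\<^sub>C x" if "t \<in> {0..}" for t
        using that by (cases "t = 0") (auto simp: f_def scaleC_scaleC exp_of_real exp_minus)
      have neg: "integral {0..} (\<lambda>t. fourier \<phi> (- t) *\<^sub>C f (- t)) = integral UNIV (\<lambda>t. fourier \<phi> t * L t) *\<^sub>C x"
        unfolding L(2)[OF \<phi>] integral_scaleC_left(1)[OF j, symmetric] by (rule integral_cong) (rule eq)
      have ineg: "(\<lambda>t. fourier \<phi> (- t) *\<^sub>C f (- t)) integrable_on {0..}"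
        by (rule integrable_eq[OF integral_scaleC_left(2)[OF j, of x]]) (rule eq[symmetric])
      have pos: "integral {0..} (\<lambda>t. fourier \<phi> t *\<^sub>C f t) = orbit_filter x \<phi> 0"
        unfolding orbit_filter_def by (rule integral_cong) (simp add: f_def)
      have "integral UNIV (\<lambda>t. fourier \<phi> t *\<^sub>C g t) =
          integral UNIV (\<lambda>t. fourier \<phi> t *\<^sub>C f t) - integral UNIV (\<lambda>t. (fourier \<phi> t * L t) *\<^sub>C x)"
        unfolding g_def scaleC_diff_right scaleC_scaleC
        by (rule integral_diff[OF if_ integral_scaleC_left(2)[OF iL]]) auto
      also have "integral UNIV (\<lambda>t. fourier \<phi> t *\<^sub>C f t) =
          integral UNIV (\<lambda>t. fourier \<phi> t * L t) *\<^sub>C x + orbit_filter x \<phi> 0"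
        unfolding neg[symmetric] pos[symmetric]
        by (rule integral_UNIV_halflines[OF if_ ineg]) (auto simp: is_interval_ci)
      finally show ?thesis by (simp add: integral_scaleC_left(1)[OF iL])
    qed
    then show "\<exists>g\<in>C0_functions. \<forall>\<phi>\<in>test_functions (ball \<xi>0 1).
        orbit_filter x \<phi> 0 = integral UNIV (\<lambda>t. fourier \<phi> t *\<^sub>C g t)"
      using gC0 by blast
  qed auto
  then show ?thesis by blast
qed

end

section \<open>Separation by functionals\<close>

text \<open>Hahn-Banach, by Zorn's lemma on the graphs of real functionals dominated by \<open>norm z / d\<close>,
  where \<open>d\<close> bounds the distance from \<open>x\<close> to the subspace. A linear subspace of pairs
  \<open>(z, r)\<close> with \<open>r \<le> norm z / d\<close> is automatically a graph.\<close>

lemma real_separation: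
  fixes V :: "'a::real_normed_vector set"
  assumes V: "subspace V" and x: "x \<notin> closure V"
  obtains g :: "'a \<Rightarrow> real" where "bounded_linear g" "\<And>v. v \<in> V \<Longrightarrow> g v = 0" "g x = 1"
proof -
  obtain d where d: "d > 0" "\<And>v. v \<in> V \<Longrightarrow> d \<le> norm (x - v)"
    using x unfolding closure_approachable by (metis dist_commute dist_norm not_le)
  let ?p = "\<lambda>z :: 'a. norm z / d"
  have p_add: "?p (y + z) \<le> ?p y + ?p z" for y z
    using d norm_triangle_ineq[of y z] by (simp add: divide_right_mono flip: add_divide_distrib)
  have p_scale: "?p (a *\<^sub>R z) = a * ?p z" if "a > 0" for a z using that by simp
  define G0 where "G0 = {(v + a *\<^sub>R x, a) | v a. v \<in> V}"
  define \<H> where "\<H> = {H :: ('a \<times> real) set. subspace H \<and> G0 \<subseteq> H \<and> (\<forall>z r. (z, r) \<in> H \<longrightarrow> r \<le> ?p z)}"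
  have "G0 \<in> \<H>"
  proof -
    have "subspace G0"
      unfolding subspace_def
    proof (intro conjI ballI allI)
      show "0 \<in> G0" using subspace_0[OF V] by (force simp: G0_def zero_prod_def)
    next
      fix s t assume "s \<in> G0" "t \<in> G0"
      then obtain v a w b where *: "v \<in> V" "w \<in> V" "s = (v + a *\<^sub>R x, a)" "t = (w + b *\<^sub>R x, b)"
        by (auto simp: G0_def)
      then have "s + t = ((v + w) + (a + b) *\<^sub>R x, a + b)" by (simp add: algebra_simps)
      then show "s + t \<in> G0" using subspace_add[OF V *(1,2)] unfolding G0_def by blast
    next
      fix c :: real and s assume "s \<in> G0"
      then obtain v a where *: "v \<in> V" "s = (v + a *\<^sub>R x, a)" by (auto simp: G0_def)
      then have "c *\<^sub>R s = (c *\<^sub>R v + (c * a) *\<^sub>R x, c * a)" by (simp add: algebra_simps)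
      then show "c *\<^sub>R s \<in> G0" using subspace_scale[OF V *(1)] unfolding G0_def by blast
    qed
    moreover have "a \<le> ?p (v + a *\<^sub>R x)" if v: "v \<in> V" for v a
    proof (cases "a > 0")
      case True
      have "d \<le> norm (x - (- (1 / a)) *\<^sub>R v)" by (rule d(2)[OF subspace_scale[OF V v]])
      then have "a * d \<le> a * norm (x + (1 / a) *\<^sub>R v)" using True by simp
      also have "\<dots> = norm (a *\<^sub>R (x + (1 / a) *\<^sub>R v))" using True by simp
      also have "a *\<^sub>R (x + (1 / a) *\<^sub>R v) = v + a *\<^sub>R x" using True by (simp add: algebra_simps)
      finally show ?thesis using d(1) by (simp add: field_simps)
    next
      case False
      then show ?thesis using d(1) by (meson divide_nonneg_pos norm_ge_zero not_le order_trans)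
    qed
    ultimately show ?thesis unfolding \<H>_def by (auto simp: G0_def)
  qed
  have "\<exists>H\<in>\<H>. \<forall>X\<in>\<H>. H \<subseteq> X \<longrightarrow> X = H"
  proof (rule subset_Zorn_nonempty)
    show "\<H> \<noteq> {}" using \<open>G0 \<in> \<H>\<close> by blast
    fix \<C> assume \<C>: "\<C> \<noteq> {}" "subset.chain \<H> \<C>"
    then have sub: "\<And>H. H \<in> \<C> \<Longrightarrow> subspace H \<and> G0 \<subseteq> H \<and> (\<forall>z r. (z, r) \<in> H \<longrightarrow> r \<le> ?p z)"
      by (auto simp: subset.chain_def \<H>_def)
    have "subspace (\<Union>\<C>)"
      unfolding subspace_def
    proof (intro conjI ballI allI)
      show "0 \<in> \<Union>\<C>" using \<C>(1) sub subspace_0 by blast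
    next
      fix s t assume "s \<in> \<Union>\<C>" "t \<in> \<Union>\<C>"
      then obtain H1 H2 where H: "H1 \<in> \<C>" "s \<in> H1" "H2 \<in> \<C>" "t \<in> H2" by blast
      then consider "H1 \<subseteq> H2" | "H2 \<subseteq> H1" using \<C>(2) unfolding subset.chain_def by blast
      then show "s + t \<in> \<Union>\<C>"
        by cases (use H sub subspace_add in blast)+
    next
      fix c :: real and s assume "s \<in> \<Union>\<C>"
      then show "c *\<^sub>R s \<in> \<Union>\<C>" using sub subspace_scale by blast
    qed
    then show "\<Union>\<C> \<in> \<H>" using \<C>(1) sub unfolding \<H>_def by blast
  qed
  then obtain H where H: "subspace H" "G0 \<subseteq> H" "\<And>z r. (z, r) \<in> H \<Longrightarrow> r \<le> ?p z"
    and max: "\<And>X. X \<in> \<H> \<Longrightarrow> H \<subseteq> X \<Longrightarrow> X = H"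
    by (auto simp: \<H>_def)
  have unique: "r = s" if "(z, r) \<in> H" "(z, s) \<in> H" for z r s
  proof -
    have "(0, r - s) \<in> H" "(0, s - r) \<in> H"
      using subspace_diff[OF H(1) that] subspace_diff[OF H(1) that(2,1)] by simp_all
    then show ?thesis using H(3)[of 0 "r - s"] H(3)[of 0 "s - r"] by simp
  qed
  have total: "\<exists>r. (z, r) \<in> H" for z
  proof (rule ccontr)
    assume z: "\<nexists>r. (z, r) \<in> H"
    define S where "S = {r - ?p (u - z) | u r. (u, r) \<in> H}"
    have le: "r - ?p (u - z) \<le> ?p (w + z) - s" if "(u, r) \<in> H" "(w, s) \<in> H" for u r w s
    proof -
      have "(u + w, r + s) \<in> H" using subspace_add[OF H(1) that] by simp
      then have "r + s \<le> ?p (u + w)" by (rule H(3))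
      also have "\<dots> \<le> ?p (u - z) + ?p (w + z)" using p_add[of "u - z" "w + z"] by simp
      finally show ?thesis by linarith
    qed
    have zero: "(0, 0) \<in> H" using subspace_0[OF H(1)] by (simp add: zero_prod_def)
    have "S \<noteq> {}" using zero by (auto simp: S_def)
    have "bdd_above S" unfolding bdd_above_def S_def using le[OF _ zero] by blast
    \<comment> \<open>Any value between the two sides of \<open>le\<close> extends the functional to \<open>z\<close>.\<close>
    define c where "c = Sup S"
    have c1: "r - c \<le> ?p (u - z)" if "(u, r) \<in> H" for u r
      using cSup_upper[OF _ \<open>bdd_above S\<close>, of "r - ?p (u - z)"] that by (force simp: S_def c_def)
    have c2: "s + c \<le> ?p (w + z)" if "(w, s) \<in> H" for w s
      using cSup_least[OF \<open>S \<noteq> {}\<close>, of "?p (w + z) - s"] le[OF _ that] by (force simp: S_def c_def)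
    let ?X = "span (insert (z, c) H)"
    have "?X \<in> \<H>"
    proof -
      have "t \<le> ?p y" if X: "(y, t) \<in> ?X" for y t
      proof -
        obtain a where "(y, t) - a *\<^sub>R (z, c) \<in> H"
          using X unfolding span_breakdown_eq span_eq_iff[THEN iffD2, OF H(1)] by blast
        then have yt: "(y - a *\<^sub>R z, t - a * c) \<in> H" by simp
        consider "a = 0" | "a > 0" | "a < 0" by linarith
        then show ?thesis
        proof cases
          case 1 then show ?thesis using H(3)[OF yt] by simp
        next
          case 2
          have "((1 / a) *\<^sub>R (y - a *\<^sub>R z), (1 / a) * (t - a * c)) \<in> H"
            using subspace_scale[OF H(1) yt, of "1 / a"] by simp
          then have "(1 / a) * (t - a * c) + c \<le> ?p ((1 / a) *\<^sub>R (y - a *\<^sub>R z) + z)" by (rule c2)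
          moreover have "(1 / a) *\<^sub>R (y - a *\<^sub>R z) + z = (1 / a) *\<^sub>R y" using 2 by (simp add: scaleR_diff_right)
          moreover have "(1 / a) * (t - a * c) + c = (1 / a) * t" using 2 by (simp add: field_simps)
          ultimately have "(1 / a) * t \<le> (1 / a) * ?p y" using p_scale[of "1 / a" y] 2 by simp
          then show ?thesis using 2 by (simp only: mult_le_cancel_left_pos zero_less_divide_1_iff)
        next
          case 3
          define b where "b = - a"
          have b: "b > 0" "a = - b" using 3 by (auto simp: b_def)
          have "((1 / b) *\<^sub>R (y - a *\<^sub>R z), (1 / b) * (t - a * c)) \<in> H"
            using subspace_scale[OF H(1) yt, of "1 / b"] by simp
          then have "(1 / b) * (t - a * c) - c \<le> ?p ((1 / b) *\<^sub>R (y - a *\<^sub>R z) - z)" by (rule c1)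
          moreover have "(1 / b) *\<^sub>R (y - a *\<^sub>R z) - z = (1 / b) *\<^sub>R y" using b by (simp add: scaleR_add_right)
          moreover have "(1 / b) * (t - a * c) - c = (1 / b) * t" using b by (simp add: field_simps)
          ultimately have "(1 / b) * t \<le> (1 / b) * ?p y" using p_scale[of "1 / b" y] b by simp
          then show ?thesis using b(1) by (simp only: mult_le_cancel_left_pos zero_less_divide_1_iff)
        qed
      qed
      moreover have "G0 \<subseteq> ?X" using H(2) span_superset[of "insert (z, c) H"] by blast
      ultimately show ?thesis unfolding \<H>_def by simp
    qed
    then have "?X = H" using max span_superset[of "insert (z, c) H"] by blast
    then show False using z span_base[of "(z, c)" "insert (z, c) H"] by auto
  qed
  define g where "g z = (THE r. (z, r) \<in> H)" for z
  have g: "(z, g z) \<in> H" for z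
    unfolding g_def by (rule theI') (use total unique in blast)
  have gI: "g z = r" if "(z, r) \<in> H" for z r using unique[OF g that] .
  have "bounded_linear g"
  proof (rule bounded_linear_intro)
    show "g (y + z) = g y + g z" for y z by (rule gI) (use subspace_add[OF H(1) g g, of y z] in simp)
    show "g (a *\<^sub>R z) = a *\<^sub>R g z" for a z by (rule gI) (use subspace_scale[OF H(1) g, of a z] in simp)
    show "norm (g z) \<le> norm z * (1 / d)" for z
    proof -
      have "(- z, - g z) \<in> H" using subspace_neg[OF H(1) g[of z]] by simp
      then show ?thesis using H(3)[OF g[of z]] H(3)[of "- z" "- g z"] by (simp add: abs_le_iff)
    qed
  qed
  moreover have "g v = 0" if "v \<in> V" for v
  proof (rule gI)
    have "(v + 0 *\<^sub>R x, 0) \<in> G0" using that unfolding G0_def by blast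
    then show "(v, 0) \<in> H" using H(2) by auto
  qed
  moreover have "g x = 1"
  proof (rule gI)
    have "(0 + 1 *\<^sub>R x, 1) \<in> G0" using subspace_0[OF V] unfolding G0_def by blast
    then show "(x, 1) \<in> H" using H(2) by auto
  qed
  ultimately show ?thesis by (rule that)
qed

text \<open>A real functional \<open>g\<close> is the real part of \<open>z \<mapsto> g z - \<i> g (\<i> z)\<close>.\<close>

lemma complex_separation:
  fixes V :: "'a::complex_normed_vector set"
  assumes V: "subspace V" "\<And>c v. v \<in> V \<Longrightarrow> c *\<^sub>C v \<in> V" and x: "x \<notin> closure V"
  obtains x' :: "'a \<Rightarrow> complex" where "bounded_clinear x'" "\<And>v. v \<in> V \<Longrightarrow> x' v = 0" "x' x \<noteq> 0"
proof -
  obtain g :: "'a \<Rightarrow> real" where g: "bounded_linear g" "\<And>v. v \<in> V \<Longrightarrow> g v = 0" "g x = 1"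
    using real_separation[OF V(1) x] by metis
  interpret g: bounded_linear g by (rule g(1))
  define x' where "x' z = complex_of_real (g z) - \<i> * of_real (g (\<i> *\<^sub>C z))" for z
  have "bounded_linear x'"
    unfolding x'_def[abs_def]
    by (intro bounded_linear_sub bounded_linear_const_mult bounded_linear_compose[OF bounded_linear_of_real]
        g(1) bounded_linear_compose[OF g(1) bounded_linear_scaleC_right])
  moreover have "x' (c *\<^sub>C z) = c *\<^sub>C x' z" for c z
  proof -
    have c: "c = of_real (Re c) + of_real (Im c) * \<i>" by (simp add: complex_eq_iff)
    have "c *\<^sub>C z = Re c *\<^sub>R z + Im c *\<^sub>R (\<i> *\<^sub>C z)"
      by (subst c) (simp add: scaleC_add_left scaleR_scaleC scaleC_scaleC)
    then have 1: "g (c *\<^sub>C z) = Re c * g z + Im c * g (\<i> *\<^sub>C z)"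
      by (simp add: g.add g.scaleR)
    have "\<i> *\<^sub>C c *\<^sub>C z = Re c *\<^sub>R (\<i> *\<^sub>C z) - Im c *\<^sub>R z"
    proof -
      have "\<i> * c = of_real (Re c) * \<i> - of_real (Im c)" by (simp add: complex_eq_iff)
      then show ?thesis by (simp add: scaleC_scaleC scaleC_diff_left scaleR_scaleC)
    qed
    then have 2: "g (\<i> *\<^sub>C c *\<^sub>C z) = Re c * g (\<i> *\<^sub>C z) - Im c * g z"
      by (simp add: g.diff g.scaleR)
    show ?thesis unfolding x'_def 1 2 scaleC_complex_def by (simp add: complex_eq_iff)
  qed
  ultimately have "bounded_clinear x'" by (simp add: bounded_clinear_def)
  moreover have "x' v = 0" if "v \<in> V" for v using g(2) V(2)[OF that] that by (simp add: x'_def)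
  moreover have "x' x \<noteq> 0" using g(3) by (simp add: x'_def complex_eq_iff)
  ultimately show ?thesis by (rule that)
qed

section \<open>Stability of a single orbit\<close>

context bounded_C0_semigroup
begin

lemma generator_subspace:
  assumes "(u, v) \<in> generator T"
  shows "(c *\<^sub>C u, c *\<^sub>C v) \<in> generator T"
    and "(u', v') \<in> generator T \<Longrightarrow> (u + u', v + v') \<in> generator T"
proof -
  have "((\<lambda>t. c *\<^sub>C (1 / t) *\<^sub>R (T t u - u)) \<longlongrightarrow> c *\<^sub>C v) (at_right 0)"
    using assms by (intro tendsto_intros) (simp add: generator_def)
  then have "((\<lambda>t. (1 / t) *\<^sub>R (T t (c *\<^sub>C u) - c *\<^sub>C u)) \<longlongrightarrow> c *\<^sub>C v) (at_right 0)"
    by (rule Lim_transform_eventually)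
       (auto simp: eventually_at_filter T_scaleC scaleR_scaleC scaleC_scaleC scaleC_diff_right mult.commute)
  then show "(c *\<^sub>C u, c *\<^sub>C v) \<in> generator T" by (simp add: generator_def)
next
  assume "(u', v') \<in> generator T"
  with assms have "((\<lambda>t. (1 / t) *\<^sub>R (T t u - u) + (1 / t) *\<^sub>R (T t u' - u')) \<longlongrightarrow> v + v') (at_right 0)"
    by (intro tendsto_intros) (simp_all add: generator_def)
  then have "((\<lambda>t. (1 / t) *\<^sub>R (T t (u + u') - (u + u'))) \<longlongrightarrow> v + v') (at_right 0)"
    by (rule Lim_transform_eventually) (auto simp: eventually_at_filter T_plus algebra_simps)
  then show "(u + u', v + v') \<in> generator T" by (simp add: generator_def)
qed

lemma Range_subspace:
  shows "subspace (Range (scalar_minus \<mu> (generator T)))"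
    and "w \<in> Range (scalar_minus \<mu> (generator T)) \<Longrightarrow> c *\<^sub>C w \<in> Range (scalar_minus \<mu> (generator T))"
proof -
  let ?V = "Range (scalar_minus \<mu> (generator T))"
  have V: "w \<in> ?V \<longleftrightarrow> (\<exists>u v. (u, v) \<in> generator T \<and> w = \<mu> *\<^sub>C u - v)" for w
    by (auto simp: scalar_minus_def)
  show scale: "c *\<^sub>C w \<in> ?V" if "w \<in> ?V" for c w
  proof -
    from that obtain u v where uv: "(u, v) \<in> generator T" "w = \<mu> *\<^sub>C u - v" unfolding V by blast
    have "c *\<^sub>C w = \<mu> *\<^sub>C (c *\<^sub>C u) - c *\<^sub>C v"
      unfolding uv(2) by (simp add: scaleC_diff_right scaleC_scaleC mult.commute)
    then show ?thesis unfolding V using generator_subspace(1)[OF uv(1)] by blast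
  qed
  have "(0, 0) \<in> generator T" by (auto simp: generator_def T_scaleR[of _ 0 0, simplified] eventually_at_filter intro!: tendsto_eventually)
  then have "\<mu> *\<^sub>C 0 - 0 \<in> ?V" unfolding V by blast
  then have "0 \<in> ?V" by simp
  moreover have "w + w' \<in> ?V" if "w \<in> ?V" "w' \<in> ?V" for w w'
  proof -
    from that obtain u v u' v' where uv: "(u, v) \<in> generator T" "w = \<mu> *\<^sub>C u - v"
      "(u', v') \<in> generator T" "w' = \<mu> *\<^sub>C u' - v'" unfolding V by blast
    have "w + w' = \<mu> *\<^sub>C (u + u') - (v + v')" unfolding uv by (simp add: scaleC_add_right)
    then show ?thesis unfolding V using generator_subspace(2)[OF uv(1,3)] by blast
  qed
  moreover have "r *\<^sub>R w \<in> ?V" if "w \<in> ?V" for r w unfolding scaleR_scaleC by (rule scale[OF that])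
  ultimately show "subspace ?V" unfolding subspace_def by blast
qed

text \<open>A functional vanishing on the range is constant on \<open>\<alpha> R(\<alpha> + \<i> \<xi>, A) x\<close>, which differs from
  \<open>x\<close> by an element of the range.\<close>

lemma weak_ergodic_imp_closure_Range:
  assumes weak: "weakly_tendsto (\<lambda>\<alpha>. \<alpha> *\<^sub>R resolvent (of_real \<alpha> + \<i> * of_real \<xi>) (generator T) x) 0 (at_right 0)"
  shows "x \<in> closure (Range (scalar_minus (\<i> * of_real \<xi>) (generator T)))"
proof (rule ccontr)
  let ?V = "Range (scalar_minus (\<i> * of_real \<xi>) (generator T))"
  assume "x \<notin> closure ?V"
  then obtain x' :: "'a \<Rightarrow> complex" where x': "bounded_clinear x'" "\<And>v. v \<in> ?V \<Longrightarrow> x' v = 0" "x' x \<noteq> 0"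
    using complex_separation[OF Range_subspace(1) Range_subspace(2)] by metis
  interpret x': bounded_linear x' using x'(1) by (simp add: bounded_clinear_def)
  have const: "x' (\<alpha> *\<^sub>R resolvent (of_real \<alpha> + \<i> * of_real \<xi>) (generator T) x) = x' x" if \<alpha>: "\<alpha> > 0" for \<alpha>
  proof -
    let ?\<mu> = "of_real \<alpha> + \<i> * of_real \<xi>"
    have \<mu>: "Re ?\<mu> > 0" using \<alpha> by simp
    have "(\<i> * of_real \<xi>) *\<^sub>C laplace ?\<mu> x - (?\<mu> *\<^sub>C laplace ?\<mu> x - x) \<in> ?V"
      using laplace_in_generator[OF \<mu>, of x] by (force simp: scalar_minus_def)
    also have "(\<i> * of_real \<xi>) *\<^sub>C laplace ?\<mu> x - (?\<mu> *\<^sub>C laplace ?\<mu> x - x) = x - \<alpha> *\<^sub>R laplace ?\<mu> x"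
      by (simp add: scaleC_add_left scaleR_scaleC)
    finally show ?thesis unfolding resolvent_eq_laplace[OF \<mu>] using x'(2) x'.diff by fastforce
  qed
  have "((\<lambda>\<alpha>. x' (\<alpha> *\<^sub>R resolvent (of_real \<alpha> + \<i> * of_real \<xi>) (generator T) x)) \<longlongrightarrow> x' 0) (at_right 0)"
    using weak x'(1) unfolding weakly_tendsto_def by blast
  moreover have "((\<lambda>\<alpha>. x' (\<alpha> *\<^sub>R resolvent (of_real \<alpha> + \<i> * of_real \<xi>) (generator T) x)) \<longlongrightarrow> x' x) (at_right 0)"
    by (rule tendsto_eventually) (auto simp: eventually_at_filter const)
  ultimately have "x' 0 = x' x" by (rule tendsto_unique[OF trivial_limit_at_right_real])
  then show False using x'(3) x'.zero by simp
qed

end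

lemma tendsto_imp_weakly_tendsto: "(u \<longlongrightarrow> l) F \<Longrightarrow> weakly_tendsto u l F"
  unfolding weakly_tendsto_def bounded_clinear_def by (blast intro: bounded_linear.tendsto)

lemma bounded_semigroup_locale:
  assumes "C0_semigroup T" "bounded_semigroup T"
  obtains M where "bounded_C0_semigroup T M"
proof -
  obtain B where B: "\<And>t. t \<ge> 0 \<Longrightarrow> onorm (T t) \<le> B"
    using assms(2) by (auto simp: bounded_semigroup_def bdd_above_def)
  have "norm (T t x) \<le> max 1 B * norm x" if t: "t \<ge> 0" for t x
  proof -
    have "bounded_linear (T t)" using assms(1) t by (simp add: C0_semigroup_def bounded_clinear_def)
    then have "norm (T t x) \<le> onorm (T t) * norm x" by (rule onorm)
    also have "\<dots> \<le> max 1 B * norm x" using B[OF t] by (intro mult_right_mono) auto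
    finally show ?thesis .
  qed
  then have "bounded_C0_semigroup T (max 1 B)"
    using assms(1) by unfold_locales auto
  then show ?thesis by (rule that)
qed

theorem theorem4p1:
  fixes T :: "real \<Rightarrow> 'a::complex_banach \<Rightarrow> 'a"
    and A :: "('a \<times> 'a) set"
    and x :: 'a
  assumes "C0_semigroup T"
    and "bounded_semigroup T"
    and "A = generator T"
  shows
    "(((\<lambda>t. norm (T t x)) \<longlongrightarrow> 0) at_top \<longleftrightarrow> sigma_PF A x = {}) \<and>
     (((\<lambda>t. norm (T t x)) \<longlongrightarrow> 0) at_top \<longleftrightarrow>
       countable (sigma_PF A x) \<and>
       (\<forall>\<xi>::real. \<i> * of_real \<xi> \<in> sigma_PF A x \<longrightarrow>
         x \<in> closure (Range (scalar_minus (\<i> * of_real \<xi>) A)))) \<and>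
     (((\<lambda>t. norm (T t x)) \<longlongrightarrow> 0) at_top \<longleftrightarrow>
       countable (sigma_PF A x) \<and>
       (\<forall>\<xi>::real. \<i> * of_real \<xi> \<in> sigma_PF A x \<longrightarrow>
         ((\<lambda>\<alpha>. \<alpha> *\<^sub>R resolvent (of_real \<alpha> + \<i> * of_real \<xi>) A x) \<longlongrightarrow> 0) (at_right 0))) \<and>
     (((\<lambda>t. norm (T t x)) \<longlongrightarrow> 0) at_top \<longleftrightarrow>
       countable (sigma_PF A x) \<and>
       (\<forall>\<xi>::real. \<i> * of_real \<xi> \<in> sigma_PF A x \<longrightarrow>
         weakly_tendsto (\<lambda>\<alpha>. \<alpha> *\<^sub>R resolvent (of_real \<alpha> + \<i> * of_real \<xi>) A x) 0 (at_right 0)))"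
    (is "(?a \<longleftrightarrow> ?b) \<and> (?a \<longleftrightarrow> ?n \<and> ?c) \<and> (?a \<longleftrightarrow> ?n \<and> ?d) \<and> (?a \<longleftrightarrow> ?n \<and> ?e)")
proof -
  obtain M where "bounded_C0_semigroup T M"
    using bounded_semigroup_locale[OF assms(1,2)] .
  then interpret bounded_C0_semigroup T M .
  let ?E = "sing_supp_PF (boundary_resolvent (generator T) x)"
  have inj: "inj (\<lambda>\<xi>. \<i> * complex_of_real \<xi>)" by (auto simp: inj_def)
  have mem: "\<i> * complex_of_real \<xi> \<in> sigma_PF A x \<longleftrightarrow> \<xi> \<in> ?E" for \<xi>
    unfolding sigma_PF_def assms(3) by (rule inj_image_mem_iff[OF inj])
  have count: "?n \<longleftrightarrow> countable ?E"
    unfolding sigma_PF_def assms(3) using inj by (intro countable_image_inj_eq) (auto simp: inj_on_def)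
  have ab: "?a \<Longrightarrow> ?b"
    unfolding sigma_PF_def assms(3) using stable_imp_sing_supp_empty by simp
  have empty: "?b \<Longrightarrow> ?n \<and> ?c \<and> ?d \<and> ?e" by simp
  have de: "?d \<Longrightarrow> ?e" using tendsto_imp_weakly_tendsto by blast
  have ec: "?e \<Longrightarrow> ?c" unfolding assms(3) using weak_ergodic_imp_closure_Range by blast
  have ca: "?n \<Longrightarrow> ?c \<Longrightarrow> ?a"
    unfolding count mem unfolding assms(3) by (rule countable_spectrum_imp_stable) blast+
  show ?thesis using ab empty de ec ca by blast
qed

end
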